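(* Let $n\ge 3$ and let $C_n$ be the cycle graph on $n$ vertices. Then $C_n$ is initially Cohen--Macaulay (over a field $\mathbb{K}$) if and only if $n\not\equiv 1\pmod 3$.
   Context: Let $R=\mathbb{K}[x_1,\dots,x_n]$ with the standard grading and $M=(x_1,\dots,x_n)$. $C_n$ has vertices $x_1,\dots,x_n$ and edges $\{x_i,x_{i+1}\}$ for $1\le i<n$ together with $\{x_1,x_n\}$. For a graph $G$ on $x_1,\dots,x_n$, the edge ideal is $I(G)=(x_ix_j\mid \{x_i,x_j\}\in E(G))\subset R$; the independence complex $\Delta_G$ is the simplicial complex of independent sets of $G$, and its Stanley--Reisner ring is $\mathbb{K}[\Delta_G]=R/I(G)$. The initial dimension of a module $N$ is $\mathrm{indim}\,N=\inf\{\dim R/P\mid P\in\mathrm{Ass}_R N\}$. The graph $G$ is initially Cohen--Macaulay over $\mathbb{K}$ if $\mathrm{depth}\,R/I(G)=\mathrm{indim}\,R/I(G)$, depth being taken with respect to $M$. *)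

theory Defs
  imports
    "HOL-Algebra.QuotRing"
    "HOL-Algebra.Module"
    "HOL-Library.Poly_Mapping"
    "HOL-Library.Extended_Nat"
    "HOL-Number_Theory.Cong"
begin

section \<open>Krull dimension, associated primes, regular sequences\<close>

definition krull_dim :: "('a, 'm) ring_scheme \<Rightarrow> enat" where
  "krull_dim A = Sup {enat k | k. \<exists>P. (\<forall>i\<le>k. primeideal (P i) A) \<and> (\<forall>i<k. P i \<subset> P (Suc i))}"

definition self_module :: "('a, 'm) ring_scheme \<Rightarrow> ('a, 'a) module" where
  "self_module R = \<lparr>carrier = carrier R, monoid.mult = monoid.mult R, one = one R, zero = zero R,
    add = add R, smult = monoid.mult R\<rparr>"

text \<open>
  The module structure on \<open>N/H\<close> only involves the carrier, \<open>zero\<close>, \<open>add\<close> and \<open>smult\<close>.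
  The fields \<open>mult\<close> and \<open>one\<close> are part of the record type; they are meaningful only when
  \<open>N\<close> is the ring itself and \<open>H\<close> an ideal.
\<close>

definition quot_module :: "('r, 'b, 'm) module_scheme \<Rightarrow> 'b set \<Rightarrow> ('r, 'b set) module" where
  "quot_module N H = \<lparr>carrier = a_rcosets\<^bsub>N\<^esub> H, monoid.mult = rcoset_mult N H,
    one = H +>\<^bsub>N\<^esub> \<one>\<^bsub>N\<^esub>, zero = H, add = set_add N,
    smult = (\<lambda>r X. \<Union>u\<in>X. H +>\<^bsub>N\<^esub> (r \<odot>\<^bsub>N\<^esub> u))\<rparr>"

definition annihilator :: "('r, 'm) ring_scheme \<Rightarrow> ('r, 'b, 'n) module_scheme \<Rightarrow> 'b \<Rightarrow> 'r set" where
  "annihilator R N u = {r \<in> carrier R. r \<odot>\<^bsub>N\<^esub> u = \<zero>\<^bsub>N\<^esub>}"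

definition associated_primes ::
    "('r, 'm) ring_scheme \<Rightarrow> ('r, 'b, 'n) module_scheme \<Rightarrow> 'r set set" where
  "associated_primes R N = {P. primeideal P R \<and> (\<exists>u\<in>carrier N. P = annihilator R N u)}"

text \<open>As usual, the infimum of the empty set is \<open>\<infinity>\<close>.\<close>

definition indim :: "('r, 'm) ring_scheme \<Rightarrow> ('r, 'b, 'n) module_scheme \<Rightarrow> enat" where
  "indim R N = (INF P\<in>associated_primes R N. krull_dim (R Quot P))"

text \<open>\<open>smult_span R N S\<close> is the submodule \<open>(S)N\<close> of \<open>N\<close>, where \<open>(S)\<close> is the ideal
  generated by \<open>S\<close>.\<close>

definition smult_span ::
    "('r, 'm) ring_scheme \<Rightarrow> ('r, 'b, 'n) module_scheme \<Rightarrow> 'r set \<Rightarrow> 'b set" where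
  "smult_span R N S =
    \<Inter>{H. submodule H R N \<and> (\<forall>s\<in>S. \<forall>u\<in>carrier N. s \<odot>\<^bsub>N\<^esub> u \<in> H)}"

definition nonzerodivisor_on :: "('r, 'b, 'n) module_scheme \<Rightarrow> 'r \<Rightarrow> bool" where
  "nonzerodivisor_on N r \<longleftrightarrow> (\<forall>u\<in>carrier N. r \<odot>\<^bsub>N\<^esub> u = \<zero>\<^bsub>N\<^esub> \<longrightarrow> u = \<zero>\<^bsub>N\<^esub>)"

definition regular_sequence ::
    "('r, 'm) ring_scheme \<Rightarrow> ('r, 'b, 'n) module_scheme \<Rightarrow> 'r list \<Rightarrow> bool" where
  "regular_sequence R N rs \<longleftrightarrow>
    set rs \<subseteq> carrier R \<and>
    (\<forall>i<length rs. nonzerodivisor_on (quot_module N (smult_span R N (set (take i rs)))) (rs ! i)) \<and>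
    smult_span R N (set rs) \<noteq> carrier N"

definition depth ::
    "('r, 'm) ring_scheme \<Rightarrow> 'r set \<Rightarrow> ('r, 'b, 'n) module_scheme \<Rightarrow> enat" where
  "depth R J N = Sup {enat (length rs) | rs. set rs \<subseteq> J \<and> regular_sequence R N rs}"

section \<open>Polynomial rings\<close>

text \<open>
  A polynomial maps monomials \<open>'v \<Rightarrow>\<^sub>0 nat\<close> (finitely supported exponent functions) to
  coefficients. The ring \<open>K[x\<^sub>v | v \<in> V]\<close> consists of those polynomials in which only
  variables indexed by \<open>V\<close> occur.
\<close>

definition poly_ring :: "'v set \<Rightarrow> (('v \<Rightarrow>\<^sub>0 nat) \<Rightarrow>\<^sub>0 'k::field) ring" where
  "poly_ring V = \<lparr>carrier = {p. \<forall>m\<in>Poly_Mapping.keys p. Poly_Mapping.keys m \<subseteq> V},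
    monoid.mult = (*), one = 1, zero = 0, add = (+)\<rparr>"

definition Var :: "'v \<Rightarrow> (('v \<Rightarrow>\<^sub>0 nat) \<Rightarrow>\<^sub>0 'k::field)" where
  "Var v = Poly_Mapping.single (Poly_Mapping.single v 1) 1"

definition irrelevant_ideal :: "'v set \<Rightarrow> (('v \<Rightarrow>\<^sub>0 nat) \<Rightarrow>\<^sub>0 'k::field) set" where
  "irrelevant_ideal V = Idl\<^bsub>poly_ring V\<^esub> (Var ` V)"

section \<open>Graphs and edge ideals\<close>

text \<open>A simple graph is a pair of its vertex set and its set of (two-element) edges.\<close>

type_synonym 'v graph = "'v set \<times> 'v set set"

definition cycle_graph :: "nat \<Rightarrow> nat graph" where
  "cycle_graph n = ({1..n}, {{i, i + 1} | i. 1 \<le> i \<and> i < n} \<union> {{1, n}})"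

definition edge_ideal :: "'v graph \<Rightarrow> (('v \<Rightarrow>\<^sub>0 nat) \<Rightarrow>\<^sub>0 'k::field) set" where
  "edge_ideal G = Idl\<^bsub>poly_ring (fst G)\<^esub> {Var i * Var j | i j. {i, j} \<in> snd G}"

text \<open>\<open>R/I(G)\<close>, the Stanley--Reisner ring of the independence complex of \<open>G\<close>,
  as a module over the polynomial ring \<open>R\<close>.\<close>

definition edge_ring ::
    "'v graph \<Rightarrow> (('v \<Rightarrow>\<^sub>0 nat) \<Rightarrow>\<^sub>0 'k::field, (('v \<Rightarrow>\<^sub>0 nat) \<Rightarrow>\<^sub>0 'k) set) module" where
  "edge_ring G = quot_module (self_module (poly_ring (fst G))) (edge_ideal G)"

definition initially_Cohen_Macaulay :: "'k::field itself \<Rightarrow> 'v graph \<Rightarrow> bool" where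
  "initially_Cohen_Macaulay (_ :: 'k itself) G \<longleftrightarrow>
    (let R = poly_ring (fst G) :: (('v \<Rightarrow>\<^sub>0 nat) \<Rightarrow>\<^sub>0 'k) ring
     in depth R (irrelevant_ideal (fst G)) (edge_ring G) = indim R (edge_ring G))"

end

theory Submission
  imports Defs
begin

text \<open>
  Let \<open>I\<close> be the edge ideal of \<open>C\<^sub>n\<close> and \<open>\<Delta>\<close> its independence complex. The associated primes of
  \<open>R/I\<close> are generated by the complements of the facets of \<open>\<Delta>\<close>, and a facet has at least
  \<open>\<lceil>n/3\<rceil>\<close> elements, so \<open>indim R/I \<ge> \<lceil>n/3\<rceil>\<close>, with equality unless \<open>n \<equiv> 1\<close> modulo 3.

  For lower bounds on the depth, the elementary symmetric polynomials \<open>e\<^sub>1, \<dots>, e\<^sub>d\<close> form a regular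
  sequence on every face ring of a simplex with at least \<open>d\<close> vertices, and regularity passes from
  \<open>R/(I : x)\<close> and \<open>R/(I + (x))\<close> to \<open>R/I\<close>; branching over suitable vertices \<open>x\<close> reduces \<open>\<Delta>\<close> to
  simplices.

  For upper bounds, a regular element in \<open>M\<close> lowers by one the degree of a nonvanishing Koszul
  cohomology class, so a nonzero class in degree \<open>d\<close> bounds the depth by \<open>d\<close>. In the squarefree
  multidegree the Koszul complex of \<open>R/I\<close> is the simplicial cochain complex of \<open>\<Delta>\<close>, which is a
  homology sphere (or a wedge of two) of dimension \<open>\<lceil>(n - 1)/3\<rceil> - 1\<close>; an explicit cocycle is
  paired with an explicit cycle.

  Ideals of the polynomial ring on \<open>x\<^sub>1, \<dots>, x\<^sub>n\<close> are replaced by their preimages in the ring on all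
  \<open>x\<^sub>i\<close>, \<open>i \<in> \<nat>\<close>, under the map killing the remaining variables.
\<close>

section \<open>Ideals and weakly regular sequences\<close>

text \<open>The short exact sequence transfers regularity only if one and the same sequence works on
  both ends, so a single sequence must serve all simplices that the branching reaches. Linear forms
  in general position would need an infinite field; symmetric polynomials in all n variables work
  over any field, since modulo the variables outside a face F they become those of F. The residue 1
  modulo 3 enters twice. Deleting a vertex of the cycle leaves a path on n - 1 vertices, for which
  branching yields ceil((n - 1)/3), and this equals ceil(n/3) exactly when n is not 1 modulo 3.
  Under the same condition the ceil(n/3) vertices 1, 4, 7, ... are independent in the cycle. For n =
  3k + 1, a Koszul class in degree k already separates the depth from the bound k + 1 for the
  initial dimension, so neither value has to be determined. The dimension of R/P is obtained by
  counting: f + 1 algebraically independent polynomials in f variables would have more linearly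
  independent products of bounded degree than there are monomials.\<close>

definition is_ideal :: "'a::comm_ring_1 set \<Rightarrow> bool" where
  "is_ideal J \<longleftrightarrow> 0 \<in> J \<and> (\<forall>x\<in>J. \<forall>y\<in>J. x + y \<in> J) \<and> (\<forall>a. \<forall>x\<in>J. a * x \<in> J)"

definition nzd :: "'a::comm_ring_1 set \<Rightarrow> 'a \<Rightarrow> bool" where
  "nzd J r \<longleftrightarrow> (\<forall>u. r * u \<in> J \<longrightarrow> u \<in> J)"

text \<open>For an ideal J this is J + (r), presented with the cofactor of r as a witness.\<close>

definition adj :: "'a::comm_ring_1 set \<Rightarrow> 'a \<Rightarrow> 'a set" where
  "adj J r = {u. \<exists>a. u - r * a \<in> J}"

abbreviation adjs :: "'a::comm_ring_1 set \<Rightarrow> 'a list \<Rightarrow> 'a set" where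
  "adjs \<equiv> foldl adj"

definition colon :: "'a::comm_ring_1 set \<Rightarrow> 'a \<Rightarrow> 'a set" where
  "colon J x = {u. x * u \<in> J}"

text \<open>Nonvanishing of the last quotient is left out: it is not inherited by
  \<open>colon\<close> and \<open>adj\<close>, which may produce the unit ideal. It returns as
  \<open>1 \<notin> adjs J rs\<close> when regular sequences are translated.\<close>

fun weakly_regular :: "'a::comm_ring_1 set \<Rightarrow> 'a list \<Rightarrow> bool" where
  "weakly_regular J [] \<longleftrightarrow> True"
| "weakly_regular J (r # rs) \<longleftrightarrow> nzd J r \<and> weakly_regular (adj J r) rs"

lemma is_idealI:
  assumes "0 \<in> J" "\<And>x y. x \<in> J \<Longrightarrow> y \<in> J \<Longrightarrow> x + y \<in> J" "\<And>a x. x \<in> J \<Longrightarrow> a * x \<in> J"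
  shows "is_ideal J"
  using assms by (auto simp: is_ideal_def)

lemma
  assumes "is_ideal J"
  shows ideal_zero: "0 \<in> J"
    and ideal_add: "x \<in> J \<Longrightarrow> y \<in> J \<Longrightarrow> x + y \<in> J"
    and ideal_mult: "x \<in> J \<Longrightarrow> a * x \<in> J"
    and ideal_mult_right: "x \<in> J \<Longrightarrow> x * a \<in> J"
  using assms by (auto simp: is_ideal_def mult.commute)

lemma ideal_uminus: "is_ideal J \<Longrightarrow> x \<in> J \<Longrightarrow> - x \<in> J"
  using ideal_mult[of J x "-1"] by simp

lemma ideal_diff: "is_ideal J \<Longrightarrow> x \<in> J \<Longrightarrow> y \<in> J \<Longrightarrow> x - y \<in> J"
  using ideal_add[of J x "-y"] ideal_uminus[of J y] by simp

lemma ideal_sum: "is_ideal J \<Longrightarrow> (\<And>i. i \<in> A \<Longrightarrow> f i \<in> J) \<Longrightarrow> sum f A \<in> J"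
  by (induction A rule: infinite_finite_induct) (auto simp: ideal_zero ideal_add)

lemma ideal_diff_iff: "is_ideal J \<Longrightarrow> x - y \<in> J \<Longrightarrow> x \<in> J \<longleftrightarrow> y \<in> J"
  using ideal_add[of J "x - y" y] ideal_diff[of J x "x - y"] by auto

lemma ideal_adj: 
  assumes "is_ideal J" shows "is_ideal (adj J r)"
proof (rule is_idealI)
  show "0 \<in> adj J r"
    using ideal_zero[OF assms] by (auto simp: adj_def intro!: exI[of _ 0])
next
  fix x y assume "x \<in> adj J r" "y \<in> adj J r"
  then obtain a b where "x - r * a \<in> J" "y - r * b \<in> J" by (auto simp: adj_def)
  then have "(x - r * a) + (y - r * b) \<in> J" by (rule ideal_add[OF assms])
  then have "(x + y) - r * (a + b) \<in> J" by (simp add: algebra_simps)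
  then show "x + y \<in> adj J r" unfolding adj_def by blast
next
  fix c x assume "x \<in> adj J r"
  then obtain a where "x - r * a \<in> J" by (auto simp: adj_def)
  then have "c * (x - r * a) \<in> J" by (rule ideal_mult[OF assms])
  then have "c * x - r * (c * a) \<in> J" by (simp add: algebra_simps)
  then show "c * x \<in> adj J r" unfolding adj_def by blast
qed

lemma ideal_adjs: "is_ideal J \<Longrightarrow> is_ideal (adjs J rs)"
  by (induction rs arbitrary: J) (auto simp: ideal_adj)

lemma subset_adj: "J \<subseteq> adj J r"
  by (auto simp: adj_def intro!: exI[of _ 0])

lemma mem_adj: "is_ideal J \<Longrightarrow> r * a \<in> adj J r"
  by (auto simp: adj_def ideal_zero intro!: exI[of _ a])

lemma adj_minimal: "is_ideal K \<Longrightarrow> J \<subseteq> K \<Longrightarrow> r \<in> K \<Longrightarrow> adj J r \<subseteq> K"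
proof
  fix u assume K: "is_ideal K" "J \<subseteq> K" "r \<in> K" and "u \<in> adj J r"
  then obtain a where "u - r * a \<in> K" by (auto simp: adj_def)
  then show "u \<in> K" using ideal_diff_iff[OF K(1)] ideal_mult_right[OF K(1,3)] by blast
qed

lemma adj_commute: "is_ideal J \<Longrightarrow> adj (adj J r) x = adj (adj J x) r"
proof -
  have "u - x * a - r * b = u - r * b - x * a" for u a b by simp
  then show ?thesis unfolding adj_def mem_Collect_eq by metis
qed

lemma nzd_cong_mod:
  assumes "is_ideal J" "r - s \<in> J" shows "nzd J r \<longleftrightarrow> nzd J s"
proof -
  have "r * a \<in> J \<longleftrightarrow> s * a \<in> J" for a
    using ideal_diff_iff[OF assms(1), of "r * a" "s * a"] ideal_mult_right[OF assms, of a]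
    by (simp add: algebra_simps)
  then show ?thesis by (simp add: nzd_def)
qed

lemma nzd_prod: "finite A \<Longrightarrow> (\<And>i. i \<in> A \<Longrightarrow> nzd J (f i)) \<Longrightarrow> nzd J (prod f A)"
proof (induction A rule: finite_induct)
  case (insert x F)
  then have "nzd J (f x)" "nzd J (prod f F)" by auto
  then show ?case unfolding nzd_def prod.insert[OF insert(1,2)] mult.assoc by blast
qed (auto simp: nzd_def)

lemma ideal_colon: "is_ideal J \<Longrightarrow> is_ideal (colon J x)"
  by (rule is_idealI) (auto simp: colon_def ideal_zero ideal_add distrib_left mult.left_commute ideal_mult)

lemma weakly_regular_append:
  "weakly_regular J (rs @ ss) \<longleftrightarrow> weakly_regular J rs \<and> weakly_regular (adjs J rs) ss"
  by (induction rs arbitrary: J) auto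

lemma weakly_regular_take: "weakly_regular J rs \<Longrightarrow> weakly_regular J (take i rs)"
  by (metis append_take_drop_id weakly_regular_append)

lemma weakly_regular_iff_nth:
  "weakly_regular J rs \<longleftrightarrow> (\<forall>i<length rs. nzd (adjs J (take i rs)) (rs ! i))"
proof (induction rs arbitrary: J)
  case (Cons r rs)
  show ?case
    unfolding weakly_regular.simps Cons
    by (simp add: All_less_Suc2)
qed auto

text \<open>Regularity is inherited along \<open>0 \<rightarrow> R/(J:x) \<rightarrow> R/J \<rightarrow> R/(J+(x)) \<rightarrow> 0\<close>.\<close>

lemma weakly_regular_colon_adj:
  "is_ideal J \<Longrightarrow> weakly_regular (colon J x) rs \<Longrightarrow> weakly_regular (adj J x) rs \<Longrightarrow> weakly_regular J rs"
proof (induction rs arbitrary: J)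
  case (Cons r rs)
  have J: "is_ideal J" and 1: "nzd (colon J x) r" and 2: "nzd (adj J x) r" using Cons.prems by auto
  have nz: "nzd J r" unfolding nzd_def
  proof safe
    fix u assume u: "r * u \<in> J"
    then have "r * u \<in> adj J x" using subset_adj by blast
    then have "u \<in> adj J x" using 2 by (auto simp: nzd_def)
    then obtain a where a: "u - x * a \<in> J" by (auto simp: adj_def)
    then have "r * u - r * (x * a) \<in> J" using ideal_mult[OF J, of _ r] by (metis right_diff_distrib)
    then have "r * (x * a) \<in> J" using u ideal_diff_iff[OF J] by blast
    then have "r * a \<in> colon J x" by (simp add: colon_def mult.left_commute)
    then have "x * a \<in> J" using 1 by (auto simp: nzd_def colon_def)
    then show "u \<in> J" using a ideal_diff_iff[OF J] by blast
  qed
  \<comment> \<open>Reduction modulo r preserves exactness because r is a nonzerodivisor on the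
    right-hand term R/(J + (x)).\<close>
  have "colon (adj J r) x = adj (colon J x) r"
  proof (intro equalityI subsetI)
    fix u assume "u \<in> colon (adj J r) x"
    then obtain b where b: "x * u - r * b \<in> J" by (auto simp: colon_def adj_def)
    have "- (x * u - r * b) \<in> J" using b ideal_uminus[OF J] by blast
    then have "r * b \<in> adj J x" by (auto simp: adj_def intro!: exI[of _ u])
    then have "b \<in> adj J x" using 2 by (auto simp: nzd_def)
    then obtain a where "b - x * a \<in> J" by (auto simp: adj_def)
    then have "r * (b - x * a) \<in> J" by (rule ideal_mult[OF J])
    with b have "(x * u - r * b) + r * (b - x * a) \<in> J" by (rule ideal_add[OF J])
    then have "x * (u - r * a) \<in> J" by (simp add: algebra_simps)
    then show "u \<in> adj (colon J x) r" by (auto simp: adj_def colon_def)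
  next
    fix u assume "u \<in> adj (colon J x) r"
    then obtain a where "x * (u - r * a) \<in> J" by (auto simp: adj_def colon_def)
    then have "x * u - r * (x * a) \<in> J" by (simp add: algebra_simps)
    then show "u \<in> colon (adj J r) x" by (auto simp: adj_def colon_def)
  qed
  moreover have "adj (adj J r) x = adj (adj J x) r" using adj_commute[OF J] .
  ultimately have "weakly_regular (adj J r) rs"
    using Cons by (simp add: ideal_adj)
  then show ?case using nz by simp
qed simp

section \<open>Koszul cochains\<close>

definition ksign :: "nat \<Rightarrow> nat set \<Rightarrow> 'a::comm_ring_1" where
  "ksign k F = (- 1) ^ card {j\<in>F. j < k}"

text \<open>A function on sets is the coefficient family of an element of the exterior algebra with
  basis e_F. Then \<open>wedge k\<close> is left multiplication by e_k and \<open>contr k\<close>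
  the dual contraction; degrees are imposed only where they are used.\<close>

definition wedge :: "nat \<Rightarrow> (nat set \<Rightarrow> 'a::comm_ring_1) \<Rightarrow> nat set \<Rightarrow> 'a" where
  "wedge k w F = (if k \<in> F then ksign k F * w (F - {k}) else 0)"

definition contr :: "nat \<Rightarrow> (nat set \<Rightarrow> 'a::comm_ring_1) \<Rightarrow> nat set \<Rightarrow> 'a" where
  "contr k w F = (if k \<notin> F then ksign k F * w (insert k F) else 0)"

lemma ksign_sq [simp]: "ksign k F * ksign k F = 1" "ksign k F * (ksign k F * c) = c"
  by (simp_all add: ksign_def mult.assoc[symmetric] power_add[symmetric] flip: mult_2)

lemma ksign_insert: "k \<notin> F \<Longrightarrow> ksign j (insert k F) = (if k < j then - ksign j F else ksign j F)"
proof -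
  assume k: "k \<notin> F"
  have "{i \<in> insert k F. i < j} = (if k < j then insert k {i \<in> F. i < j} else {i \<in> F. i < j})" by auto
  then show ?thesis using k by (simp add: ksign_def)
qed

lemma ksign_remove: "k \<in> F \<Longrightarrow> ksign j (F - {k}) = (if k < j then - ksign j F else ksign j F)"
  using ksign_insert[of k "F - {k}" j] by (metis Diff_iff insert_Diff minus_minus singletonI)

lemma wedge_wedge: "wedge j (wedge k w) F = - wedge k (wedge j w) F"
  by (auto simp: wedge_def ksign_remove Diff_insert2[symmetric] insert_commute)

text \<open>The anticommutation relation of exterior multiplication and contraction. Both the Koszul
  homotopy and the Leibniz rule for the simplicial boundary are sums of it.\<close>

lemma contr_wedge: "contr j (wedge k w) F + wedge k (contr j w) F = (if j = k then w F else 0)"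
proof (cases "j = k")
  case True
  then show ?thesis 
    by (cases "k \<in> F") (auto simp: wedge_def contr_def ksign_remove ksign_insert insert_absorb)
next
  case False
  then have *: "insert j F - {k} = insert j (F - {k})" by auto
  show ?thesis using False
    by (cases "k \<in> F"; cases "j \<in> F")
       (auto simp: wedge_def contr_def ksign_remove ksign_insert * algebra_simps)
qed

section \<open>The Koszul differential and descent along a regular element\<close>

definition kdiff :: "nat set \<Rightarrow> (nat \<Rightarrow> 'a::comm_ring_1) \<Rightarrow> (nat set \<Rightarrow> 'a) \<Rightarrow> nat set \<Rightarrow> 'a" where
  "kdiff V x w F = (\<Sum>k\<in>V. x k * wedge k w F)"

text \<open>The \<open>i\<close>-th Koszul cohomology of \<open>(x\<^sub>k)\<^sub>k\<^sub>\<in>\<^sub>V\<close> on \<open>R/J\<close> does not vanish.\<close>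

definition koszul_nonzero :: "nat set \<Rightarrow> (nat \<Rightarrow> 'a::comm_ring_1) \<Rightarrow> 'a set \<Rightarrow> nat \<Rightarrow> bool" where
  "koszul_nonzero V x J i \<longleftrightarrow> (\<exists>z.
    (\<forall>F\<subseteq>V. card F = Suc i \<longrightarrow> kdiff V x z F \<in> J) \<and>
    \<not> (\<exists>w. \<forall>F\<subseteq>V. card F = i \<longrightarrow> z F - kdiff V x w F \<in> J))"

lemma wedge_sum: "wedge k (\<lambda>F. \<Sum>i\<in>A. f i F) F = (\<Sum>i\<in>A. wedge k (f i) F)"
  by (simp add: wedge_def sum_distrib_left)

lemma wedge_scale: "wedge k (\<lambda>F. c * w F) F = c * wedge k w F"
  by (simp add: wedge_def)

lemma wedge_add: "wedge k (\<lambda>F. v F + w F) F = wedge k v F + wedge k w F"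
  by (simp add: wedge_def distrib_left)

lemma wedge_diff: "wedge k (\<lambda>F. v F - w F) F = wedge k v F - wedge k w F"
  by (simp add: wedge_def right_diff_distrib)

lemma contr_sum: "contr k (\<lambda>F. \<Sum>i\<in>A. f i F) F = (\<Sum>i\<in>A. contr k (f i) F)"
  by (simp add: contr_def sum_distrib_left)

lemma contr_scale: "contr k (\<lambda>F. c * w F) F = c * contr k w F"
  by (simp add: contr_def)

lemma contr_diff: "contr k (\<lambda>F. v F - w F) F = contr k v F - contr k w F"
  by (simp add: contr_def right_diff_distrib)

lemma wedge_self: "wedge k (wedge k w) F = 0"
  by (simp add: wedge_def)

lemma kdiff_kdiff: 
  assumes "finite V" shows "kdiff V x (kdiff V x w) F = 0"
  using assms
proof (induction V rule: finite_induct)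
  case (insert v V)
  define d where "d = kdiff V x w"
  have dd: "(\<Sum>k\<in>V. x k * wedge k d F) = 0" 
    using insert.IH by (simp add: d_def kdiff_def[of V x "kdiff V x w"])
  have e: "kdiff (insert v V) x w = (\<lambda>F. x v * wedge v w F + d F)"
    using insert.hyps by (auto simp: kdiff_def d_def)
  have "wedge v d F = (\<Sum>k\<in>V. x k * wedge v (wedge k w) F)"
    unfolding d_def kdiff_def by (simp add: wedge_sum wedge_scale)
  also have "\<dots> = - (\<Sum>k\<in>V. x k * wedge k (wedge v w) F)"
    by (subst wedge_wedge) (simp add: sum_negf)
  finally have "x v * wedge v d F + (\<Sum>k\<in>V. x k * (x v * wedge k (wedge v w) F)) = 0"
    by (simp add: sum_distrib_left mult.left_commute)
  then show ?case using insert.hyps dd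
    unfolding e by (simp add: add.commute kdiff_def wedge_add wedge_scale wedge_self distrib_left sum.distrib)
qed (simp add: kdiff_def)

text \<open>Contraction with the functional taking e_j to a_j is a null homotopy of multiplication
  by the sum of the a_j x_j. Hence the ideal generated by the x_j annihilates Koszul
  cohomology.\<close>

lemma koszul_homotopy:
  assumes "finite V"
  shows "(\<Sum>j\<in>V. a j * contr j (kdiff V x z) F) + kdiff V x (\<lambda>F. \<Sum>j\<in>V. a j * contr j z F) F
    = (\<Sum>j\<in>V. a j * x j) * z F"
proof -
  have "(\<Sum>j\<in>V. a j * contr j (kdiff V x z) F) = (\<Sum>j\<in>V. \<Sum>k\<in>V. a j * x k * contr j (wedge k z) F)"
    unfolding kdiff_def by (simp add: contr_sum contr_scale sum_distrib_left mult.assoc)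
  moreover have "kdiff V x (\<lambda>F. \<Sum>j\<in>V. a j * contr j z F) F = (\<Sum>k\<in>V. \<Sum>j\<in>V. a j * x k * wedge k (contr j z) F)"
    unfolding kdiff_def by (simp add: wedge_sum wedge_scale sum_distrib_left mult_ac)
  moreover have "(\<Sum>k\<in>V. \<Sum>j\<in>V. a j * x k * wedge k (contr j z) F) = (\<Sum>j\<in>V. \<Sum>k\<in>V. a j * x k * wedge k (contr j z) F)"
    by (rule sum.swap)
  ultimately have "(\<Sum>j\<in>V. a j * contr j (kdiff V x z) F) + kdiff V x (\<lambda>F. \<Sum>j\<in>V. a j * contr j z F) F
    = (\<Sum>j\<in>V. \<Sum>k\<in>V. a j * x k * (contr j (wedge k z) F + wedge k (contr j z) F))"
    by (simp add: sum.distrib[symmetric] distrib_left)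
  also have "\<dots> = (\<Sum>j\<in>V. \<Sum>k\<in>V. if j = k then a j * x k * z F else 0)"
    by (intro sum.cong refl) (simp add: contr_wedge)
  also have "\<dots> = (\<Sum>j\<in>V. a j * x j * z F)" using assms by simp
  finally show ?thesis by (simp add: sum_distrib_right)
qed

text \<open>In the long exact sequence of multiplication by r on R/J, the map induced by r is zero,
  so the connecting map from degree i - 1 modulo J + (r) to degree i modulo J is onto. The
  contraction \<open>w\<close> of z is an explicit preimage of the class of z; in degree 0 there is
  none and z would vanish.\<close>

lemma koszul_nonzero_adj:
  assumes J: "is_ideal J" and V: "finite V" and r: "r = (\<Sum>k\<in>V. a k * x k)" 
    and nz: "nzd J r" and k: "koszul_nonzero V x J i"
  shows "\<exists>i'. i = Suc i' \<and> koszul_nonzero V x (adj J r) i'"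
proof -
  obtain z where z: "\<And>F. F \<subseteq> V \<Longrightarrow> card F = Suc i \<Longrightarrow> kdiff V x z F \<in> J"
    and nb: "\<And>w. \<not> (\<forall>F\<subseteq>V. card F = i \<longrightarrow> z F - kdiff V x w F \<in> J)"
    using k unfolding koszul_nonzero_def by blast
  define w where "w F = (\<Sum>j\<in>V. a j * contr j z F)" for F
  have w: "r * z F - kdiff V x w F \<in> J" if F: "F \<subseteq> V" "card F = i" for F
  proof -
    have "finite F" using F V finite_subset by blast
    then have "a j * contr j (kdiff V x z) F \<in> J" if "j \<in> V" for j
      using that F z[of "insert j F"] J 
      by (auto simp: contr_def ideal_zero ideal_mult)
    then have "(\<Sum>j\<in>V. a j * contr j (kdiff V x z) F) \<in> J" by (rule ideal_sum[OF J])
    also have "(\<Sum>j\<in>V. a j * contr j (kdiff V x z) F) = r * z F - kdiff V x w F"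
      using koszul_homotopy[OF V, of a x z F] unfolding w_def[abs_def] r by (simp only: eq_diff_eq)
    finally show ?thesis .
  qed
  show ?thesis
  proof (cases i)
    case 0
    have "kdiff V x w {} = 0" for w by (simp add: kdiff_def wedge_def)
    then have "r * z {} \<in> J" using w[of "{}"] 0 by simp
    then have "z {} \<in> J" using nz by (simp add: nzd_def)
    then have "\<forall>F\<subseteq>V. card F = i \<longrightarrow> z F - kdiff V x (\<lambda>F. 0) F \<in> J"
      using 0 V by (auto simp: kdiff_def wedge_def card_eq_0_iff dest: finite_subset)
    then show ?thesis using nb by blast
  next
    case (Suc i')
    have "\<forall>F\<subseteq>V. card F = Suc i' \<longrightarrow> kdiff V x w F \<in> adj J r"
    proof safe
      fix F assume F: "F \<subseteq> V" "card F = Suc i'"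
      have "- (r * z F - kdiff V x w F) \<in> J" using w[OF F(1)] F Suc ideal_uminus[OF J] by blast
      then show "kdiff V x w F \<in> adj J r" unfolding adj_def by (auto intro!: exI[of _ "z F"])
    qed
    moreover have "\<not> (\<forall>F\<subseteq>V. card F = i' \<longrightarrow> w F - kdiff V x e F \<in> adj J r)" for e
    proof
      assume e: "\<forall>F\<subseteq>V. card F = i' \<longrightarrow> w F - kdiff V x e F \<in> adj J r"
      \<comment> \<open>If w were the coboundary of e modulo J + (r), dividing the difference by r
        would give f with r z = r df modulo J; cancelling r would make z a coboundary.\<close>
      define f where "f F = (SOME b. w F - kdiff V x e F - r * b \<in> J)" for F
      have f: "w F - kdiff V x e F - r * f F \<in> J" if "F \<subseteq> V" "card F = i'" for F
        unfolding f_def by (rule someI_ex) (use e that in \<open>auto simp: adj_def\<close>)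
      have "z F - kdiff V x f F \<in> J" if F: "F \<subseteq> V" "card F = i" for F
      proof -
        have "finite F" using F V finite_subset by blast
        have "x k * wedge k (\<lambda>F. w F - kdiff V x e F - r * f F) F \<in> J" if "k \<in> V" for k
        proof (cases "k \<in> F")
          case True
          then have "F - {k} \<subseteq> V" "card (F - {k}) = i'" using F Suc \<open>finite F\<close> by auto
          then show ?thesis using f J by (auto simp: wedge_def ideal_zero ideal_mult)
        qed (auto simp: wedge_def ideal_zero[OF J])
        then have "kdiff V x (\<lambda>F. w F - kdiff V x e F - r * f F) F \<in> J"
          unfolding kdiff_def by (rule ideal_sum[OF J])
        moreover have "kdiff V x (\<lambda>F. w F - kdiff V x e F - r * f F) F = 
            kdiff V x w F - kdiff V x (kdiff V x e) F - r * kdiff V x f F"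
          by (simp add: kdiff_def[of V x "\<lambda>F. w F - kdiff V x e F - r * f F"] kdiff_def[of V x w] kdiff_def[of V x f] 
            kdiff_def[of V x "kdiff V x e"]
            wedge_diff wedge_scale sum_subtractf right_diff_distrib sum_distrib_left mult_ac)
        ultimately have "kdiff V x w F - r * kdiff V x f F \<in> J" by (simp add: kdiff_kdiff[OF V])
        then have "(r * z F - kdiff V x w F) + (kdiff V x w F - r * kdiff V x f F) \<in> J"
          using w[OF F] ideal_add[OF J] by blast
        then have "r * (z F - kdiff V x f F) \<in> J" by (simp add: algebra_simps)
        then show ?thesis using nz by (simp add: nzd_def)
      qed
      then show False using nb by blast
    qed
    ultimately show ?thesis using Suc unfolding koszul_nonzero_def by blast
  qed
qed

lemma weakly_regular_length_le:
  assumes "is_ideal J" "finite V" "koszul_nonzero V x J i" "weakly_regular J rs"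
    and "\<And>r. r \<in> set rs \<Longrightarrow> \<exists>a. r = (\<Sum>k\<in>V. a k * x k)"
  shows "length rs \<le> i"
  using assms
proof (induction rs arbitrary: J i)
  case (Cons r rs)
  obtain a where "r = (\<Sum>k\<in>V. a k * x k)" using Cons.prems(5)[of r] by auto
  then obtain i' where "i = Suc i'" "koszul_nonzero V x (adj J r) i'"
    using koszul_nonzero_adj[OF Cons.prems(1,2)] Cons.prems(3,4) by fastforce
  then show ?case using Cons.IH[of "adj J r" i'] Cons.prems by (auto simp: ideal_adj)
qed simp

section \<open>Squarefree monomial ideals\<close>

type_synonym 'k mpoly = "(nat \<Rightarrow>\<^sub>0 nat) \<Rightarrow>\<^sub>0 'k"

abbreviation "keys \<equiv> Poly_Mapping.keys"
abbreviation "lookup \<equiv> Poly_Mapping.lookup"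
abbreviation "single \<equiv> Poly_Mapping.single"

lemma poly_mapping_sum_monomials:
  assumes "finite A" "keys p \<subseteq> A"
  shows "(\<Sum>m\<in>A. single m (lookup p m)) = p"
proof (rule poly_mapping_eqI)
  fix k
  have "lookup (\<Sum>m\<in>A. single m (lookup p m)) k = (\<Sum>m\<in>A. if m = k then lookup p m else 0)"
    by (simp add: lookup_sum lookup_single when_def)
  also have "\<dots> = lookup p k"
    using assms by (auto simp: in_keys_iff)
  finally show "lookup (\<Sum>m\<in>A. single m (lookup p m)) k = lookup p k" .
qed

lemma keys_add_nat: "keys (a + b :: 'v \<Rightarrow>\<^sub>0 nat) = keys a \<union> keys b"
  by (auto simp: in_keys_iff lookup_add)

lemma lookup_single_mult_add:
  fixes p :: "('v \<Rightarrow>\<^sub>0 nat) \<Rightarrow>\<^sub>0 'k::comm_ring_1"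
  shows "lookup (single a c * p) (a + k) = c * lookup p k"
proof -
  have "single a c * p = (\<Sum>m\<in>keys p. single (a + m) (c * lookup p m))"
    by (subst poly_mapping_sum_monomials[of "keys p" p, symmetric])
       (simp_all add: sum_distrib_left mult_single)
  then have "lookup (single a c * p) (a + k) = (\<Sum>m\<in>keys p. if m = k then c * lookup p m else 0)"
    by (simp add: lookup_sum lookup_single when_def)
  then show ?thesis by (auto simp: in_keys_iff)
qed

lemma keys_single_mult_subset:
  fixes p :: "('v \<Rightarrow>\<^sub>0 nat) \<Rightarrow>\<^sub>0 'k::comm_ring_1"
  shows "keys (single a c * p) \<subseteq> (+) a ` keys p"
  using keys_mult[of "single a c" p] by (auto split: if_splits)

lemma keys_single_mult:
  fixes p :: "('v \<Rightarrow>\<^sub>0 nat) \<Rightarrow>\<^sub>0 'k::comm_ring_1"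
  shows "keys (single a 1 * p) = (+) a ` keys p"
  using keys_single_mult_subset[of a 1 p] by (auto simp: in_keys_iff lookup_single_mult_add)

lemma keys_Var_mult:
  fixes p :: "('v \<Rightarrow>\<^sub>0 nat) \<Rightarrow>\<^sub>0 'k::field"
  shows "keys (Var v * p) = (+) (single v 1) ` keys p"
  by (simp add: Var_def keys_single_mult)

definition chi :: "'v set \<Rightarrow> ('v \<Rightarrow>\<^sub>0 nat)" where
  "chi F = (\<Sum>v\<in>F. single v 1)"

lemma lookup_chi: "finite F \<Longrightarrow> lookup (chi F) v = (if v \<in> F then 1 else 0)"
  by (simp add: chi_def lookup_sum lookup_single when_def)

lemma keys_chi: "finite F \<Longrightarrow> keys (chi F) = F"
  by (auto simp: in_keys_iff lookup_chi split: if_splits)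

lemma chi_remove: "finite F \<Longrightarrow> v \<in> F \<Longrightarrow> chi F = single v 1 + chi (F - {v})"
  by (simp add: chi_def sum.remove)

definition xmon :: "nat set \<Rightarrow> 'k::field mpoly" where
  "xmon F = single (chi F) 1"

lemma xmon_remove: "finite F \<Longrightarrow> v \<in> F \<Longrightarrow> xmon F = Var v * xmon (F - {v})"
  by (simp add: xmon_def Var_def mult_single chi_remove)

lemma prod_Var: "finite F \<Longrightarrow> (\<Prod>v\<in>F. Var v) = xmon F"
proof (induction F rule: finite_induct)
  case (insert v F)
  then show ?case by (subst xmon_remove[of "insert v F" v]) simp_all
qed (simp add: xmon_def chi_def)

text \<open>For a simplicial complex \<open>D\<close> on a subset of \<open>\<nat>\<close> this is its Stanley-Reisner ideal, with
  the variables which are not vertices of \<open>D\<close> adjoined.\<close>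

definition sr :: "nat set set \<Rightarrow> 'k::field mpoly set" where
  "sr D = {p. \<forall>m\<in>keys p. keys m \<notin> D}"

definition down_closed :: "nat set set \<Rightarrow> bool" where
  "down_closed D \<longleftrightarrow> (\<forall>S\<in>D. \<forall>T\<subseteq>S. T \<in> D)"

lemma down_closedD: "down_closed D \<Longrightarrow> S \<in> D \<Longrightarrow> T \<subseteq> S \<Longrightarrow> T \<in> D"
  by (auto simp: down_closed_def)

lemma keys_mult_cases:
  fixes p q :: "('v \<Rightarrow>\<^sub>0 nat) \<Rightarrow>\<^sub>0 'k::comm_ring_1"
  assumes "m \<in> keys (p * q)"
  obtains a b where "m = a + b" "a \<in> keys p" "b \<in> keys q"
  using keys_mult[of p q] assms by auto

lemma ideal_sr: 
  assumes "down_closed D" shows "is_ideal (sr D :: 'k::field mpoly set)"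
proof (rule is_idealI)
  fix x y :: "'k mpoly" assume "x \<in> sr D" "y \<in> sr D"
  then show "x + y \<in> sr D" using keys_add[of x y] by (auto simp: sr_def)
next
  fix a x :: "'k mpoly" assume "x \<in> sr D"
  then show "a * x \<in> sr D" unfolding sr_def
    by (auto simp: keys_add_nat elim!: keys_mult_cases) (use assms in \<open>auto simp: down_closed_def\<close>)
qed (simp add: sr_def)

lemma down_closed_Pow: "down_closed (Pow F)"
  by (auto simp: down_closed_def)

text \<open>The complex on the right is the star of v, empty if v is not a vertex. There v is a cone
  point, so it is kept as a vertex while the complex shrinks.\<close>

lemma colon_sr: "colon (sr D) (Var v) = sr {S. insert v S \<in> D}"
  by (auto simp: colon_def sr_def keys_Var_mult keys_add_nat)

lemma adj_sr: "adj (sr D) (Var v) = (sr {S\<in>D. v \<notin> S} :: 'k::field mpoly set)"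
proof (intro equalityI subsetI)
  fix p :: "'k mpoly" assume "p \<in> adj (sr D) (Var v)"
  then obtain q where q: "p - Var v * q \<in> sr D" by (auto simp: adj_def)
  show "p \<in> sr {S\<in>D. v \<notin> S}" unfolding sr_def
  proof safe
    fix m assume m: "m \<in> keys p" "keys m \<in> D" "v \<notin> keys m"
    then have "m \<notin> keys (Var v * q)" by (auto simp: keys_Var_mult keys_add_nat)
    then have "m \<in> keys (p - Var v * q)" using m by (simp add: in_keys_iff lookup_minus)
    then show False using q m by (auto simp: sr_def)
  qed
next
  fix p :: "'k mpoly" assume p: "p \<in> sr {S\<in>D. v \<notin> S}"
  let ?A = "{m\<in>keys p. v \<in> keys m}"
  define q where "q = (\<Sum>m\<in>?A. single (m - single v 1) (lookup p m))"
  have *: "single v (Suc 0) + (m - single v (Suc 0)) = m" if "v \<in> keys m" for m :: "nat \<Rightarrow>\<^sub>0 nat"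
    using that by (intro poly_mapping_eqI) (auto simp: lookup_add lookup_minus lookup_single when_def in_keys_iff)
  have q: "Var v * q = (\<Sum>m\<in>?A. single m (lookup p m))"
    by (simp add: q_def Var_def sum_distrib_left mult_single *)
  have "p = (\<Sum>m\<in>keys p. single m (lookup p m))" by (simp add: poly_mapping_sum_monomials)
  also have "\<dots> = (\<Sum>m\<in>keys p - ?A. single m (lookup p m)) + (\<Sum>m\<in>?A. single m (lookup p m))"
    by (rule sum.subset_diff) auto
  finally have "p - Var v * q = (\<Sum>m\<in>keys p - ?A. single m (lookup p m))"
    unfolding q diff_eq_eq .
  moreover have "\<dots> \<in> sr D"
  proof -
    have "keys (\<Sum>m\<in>keys p - ?A. single m (lookup p m)) \<subseteq> keys p - ?A"
      by (rule order.trans[OF keys_sum]) auto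
    then show ?thesis using p by (auto simp: sr_def)
  qed
  ultimately have "p - Var v * q \<in> sr D" by simp
  then show "p \<in> adj (sr D) (Var v)" unfolding adj_def by blast
qed

section \<open>Killing the variables outside a given set\<close>

definition restr :: "nat set \<Rightarrow> 'k::field mpoly \<Rightarrow> 'k mpoly" where
  "restr F p = (\<Sum>m\<in>{m\<in>keys p. keys m \<subseteq> F}. single m (lookup p m))"

definition polys_in :: "nat set \<Rightarrow> 'k::field mpoly set" where
  "polys_in V = {p. \<forall>m\<in>keys p. keys m \<subseteq> V}"

lemma lookup_restr: "lookup (restr F p) m = (if keys m \<subseteq> F then lookup p m else 0)"
  by (auto simp: restr_def lookup_sum lookup_single when_def in_keys_iff)

lemma restr_in: "restr F p \<in> polys_in F"
  by (auto simp: polys_in_def in_keys_iff[of _ "restr F p"] lookup_restr split: if_splits)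

lemma restr_id: "p \<in> polys_in F \<Longrightarrow> restr F p = p"
  by (rule poly_mapping_eqI) (auto simp: polys_in_def in_keys_iff lookup_restr)

lemma diff_restr: "p - restr F p \<in> sr (Pow F)"
  by (auto simp: sr_def in_keys_iff lookup_minus lookup_restr split: if_splits)

lemma polys_in_sr_Pow: "p \<in> polys_in F \<Longrightarrow> p \<in> sr (Pow F) \<Longrightarrow> p = 0"
  by (rule poly_mapping_eqI) (auto simp: polys_in_def sr_def in_keys_iff)

lemma polys_in_closed:
  shows polys_in_0: "0 \<in> polys_in V" and polys_in_1: "1 \<in> polys_in V"
    and polys_in_diff: "p \<in> polys_in V \<Longrightarrow> q \<in> polys_in V \<Longrightarrow> p - q \<in> polys_in V"
    and polys_in_mult: "p \<in> polys_in V \<Longrightarrow> q \<in> polys_in V \<Longrightarrow> p * q \<in> polys_in V"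
proof -
  show "p - q \<in> polys_in V" if "p \<in> polys_in V" "q \<in> polys_in V"
    using that keys_diff[of p q] by (auto simp: polys_in_def)
  show "p * q \<in> polys_in V" if "p \<in> polys_in V" "q \<in> polys_in V"
    using that by (fastforce simp: polys_in_def keys_add_nat elim!: keys_mult_cases)
qed (auto simp: polys_in_def in_keys_iff)

lemma restr_eqI:
  assumes "q \<in> polys_in F" "p - q \<in> sr (Pow F)" shows "restr F p = q"
proof -
  have J: "is_ideal (sr (Pow F) :: 'a mpoly set)" by (rule ideal_sr[OF down_closed_Pow])
  have "(p - q) - (p - restr F p) \<in> sr (Pow F)" using ideal_diff[OF J assms(2) diff_restr] .
  then have "restr F p - q \<in> sr (Pow F)" by simp
  then show ?thesis using polys_in_sr_Pow[OF polys_in_diff[OF restr_in assms(1)]] by simp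
qed

lemma restr_add: "restr F (p + q) = restr F p + restr F q"
  by (rule poly_mapping_eqI) (simp add: lookup_restr lookup_add)

lemma restr_mult: "restr F (p * q) = restr F p * restr F q"
proof (rule restr_eqI)
  have J: "is_ideal (sr (Pow F) :: 'a mpoly set)" by (rule ideal_sr[OF down_closed_Pow])
  have "p * q - restr F p * restr F q = (p - restr F p) * q + restr F p * (q - restr F q)"
    by (simp add: algebra_simps)
  also have "\<dots> \<in> sr (Pow F)"
    by (intro ideal_add[OF J] ideal_mult[OF J] ideal_mult_right[OF J] diff_restr)
  finally show "p * q - restr F p * restr F q \<in> sr (Pow F)" .
qed (intro polys_in_mult restr_in)

text \<open>The set \<open>sr (Pow F)\<close> is the kernel of the ring homomorphism
  \<open>restr F\<close>, whose values lie in an integral domain.\<close>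

lemma prime_sr_Pow:
  assumes "p * q \<in> sr (Pow F)" shows "p \<in> sr (Pow F) \<or> q \<in> (sr (Pow F) :: 'k::field mpoly set)"
proof -
  have J: "is_ideal (sr (Pow F) :: 'k mpoly set)" by (rule ideal_sr[OF down_closed_Pow])
  have "restr F (p * q) \<in> sr (Pow F)"
    using ideal_diff[OF J assms diff_restr[of "p * q" F]] by simp
  then have "restr F (p * q) = 0" by (rule polys_in_sr_Pow[OF restr_in])
  then have "restr F p = 0 \<or> restr F q = 0" by (simp add: restr_mult)
  then show ?thesis using diff_restr[of p F] diff_restr[of q F] by auto
qed

section \<open>Gradings and permutation of regular sequences\<close>

definition deg :: "(nat \<Rightarrow>\<^sub>0 nat) \<Rightarrow> nat" where
  "deg m = (\<Sum>v\<in>keys m. lookup m v)"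

lemma deg_add: "deg (a + b) = deg a + deg b"
  unfolding deg_def by (rule setsum_keys_plus_distrib[of "\<lambda>_ x. x"]) auto

lemma deg_single: "deg (single v k) = k"
  by (simp add: deg_def)

lemma deg_sum: "deg (sum f A) = (\<Sum>i\<in>A. deg (f i))"
  by (induction A rule: infinite_finite_induct) (auto simp: deg_add deg_def[of 0])

lemma deg_chi: "deg (chi F) = card F"
  by (simp add: chi_def deg_sum deg_single)

definition degree_part :: "nat \<Rightarrow> 'k::field mpoly \<Rightarrow> 'k mpoly" where
  "degree_part t p = (\<Sum>m | m \<in> keys p \<and> deg m = t. single m (lookup p m))"

definition homogeneous :: "nat \<Rightarrow> 'k::field mpoly \<Rightarrow> bool" where
  "homogeneous t p \<longleftrightarrow> (\<forall>m\<in>keys p. deg m = t)"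

definition homogeneous_set :: "'k::field mpoly set \<Rightarrow> bool" where
  "homogeneous_set J \<longleftrightarrow> (\<forall>p\<in>J. \<forall>t. degree_part t p \<in> J)"

lemma lookup_degree_part: "lookup (degree_part t p) m = (if deg m = t then lookup p m else 0)"
  by (auto simp: degree_part_def lookup_sum lookup_single when_def in_keys_iff)

lemma keys_degree_part: "keys (degree_part t p) = {m\<in>keys p. deg m = t}"
  by (auto simp: in_keys_iff lookup_degree_part split: if_splits)

lemma homogeneous_degree_part: "homogeneous t (degree_part t p)"
  by (simp add: homogeneous_def keys_degree_part)

lemma degree_part_diff: "degree_part t (p - q) = degree_part t p - degree_part t q"
  by (rule poly_mapping_eqI) (simp add: lookup_degree_part lookup_minus)

lemma degree_part_sum: "degree_part t (sum f A) = (\<Sum>i\<in>A. degree_part t (f i))"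
  by (rule poly_mapping_eqI) (simp add: lookup_degree_part lookup_sum)

lemma degree_part_homogeneous: "homogeneous s p \<Longrightarrow> degree_part t p = (if s = t then p else 0)"
  by (rule poly_mapping_eqI) (auto simp: lookup_degree_part homogeneous_def in_keys_iff)

lemma sum_degree_part: 
  assumes "finite T" "deg ` keys p \<subseteq> T" shows "(\<Sum>t\<in>T. degree_part t p) = p"
  using assms by (intro poly_mapping_eqI) (auto simp: lookup_sum lookup_degree_part in_keys_iff image_subset_iff)

lemma homogeneous_mult: "homogeneous s p \<Longrightarrow> homogeneous t q \<Longrightarrow> homogeneous (s + t) (p * q)"
  by (auto simp: homogeneous_def deg_add elim!: keys_mult_cases)

lemma degree_part_mult:
  assumes "homogeneous t r" 
  shows "degree_part s (r * u) = (if t \<le> s then r * degree_part (s - t) u else 0)"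
proof -
  let ?T = "insert (s - t) (deg ` keys u)"
  have "r * u = (\<Sum>d\<in>?T. r * degree_part d u)"
    by (subst sum_degree_part[of ?T u, symmetric]) (auto simp: sum_distrib_left)
  then have "degree_part s (r * u) = (\<Sum>d\<in>?T. degree_part s (r * degree_part d u))" by (simp only: degree_part_sum)
  also have "\<dots> = (\<Sum>d\<in>?T. if d = s - t then (if t \<le> s then r * degree_part (s - t) u else 0) else 0)"
    using degree_part_homogeneous[OF homogeneous_mult[OF assms homogeneous_degree_part]]
    by (intro sum.cong refl) auto
  also have "\<dots> = (if t \<le> s then r * degree_part (s - t) u else 0)" by simp
  finally show ?thesis .
qed

lemma homogeneous_set_adj:
  assumes "homogeneous_set J" "homogeneous t r" "is_ideal J" shows "homogeneous_set (adj J r)"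
  unfolding homogeneous_set_def
proof safe
  fix p s assume "p \<in> adj J r"
  then obtain a where "p - r * a \<in> J" by (auto simp: adj_def)
  then have "degree_part s p - degree_part s (r * a) \<in> J" using assms by (auto simp: homogeneous_set_def simp flip: degree_part_diff)
  then show "degree_part s p \<in> adj J r" 
    by (cases "t \<le> s") (auto simp: degree_part_mult[OF assms(2)] adj_def intro: exI[of _ 0])
qed

lemma homogeneous_set_sr: "homogeneous_set (sr D)"
  by (auto simp: homogeneous_set_def sr_def keys_degree_part)

lemma homogeneous_xmon: "homogeneous (card F) (xmon F)"
  by (simp add: homogeneous_def xmon_def deg_chi)

lemma homogeneous_sum: "(\<And>i. i \<in> A \<Longrightarrow> homogeneous t (f i)) \<Longrightarrow> homogeneous t (sum f A)"
  unfolding homogeneous_def using keys_sum[of f A] by blast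

text \<open>If \<open>r\<close> is regular modulo \<open>J + (y)\<close> and \<open>y\<close> modulo \<open>J\<close>, then \<open>J : r = J + y (J : r)\<close>, and
  descent on the degree applies.\<close>

lemma nzd_swap_homogeneous:
  assumes J: "is_ideal J" and hJ: "homogeneous_set J" and y: "homogeneous 1 y" "nzd J y"
    and r: "homogeneous t r" "nzd (adj J y) r"
  shows "nzd J r"
proof -
  have *: "r * degree_part s u \<in> J \<Longrightarrow> degree_part s u \<in> J" for s u
  proof (induction s arbitrary: u rule: less_induct)
    case (less s)
    have "r * degree_part s u \<in> adj J y" using less.prems subset_adj by blast
    then have "degree_part s u \<in> adj J y" using r(2) by (auto simp: nzd_def)
    then obtain a where "degree_part s u - y * a \<in> J" by (auto simp: adj_def)
    then have "degree_part s (degree_part s u - y * a) \<in> J" using hJ by (auto simp: homogeneous_set_def)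
    then have a: "degree_part s u - degree_part s (y * a) \<in> J"
      by (simp add: degree_part_diff degree_part_homogeneous[OF homogeneous_degree_part])
    show ?case
    proof (cases "1 \<le> s")
      case True
      then have 1: "degree_part s u - y * degree_part (s - 1) a \<in> J" using a by (simp add: degree_part_mult[OF y(1)])
      then have "r * degree_part s u - r * (y * degree_part (s - 1) a) \<in> J"
        using ideal_mult[OF J, of _ r] by (simp flip: right_diff_distrib)
      then have "y * (r * degree_part (s - 1) a) \<in> J" 
        using ideal_diff_iff[OF J] less.prems by (simp add: mult.left_commute)
      then have "r * degree_part (s - 1) a \<in> J" using y(2) by (auto simp: nzd_def)
      then have "degree_part (s - 1) a \<in> J" using less.IH[of "s - 1" a] True by auto
      then show ?thesis using 1 ideal_diff_iff[OF J] ideal_mult[OF J] by blast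
    next
      case False
      then show ?thesis using a by (simp add: degree_part_mult[OF y(1)])
    qed
  qed
  show ?thesis unfolding nzd_def
  proof safe
    fix u assume u: "r * u \<in> J"
    have "degree_part s u \<in> J" for s
    proof -
      have "degree_part (s + t) (r * u) \<in> J" using u hJ by (auto simp: homogeneous_set_def)
      then show ?thesis using * by (simp add: degree_part_mult[OF r(1)])
    qed
    then have "(\<Sum>s\<in>deg ` keys u. degree_part s u) \<in> J" by (intro ideal_sum[OF J]) auto
    then show "u \<in> J" by (simp add: sum_degree_part)
  qed
qed

lemma nzd_adj_swap:
  assumes J: "is_ideal J" and y: "nzd J y" and r: "nzd (adj J y) r"
  shows "nzd (adj J r) y"
  unfolding nzd_def
proof safe
  fix u assume "y * u \<in> adj J r"
  then obtain a where a: "y * u - r * a \<in> J" by (auto simp: adj_def)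
  have "- (y * u - r * a) \<in> J" using ideal_uminus[OF J a] .
  then have "r * a \<in> adj J y" by (auto simp: adj_def intro!: exI[of _ u])
  then have "a \<in> adj J y" using r by (auto simp: nzd_def)
  then obtain b where b: "a - y * b \<in> J" by (auto simp: adj_def)
  have "(y * u - r * a) + r * (a - y * b) \<in> J" using ideal_add[OF J a ideal_mult[OF J b]] .
  then have "y * (u - r * b) \<in> J" by (simp add: algebra_simps)
  then have "u - r * b \<in> J" using y by (auto simp: nzd_def)
  then show "u \<in> adj J r" by (auto simp: adj_def)
qed

text \<open>Moves y from the front of the sequence y, rs to its end by exchanging it with one r at a
  time. Outside graded or local situations such permutations can fail, which is why homogeneity is
  carried along.\<close>

lemma weakly_regular_swap:
  assumes "is_ideal J" "homogeneous_set J" "homogeneous 1 y" "nzd J y"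
    and "weakly_regular (adj J y) rs" "\<forall>r\<in>set rs. \<exists>t. homogeneous t r"
  shows "weakly_regular J rs \<and> nzd (adjs J rs) y"
  using assms
proof (induction rs arbitrary: J)
  case (Cons r rs)
  obtain t where t: "homogeneous t r" using Cons.prems by auto
  have "nzd J r" using nzd_swap_homogeneous[OF Cons.prems(1-4) t] Cons.prems by auto
  moreover have "weakly_regular (adj J r) rs \<and> nzd (adjs (adj J r) rs) y"
    using Cons.prems t
    by (intro Cons.IH) (auto simp: ideal_adj homogeneous_set_adj nzd_adj_swap adj_commute[of J r y])
  ultimately show ?case by simp
qed simp

section \<open>Elementary symmetric polynomials\<close>

definition esym :: "nat set \<Rightarrow> nat \<Rightarrow> 'k::field mpoly" where
  "esym V j = (\<Sum>S | S \<subseteq> V \<and> card S = j. xmon S)"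

lemma homogeneous_esym: "homogeneous j (esym V j)"
  unfolding esym_def by (rule homogeneous_sum) (use homogeneous_xmon in auto)

text \<open>Every other squarefree monomial of degree card F involves a variable outside F.\<close>

lemma esym_diff_mem_sr:
  assumes "finite V" "F \<subseteq> V"
  shows "esym V (card F) - xmon F \<in> (sr (Pow F) :: 'k::field mpoly set)"
proof -
  have fin: "finite {S. S \<subseteq> V \<and> card S = card F}" using assms by auto
  then have "esym V (card F) = (xmon F :: 'k mpoly) + (\<Sum>S \<in> {S. S \<subseteq> V \<and> card S = card F} - {F}. xmon S)"
    unfolding esym_def using assms by (subst sum.remove[of _ F]) auto
  then have "esym V (card F) - (xmon F :: 'k mpoly) = (\<Sum>S \<in> {S. S \<subseteq> V \<and> card S = card F} - {F}. xmon S)" by simp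
  also have "\<dots> \<in> (sr (Pow F) :: 'k mpoly set)"
  proof (rule ideal_sum[OF ideal_sr[OF down_closed_Pow]])
    fix S assume S: "S \<in> {S. S \<subseteq> V \<and> card S = card F} - {F}"
    then have "\<not> S \<subseteq> F" using card_subset_eq[of F S] finite_subset[OF assms(2,1)] by auto
    moreover have "finite S" using S assms finite_subset by blast
    ultimately show "xmon S \<in> (sr (Pow F) :: 'k mpoly set)" by (auto simp: sr_def xmon_def keys_chi)
  qed
  finally show ?thesis .
qed

text \<open>Let card F = k + 1. For y in F, the quotient by y belongs to the simplex F - {y}, on
  which e_1, ..., e_k is regular; moving y to the end shows that y is regular after e_1, ..., e_k.
  Hence so is the product of all y in F, which is e_(k+1) modulo \<open>sr (Pow F)\<close>.\<close>

lemma weakly_regular_esym: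
  assumes "finite V" "F \<subseteq> V"
  shows "weakly_regular (sr (Pow F) :: 'k::field mpoly set) (map (esym V) [1..<Suc (card F)])"
proof -
  have "finite F" using assms finite_subset by blast
  then show ?thesis using assms(2)
  proof (induction "card F" arbitrary: F)
    case (Suc k)
    let ?rs = "map (esym V) [1..<Suc k] :: 'k mpoly list"
    have J: "is_ideal (sr (Pow F) :: 'k mpoly set)" by (rule ideal_sr[OF down_closed_Pow])
    have nz: "weakly_regular (sr (Pow F) :: 'k mpoly set) ?rs \<and> nzd (adjs (sr (Pow F)) ?rs) (Var y)" if y: "y \<in> F" for y
    proof (rule weakly_regular_swap[OF J homogeneous_set_sr])
      show "homogeneous 1 (Var y)" by (simp add: Var_def homogeneous_def deg_single)
      have "{S. insert y S \<in> Pow F} = Pow F" using y by auto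
      then show "nzd (sr (Pow F) :: 'k mpoly set) (Var y)" 
        using colon_sr[of "Pow F" y, where 'a='k] by (auto simp: colon_def nzd_def)
      have "{S \<in> Pow F. y \<notin> S} = Pow (F - {y})" by auto
      moreover have k: "k = card (F - {y})" using Suc.hyps(2) Suc.prems(1) y by simp
      have "weakly_regular (sr (Pow (F - {y})) :: 'k mpoly set) ?rs"
        unfolding k by (rule Suc.hyps(1)[OF k]) (use Suc.prems in auto)
      ultimately show "weakly_regular (adj (sr (Pow F)) (Var y)) ?rs"
        by (simp only: adj_sr)
      show "\<forall>r\<in>set ?rs. \<exists>t. homogeneous t r" using homogeneous_esym by auto
    qed
    obtain y where "y \<in> F" using Suc.hyps(2) by (metis card.empty ex_in_conv nat.distinct(1))
    then have wr: "weakly_regular (sr (Pow F)) ?rs" using nz by blast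
    have Jr: "is_ideal (adjs (sr (Pow F)) ?rs)" using ideal_adjs[OF J] .
    have "nzd (adjs (sr (Pow F)) ?rs) (\<Prod>y\<in>F. Var y)" by (rule nzd_prod) (use Suc.prems nz in auto)
    then have "nzd (adjs (sr (Pow F)) ?rs) (xmon F)" using Suc.prems prod_Var by metis
    moreover have "sr (Pow F) \<subseteq> adjs (sr (Pow F)) rs" for rs :: "'k mpoly list"
      by (induction rs rule: rev_induct) (use subset_adj in auto)
    then have "esym V (Suc k) - xmon F \<in> adjs (sr (Pow F)) ?rs"
      using esym_diff_mem_sr[OF assms(1) Suc.prems(2)] Suc.hyps(2) by auto
    ultimately have "nzd (adjs (sr (Pow F)) ?rs) (esym V (Suc k))"
      using nzd_cong_mod[OF Jr] by blast
    then show ?case using wr Suc.hyps(2)[symmetric] by (simp add: weakly_regular_append)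
  qed simp
qed

text \<open>A derivation is a branching tree with simplices at its leaves. V stays fixed along the
  tree because all leaves share the sequence built from \<open>esym V\<close>; a leaf with more than
  d vertices uses only its first d members.\<close>

inductive depth_ge :: "nat set \<Rightarrow> nat \<Rightarrow> nat set set \<Rightarrow> bool" for V d where
  simplex: "F \<subseteq> V \<Longrightarrow> d \<le> card F \<Longrightarrow> depth_ge V d (Pow F)"
| branch: "down_closed D \<Longrightarrow> depth_ge V d {S. insert v S \<in> D} \<Longrightarrow> depth_ge V d {S \<in> D. v \<notin> S} \<Longrightarrow> depth_ge V d D"

lemma depth_ge_imp_weakly_regular:
  assumes "finite V" "depth_ge V d D"
  shows "weakly_regular (sr D :: 'k::field mpoly set) (map (esym V) [1..<Suc d])"
  using assms(2)
proof induction
  case (simplex F)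
  have "map (esym V) [1..<Suc d] = take d (map (esym V) [1..<Suc (card F)] :: 'k mpoly list)"
    using simplex by (simp add: take_map take_upt del: upt_Suc)
  then show ?case using weakly_regular_take[OF weakly_regular_esym[OF assms(1) simplex(1)]] by metis
next
  case (branch D v)
  show ?case
    by (rule weakly_regular_colon_adj[OF ideal_sr[OF branch(1)], of "Var v"])
       (use branch in \<open>simp_all add: colon_sr adj_sr del: upt_Suc\<close>)
qed

section \<open>Koszul cohomology of Stanley-Reisner rings\<close>

text \<open>Coboundary and boundary of the full simplex on V with the empty face included: the
  theory is reduced, and a face with i elements has dimension i - 1. A subcomplex D enters by
  requiring cocycle equations only on D and supporting cycles on D.\<close>

definition kcobd :: "nat set \<Rightarrow> (nat set \<Rightarrow> 'a::comm_ring_1) \<Rightarrow> nat set \<Rightarrow> 'a" where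
  "kcobd V c F = (\<Sum>k\<in>V. wedge k c F)"

definition kbd :: "nat set \<Rightarrow> (nat set \<Rightarrow> 'a::comm_ring_1) \<Rightarrow> nat set \<Rightarrow> 'a" where
  "kbd V Z F = (\<Sum>k\<in>V. contr k Z F)"

lemma sum_wedge_contr:
  assumes "finite V" "k \<in> V"
  shows "(\<Sum>F\<in>Pow V. Z F * wedge k e F) = (\<Sum>F\<in>Pow V. contr k Z F * e F)"
proof -
  have "(\<Sum>F\<in>Pow V. Z F * wedge k e F) = (\<Sum>F\<in>{F\<in>Pow V. k \<in> F}. Z F * (ksign k F * e (F - {k})))"
    using assms by (intro sum.mono_neutral_cong_right) (auto simp: wedge_def)
  also have "\<dots> = (\<Sum>F\<in>{F\<in>Pow V. k \<notin> F}. ksign k F * Z (insert k F) * e F)"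
    using assms
    by (intro sum.reindex_bij_witness[of _ "insert k" "\<lambda>F. F - {k}"])
       (auto simp: insert_absorb ksign_remove mult_ac)
  also have "\<dots> = (\<Sum>F\<in>Pow V. contr k Z F * e F)"
    using assms by (intro sum.mono_neutral_cong_left) (auto simp: contr_def)
  finally show ?thesis .
qed

lemma sum_kcobd_kbd:
  assumes "finite V"
  shows "(\<Sum>F\<in>Pow V. Z F * kcobd V e F) = (\<Sum>F\<in>Pow V. kbd V Z F * e F)"
proof -
  have "(\<Sum>F\<in>Pow V. Z F * kcobd V e F) = (\<Sum>k\<in>V. \<Sum>F\<in>Pow V. Z F * wedge k e F)"
    unfolding kcobd_def sum_distrib_left by (rule sum.swap)
  also have "\<dots> = (\<Sum>k\<in>V. \<Sum>F\<in>Pow V. contr k Z F * e F)"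
    by (intro sum.cong refl sum_wedge_contr assms)
  also have "\<dots> = (\<Sum>F\<in>Pow V. kbd V Z F * e F)"
    unfolding kbd_def sum_distrib_right by (rule sum.swap)
  finally show ?thesis .
qed

lemma ksign_mpoly: "(ksign k F :: 'k::field mpoly) = single 0 (ksign k F)"
proof -
  have "(- 1) ^ m = (single 0 ((- 1) ^ m) :: 'k mpoly)" for m
  proof (induction m)
    case (Suc m)
    have "(- 1) ^ Suc m = - (single 0 ((- 1) ^ m) :: 'k mpoly)" using Suc by simp
    then show ?case by (simp add: single_uminus)
  qed simp
  then show ?thesis by (simp add: ksign_def)
qed

text \<open>A simplicial cocycle \<open>c\<close> of \<open>D\<close>, placed in the squarefree multidegrees, is a Koszul cocycle;
  pairing it with a simplicial cycle \<open>Z\<close> of \<open>D\<close> shows that it is not a coboundary.\<close>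

lemma koszul_nonzero_sr:
  fixes c Z :: "nat set \<Rightarrow> 'k::field"
  assumes V: "finite V"
    and c: "\<And>F. F \<subseteq> V \<Longrightarrow> F \<in> D \<Longrightarrow> kcobd V c F = 0"
    and Z: "\<And>F. Z F \<noteq> 0 \<Longrightarrow> F \<in> D \<and> F \<subseteq> V \<and> card F = i" "\<And>F. kbd V Z F = 0"
    and cZ: "(\<Sum>F\<in>Pow V. Z F * c F) \<noteq> 0"
  shows "koszul_nonzero V Var (sr D :: 'k mpoly set) i"
proof -
  define z :: "nat set \<Rightarrow> 'k mpoly" where "z F = single (chi F) (c F)" for F
  have "kdiff V Var z F \<in> sr D" if F: "F \<subseteq> V" for F
  proof -
    have fin: "finite F" using F V finite_subset by blast
    have "Var k * wedge k z F = single (chi F) (wedge k c F)" if "k \<in> V" for k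
      using chi_remove[OF fin, of k] 
      by (simp add: z_def wedge_def Var_def ksign_mpoly mult_single)
    then have "kdiff V Var z F = single (chi F) (kcobd V c F)"
      unfolding kdiff_def kcobd_def
      by (intro poly_mapping_eqI) (simp add: lookup_sum lookup_single when_def)
    then show ?thesis using c[OF F] fin by (auto simp: sr_def keys_chi)
  qed
  moreover have "\<not> (\<forall>F\<subseteq>V. card F = i \<longrightarrow> z F - kdiff V Var w F \<in> sr D)" for w
  proof
    assume w: "\<forall>F\<subseteq>V. card F = i \<longrightarrow> z F - kdiff V Var w F \<in> sr D"
    \<comment> \<open>The part of w in the multidegrees of z. Multiplication by \<open>Var k\<close>
      carries the monomial of F - {k} to that of F, so on faces of D with i elements the assumed
      relation becomes c F = \<open>kcobd V e F\<close>.\<close>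
    define e where "e F = lookup (w F) (chi F)" for F
    have "Z F * c F = Z F * kcobd V e F" for F
    proof (cases "Z F = 0")
      case False
      then have F: "F \<in> D" "F \<subseteq> V" "card F = i" using Z by auto
      have fin: "finite F" using F V finite_subset by blast
      have "chi F \<notin> keys (z F - kdiff V Var w F)"
        using w[rule_format, OF F(2,3)] F(1) keys_chi[OF fin] unfolding sr_def by fastforce
      then have "c F = lookup (kdiff V Var w F) (chi F)"
        by (simp add: in_keys_iff lookup_minus z_def)
      also have "\<dots> = (\<Sum>k\<in>V. lookup (Var k * wedge k w F) (chi F))"
        by (simp add: kdiff_def lookup_sum)
      also have "\<dots> = kcobd V e F" unfolding kcobd_def
      proof (rule sum.cong[OF refl])
        fix k assume "k \<in> V"
        show "lookup (Var k * wedge k w F) (chi F) = wedge k e F"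
        proof (cases "k \<in> F")
          case True
          then show ?thesis
            using chi_remove[OF fin True] lookup_single_mult_add[of "single k 1" 1 "wedge k w F" "chi (F - {k})"]
              lookup_single_mult_add[of 0 "ksign k F" "w (F - {k})" "chi (F - {k})"]
            by (simp add: Var_def wedge_def e_def ksign_mpoly)
        qed (simp add: wedge_def)
      qed
      finally show ?thesis by simp
    qed simp
    then have "(\<Sum>F\<in>Pow V. Z F * c F) = (\<Sum>F\<in>Pow V. Z F * kcobd V e F)"
      by (simp only:)
    also have "\<dots> = 0" unfolding sum_kcobd_kbd[OF V] Z(2) by simp
    finally have "(\<Sum>F\<in>Pow V. Z F * c F) = 0" .
    then show False using cZ by simp
  qed
  ultimately show ?thesis unfolding koszul_nonzero_def by blast
qed

section \<open>The independence complex of a cycle\<close>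

definition sparse :: "nat set \<Rightarrow> bool" where
  "sparse S \<longleftrightarrow> (\<forall>i\<in>S. Suc i \<notin> S)"

definition cyc :: "nat \<Rightarrow> nat set set" where
  "cyc n = {S. S \<subseteq> {1..n} \<and> sparse S \<and> \<not> (1 \<in> S \<and> n \<in> S)}"

lemma down_closed_cyc: "down_closed (cyc n)"
  by (auto simp: down_closed_def cyc_def sparse_def)

text \<open>The independence complex of the path on \<open>a + 1, \<dots>, a + L\<close> together with isolated
  vertices \<open>F\<close>.\<close>

definition path_complex :: "nat \<Rightarrow> nat \<Rightarrow> nat set \<Rightarrow> nat set set" where
  "path_complex a L F = {S. S \<subseteq> {a<..a + L} \<union> F \<and> sparse (S \<inter> {a<..a + L})}"

lemma path_complex_iff:
  "S \<in> path_complex a L F \<longleftrightarrow> (\<forall>i\<in>S. i \<in> F \<or> a < i \<and> i \<le> a + L) \<and>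
    (\<forall>i. a < i \<longrightarrow> i < a + L \<longrightarrow> i \<in> S \<longrightarrow> Suc i \<notin> S)"
  by (auto simp: path_complex_def sparse_def)

text \<open>The vertex a + m + 2 is the last but one of the path. In its star both neighbours
  disappear, so three path vertices are traded for one isolated vertex.\<close>

lemma path_complex_colon:
  assumes "F \<inter> {a<..a + (m + 3)} = {}"
  shows "{S. insert (a + m + 2) S \<in> path_complex a (m + 3) F} = path_complex a m (insert (a + m + 2) F)"
proof (intro equalityI subsetI)
  fix S assume "S \<in> {S. insert (a + m + 2) S \<in> path_complex a (m + 3) F}"
  then have 1: "\<And>i. i \<in> S \<Longrightarrow> i \<in> F \<or> a < i \<and> i \<le> a + (m + 3)"
    and 2: "\<And>i. a < i \<Longrightarrow> i < a + (m + 3) \<Longrightarrow> i \<in> insert (a + m + 2) S \<Longrightarrow> Suc i \<notin> insert (a + m + 2) S"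
    unfolding path_complex_iff mem_Collect_eq by blast+
  have 3: "a + m + 3 \<notin> S" "a + m + 1 \<notin> S"
  proof -
    have "Suc (a + m + 2) \<notin> insert (a + m + 2) S" by (rule 2) auto
    then show "a + m + 3 \<notin> S" by (simp add: eval_nat_numeral)
    show "a + m + 1 \<notin> S"
    proof
      assume "a + m + 1 \<in> S"
      then have "Suc (a + m + 1) \<notin> insert (a + m + 2) S" by (intro 2) auto
      then show False by simp
    qed
  qed
  have "i \<in> insert (a + m + 2) F \<or> a < i \<and> i \<le> a + m" if "i \<in> S" for i
  proof -
    have "i \<in> F \<or> a < i \<and> i \<le> a + m \<or> i = a + m + 1 \<or> i = a + m + 2 \<or> i = a + m + 3"
      using 1[OF that] by arith
    then show ?thesis using 3 that by blast
  qed
  then show "S \<in> path_complex a m (insert (a + m + 2) F)"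
    unfolding path_complex_iff using 2 by auto
next
  fix S assume "S \<in> path_complex a m (insert (a + m + 2) F)"
  then have 1: "\<And>i. i \<in> S \<Longrightarrow> i \<in> F \<or> i = a + m + 2 \<or> a < i \<and> i \<le> a + m"
    and 2: "\<And>i. a < i \<Longrightarrow> i < a + m \<Longrightarrow> i \<in> S \<Longrightarrow> Suc i \<notin> S"
    unfolding path_complex_iff by blast+
  have 3: "a + m + 3 \<notin> S" "a + m + 1 \<notin> S" using 1[of "a + m + 3"] 1[of "a + m + 1"] assms by auto
  have 4: "Suc i \<notin> insert (a + m + 2) S" if i: "a < i" "i < a + (m + 3)" "i \<in> insert (a + m + 2) S" for i
  proof -
    consider "i < a + m" | "i = a + m" | "i = a + m + 1" | "i = a + m + 2" using i by linarith
    then show ?thesis by cases (use 2 3 i in \<open>auto simp: eval_nat_numeral\<close>)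
  qed
  have "i \<in> F \<or> a < i \<and> i \<le> a + (m + 3)" if "i \<in> insert (a + m + 2) S" for i using 1[of i] that by auto
  then show "S \<in> {S. insert (a + m + 2) S \<in> path_complex a (m + 3) F}"
    unfolding path_complex_iff mem_Collect_eq using 4 by blast
qed

text \<open>Without the last but one vertex the endpoint becomes isolated: the path loses two
  vertices and F gains one.\<close>

lemma path_complex_remove:
  assumes "F \<inter> {a<..a + (m + 3)} = {}"
  shows "{S \<in> path_complex a (m + 3) F. a + m + 2 \<notin> S} = path_complex a (m + 1) (insert (a + m + 3) F)"
proof (intro equalityI subsetI)
  fix S assume "S \<in> {S \<in> path_complex a (m + 3) F. a + m + 2 \<notin> S}"
  then have 1: "\<And>i. i \<in> S \<Longrightarrow> i \<in> F \<or> a < i \<and> i \<le> a + (m + 3)"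
    and 2: "\<And>i. a < i \<Longrightarrow> i < a + (m + 3) \<Longrightarrow> i \<in> S \<Longrightarrow> Suc i \<notin> S" and 3: "a + m + 2 \<notin> S"
    unfolding path_complex_iff mem_Collect_eq by blast+
  have "i \<in> insert (a + m + 3) F \<or> a < i \<and> i \<le> a + (m + 1)" if "i \<in> S" for i
  proof -
    have "i \<in> F \<or> a < i \<and> i \<le> a + (m + 1) \<or> i = a + m + 2 \<or> i = a + m + 3" using 1[OF that] by arith
    then show ?thesis using 3 that by blast
  qed
  then show "S \<in> path_complex a (m + 1) (insert (a + m + 3) F)" 
    unfolding path_complex_iff using 2 by auto
next
  fix S assume "S \<in> path_complex a (m + 1) (insert (a + m + 3) F)"
  then have 1: "\<And>i. i \<in> S \<Longrightarrow> i \<in> F \<or> i = a + m + 3 \<or> a < i \<and> i \<le> a + (m + 1)"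
    and 2: "\<And>i. a < i \<Longrightarrow> i < a + (m + 1) \<Longrightarrow> i \<in> S \<Longrightarrow> Suc i \<notin> S"
    unfolding path_complex_iff by blast+
  have 3: "a + m + 2 \<notin> S" using 1[of "a + m + 2"] assms by auto
  have 4: "Suc i \<notin> S" if i: "a < i" "i < a + (m + 3)" "i \<in> S" for i
  proof -
    consider "i < a + (m + 1)" | "i = a + m + 1" | "i = a + m + 2" using i by linarith
    then show ?thesis by cases (use 2 3 i in \<open>auto simp: eval_nat_numeral\<close>)
  qed
  have "i \<in> F \<or> a < i \<and> i \<le> a + (m + 3)" if "i \<in> S" for i using 1[of i] that by auto
  then show "S \<in> {S \<in> path_complex a (m + 3) F. a + m + 2 \<notin> S}"
    unfolding path_complex_iff mem_Collect_eq using 3 4 by blast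
qed

lemma down_closed_path_complex: "down_closed (path_complex a L F)"
  unfolding down_closed_def path_complex_def sparse_def by blast

text \<open>The bound is card F + ceil(L/3). The star trades L for L - 3 and adds one isolated
  vertex, which preserves it; the deletion trades L for L - 2 and adds one, which cannot lower
  it.\<close>

lemma depth_ge_path_complex:
  assumes "finite V" "{a<..a + L} \<union> F \<subseteq> V" "F \<inter> {a<..a + L} = {}" "d \<le> card F + (L + 2) div 3"
  shows "depth_ge V d (path_complex a L F)"
  using assms(2-)
proof (induction L arbitrary: F rule: less_induct)
  case (less L)
  have fin: "finite F" using less.prems assms(1) finite_subset by blast
  consider "L = 0" | "L = 1" | "L = 2" | "L \<ge> 3" by linarith
  then show ?case
  proof cases
    case 1
    then have "path_complex a L F = Pow F" by (auto simp: path_complex_def sparse_def)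
    then show ?thesis using less.prems 1 by (auto intro: depth_ge.simplex)
  next
    case 2
    then have "path_complex a L F = Pow (insert (Suc a) F)" by (auto simp: path_complex_def sparse_def)
    moreover have "Suc a \<notin> F" using less.prems(2) 2 by auto
    ultimately show ?thesis using less.prems 2 fin by (auto intro!: depth_ge.simplex)
  next
    case 3
    have nF: "a + 1 \<notin> F" "a + 2 \<notin> F" using less.prems(2) 3 by auto
    have iff: "S \<in> path_complex a L F \<longleftrightarrow> S \<subseteq> insert (a + 1) (insert (a + 2) F) \<and> \<not> (a + 1 \<in> S \<and> a + 2 \<in> S)" for S
    proof -
      have 1: "a < i \<and> i \<le> a + 2 \<longleftrightarrow> i = a + 1 \<or> i = a + 2" for i by auto
      have 2: "(a < i \<longrightarrow> i < a + 2 \<longrightarrow> Q) \<longleftrightarrow> (i = a + 1 \<longrightarrow> Q)" for i Q by auto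
      show ?thesis unfolding path_complex_iff 3 1 2 by auto
    qed
    have "{S. insert (a + 2) S \<in> path_complex a L F} = Pow (insert (a + 2) F)"
      unfolding iff using nF by auto
    moreover have "{S \<in> path_complex a L F. a + 2 \<notin> S} = Pow (insert (a + 1) F)"
      unfolding iff using nF by auto
    moreover have "depth_ge V d (Pow (insert (a + 2) F))" "depth_ge V d (Pow (insert (a + 1) F))"
      using less.prems 3 fin nF by (auto intro!: depth_ge.simplex)
    ultimately show ?thesis
      by (intro depth_ge.branch[OF down_closed_path_complex, of _ _ "a + 2"]) (simp_all only:)
  next
    case 4
    define m where "m = L - 3"
    have L: "L = m + 3" using 4 by (simp add: m_def)
    have nF: "a + m + 2 \<notin> F" "a + m + 3 \<notin> F" using less.prems(2) by (auto simp: L)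
    have "depth_ge V d (path_complex a m (insert (a + m + 2) F))"
      using less.prems fin nF by (intro less.IH) (auto simp: L)
    moreover have "depth_ge V d (path_complex a (m + 1) (insert (a + m + 3) F))"
      using less.prems fin nF by (intro less.IH) (auto simp: L)
    moreover have "F \<inter> {a<..a + (m + 3)} = {}" using less.prems(2) by (simp add: L)
    ultimately show ?thesis unfolding L
      by (intro depth_ge.branch[OF down_closed_path_complex, of _ _ "a + m + 2"])
         (simp_all only: path_complex_colon path_complex_remove)
  qed
qed

text \<open>Branching at n. The star consists of n and the path on 2, ..., n - 2, of value 1 +
  ceil((n - 3)/3) = ceil(n/3). The deletion is the path on 1, ..., n - 1, of value ceil((n - 1)/3),
  which falls short exactly when n is 1 modulo 3.\<close>

lemma depth_ge_cyc:
  assumes "n \<ge> 3" "n mod 3 \<noteq> 1"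
  shows "depth_ge {1..n} ((n + 2) div 3) (cyc n)"
proof (rule depth_ge.branch[OF down_closed_cyc, of _ _ n])
  have "{S. insert n S \<in> cyc n} = path_complex 1 (n - 3) {n}"
  proof (intro equalityI subsetI)
    fix S assume "S \<in> {S. insert n S \<in> cyc n}"
    then have 1: "S \<subseteq> {1..n}" "sparse (insert n S)" "1 \<notin> S" using assms by (auto simp: cyc_def)
    then have 2: "n - 1 \<notin> S" using assms(1) by (auto simp: sparse_def dest!: bspec[of _ _ "n - 1"])
    have "i \<in> {n} \<or> 1 < i \<and> i \<le> 1 + (n - 3)" if "i \<in> S" for i
    proof -
      have "i \<noteq> 1" "i \<noteq> n - 1" "1 \<le> i" "i \<le> n" using 1 2 that by auto
      then show ?thesis using assms(1) by auto
    qed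
    then show "S \<in> path_complex 1 (n - 3) {n}" 
      unfolding path_complex_iff using 1(2) by (auto simp: sparse_def)
  next
    fix S assume "S \<in> path_complex 1 (n - 3) {n}"
    then have 1: "\<And>i. i \<in> S \<Longrightarrow> i = n \<or> 1 < i \<and> i \<le> n - 2" 
      and 2: "\<And>i. 1 < i \<Longrightarrow> i < n - 2 \<Longrightarrow> i \<in> S \<Longrightarrow> Suc i \<notin> S"
      unfolding path_complex_iff using assms(1) by auto
    have "Suc i \<notin> insert n S" if "i \<in> insert n S" for i
      using that 1[of i] 1[of "Suc i"] 2[of i] assms(1) by auto
    then show "S \<in> {S. insert n S \<in> cyc n}" 
      using assms(1) 1 by (fastforce simp: cyc_def sparse_def)
  qed
  moreover have "depth_ge {1..n} ((n + 2) div 3) (path_complex 1 (n - 3) {n})"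
    using assms by (intro depth_ge_path_complex) auto
  ultimately show "depth_ge {1..n} ((n + 2) div 3) {S. insert n S \<in> cyc n}" by simp
next
  have "{S \<in> cyc n. n \<notin> S} = path_complex 0 (n - 1) {}"
  proof (intro equalityI subsetI)
    fix S assume S: "S \<in> {S \<in> cyc n. n \<notin> S}"
    then have "i \<noteq> n \<and> 1 \<le> i \<and> i \<le> n" if "i \<in> S" for i using that by (auto simp: cyc_def)
    then have "0 < i \<and> i \<le> 0 + (n - 1)" if "i \<in> S" for i using that by fastforce
    then show "S \<in> path_complex 0 (n - 1) {}"
      using S by (auto simp: path_complex_iff cyc_def sparse_def)
  next
    fix S assume "S \<in> path_complex 0 (n - 1) {}"
    then have 1: "\<And>i. i \<in> S \<Longrightarrow> 0 < i \<and> i \<le> n - 1" 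
      and 2: "\<And>i. 0 < i \<Longrightarrow> i < n - 1 \<Longrightarrow> i \<in> S \<Longrightarrow> Suc i \<notin> S"
      unfolding path_complex_iff by auto
    have n: "n \<notin> S" using 1[of n] assms(1) by auto
    have "Suc i \<notin> S" if "i \<in> S" for i
      using 1[OF that] 1[of "Suc i"] 2[OF _ _ that] by linarith
    moreover have "S \<subseteq> {1..n}" using 1 by fastforce
    ultimately show "S \<in> {S \<in> cyc n. n \<notin> S}" using n by (simp add: cyc_def sparse_def)
  qed
  moreover have "depth_ge {1..n} ((n + 2) div 3) (path_complex 0 (n - 1) {})"
    using assms by (intro depth_ge_path_complex) (auto, presburger)
  ultimately show "depth_ge {1..n} ((n + 2) div 3) {S \<in> cyc n. n \<notin> S}" by simp
qed

section \<open>Cycles and cocycles\<close>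

definition unit_chain :: "nat set \<Rightarrow> 'a::comm_ring_1" where
  "unit_chain F = (if F = {} then 1 else 0)"

text \<open>The product \<open>(e\<^sub>p - e\<^sub>p\<^sub>+\<^sub>1)(e\<^sub>p\<^sub>+\<^sub>3 - e\<^sub>p\<^sub>+\<^sub>4) \<cdots>\<close> of \<open>m\<close> factors: the boundary of a cross-polytope.\<close>

fun cross :: "nat \<Rightarrow> nat \<Rightarrow> nat set \<Rightarrow> 'a::comm_ring_1" where
  "cross p 0 = unit_chain"
| "cross p (Suc m) = (\<lambda>F. wedge p (cross (p + 3) m) F - wedge (Suc p) (cross (p + 3) m) F)"

definition prog :: "nat \<Rightarrow> nat \<Rightarrow> nat set" where
  "prog p m = (\<lambda>i. p + 3 * i) ` {..<m}"

lemma prog_0 [simp]: "prog p 0 = {}"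
  by (simp add: prog_def)

lemma prog_Suc: "prog p (Suc m) = insert p (prog (p + 3) m)"
  unfolding prog_def lessThan_Suc_eq_insert_0 image_insert image_image by (simp add: add.assoc)

lemma prog_ge: "i \<in> prog p m \<Longrightarrow> p \<le> i \<and> i + 2 < p + 3 * m"
  by (auto simp: prog_def)

lemma finite_prog [simp]: "finite (prog p m)"
  by (simp add: prog_def)

lemma card_prog [simp]: "card (prog p m) = m"
  unfolding prog_def by (subst card_image) (auto simp: inj_on_def)

lemma ksign_min: "(\<And>i. i \<in> F \<Longrightarrow> p \<le> i) \<Longrightarrow> ksign p F = 1"
proof -
  assume "\<And>i. i \<in> F \<Longrightarrow> p \<le> i"
  then have "{i \<in> F. i < p} = {}" by fastforce
  then show ?thesis by (simp only: ksign_def card.empty power_0)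
qed

lemma cross_prog: "cross p m (prog p m) = 1"
proof (induction m arbitrary: p)
  case (Suc m)
  have "p \<notin> prog (p + 3) m" "Suc p \<notin> prog p (Suc m)" by (auto dest: prog_ge simp: prog_Suc)
  moreover have "(ksign p (prog p (Suc m)) :: 'a) = 1" by (rule ksign_min) (use prog_ge in blast)
  ultimately show ?case using Suc[of "p + 3"] by (simp add: wedge_def prog_Suc)
qed (simp add: unit_chain_def)

lemma cross_prog_Suc: "cross p m (prog (Suc p) m) = (- 1) ^ m"
proof (induction m arbitrary: p)
  case (Suc m)
  have "Suc p \<notin> prog (Suc p + 3) m" "p \<notin> prog (Suc p) (Suc m)" 
    by (auto dest: prog_ge simp: prog_Suc)
  moreover have "(ksign (Suc p) (prog (Suc p) (Suc m)) :: 'a) = 1" by (rule ksign_min) (use prog_ge in blast)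
  ultimately show ?case using Suc[of "p + 3"] by (simp add: wedge_def prog_Suc)
qed (simp add: unit_chain_def)

lemma wedge_nonzero: "wedge k w F \<noteq> 0 \<Longrightarrow> k \<in> F \<and> w (F - {k}) \<noteq> 0"
  by (auto simp: wedge_def split: if_splits)

lemma sparse_insert:
  assumes "sparse (F - {k})" "\<And>i. i \<in> F \<Longrightarrow> i \<noteq> k \<Longrightarrow> k + 2 \<le> i \<or> i + 2 \<le> k"
  shows "sparse F"
  unfolding sparse_def
proof safe
  fix i assume i: "i \<in> F" "Suc i \<in> F"
  then show False using assms(1) assms(2)[of i] assms(2)[of "Suc i"]
    by (cases "i = k"; cases "Suc i = k") (auto simp: sparse_def)
qed

text \<open>Here \<open>sparse\<close> rules out only edges of the path; the closing edge is ruled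
  out by the interval, whenever that misses 1 or n.\<close>

definition supported :: "nat \<Rightarrow> nat \<Rightarrow> nat \<Rightarrow> (nat set \<Rightarrow> 'a::comm_ring_1) \<Rightarrow> bool" where
  "supported a b i w \<longleftrightarrow> (\<forall>F. w F \<noteq> 0 \<longrightarrow> F \<subseteq> {a..<b} \<and> card F = i \<and> sparse F)"

text \<open>At least one vertex stays free between k and the interval {a..<b}, so no edge
  arises.\<close>

lemma supported_wedge:
  assumes "supported a b i w" "k + 2 \<le> a \<or> b < k" "a' \<le> a" "b \<le> b'" "a' \<le> k" "k < b'" "i' = Suc i"
  shows "supported a' b' i' (wedge k w)"
  unfolding supported_def
proof safe
  fix F assume "wedge k w F \<noteq> 0"
  then have k: "k \<in> F" and "w (F - {k}) \<noteq> 0" using wedge_nonzero by blast+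
  then have F: "F - {k} \<subseteq> {a..<b}" "card (F - {k}) = i" "sparse (F - {k})"
    using assms(1) by (auto simp: supported_def)
  have fin: "finite F" using finite_subset[OF F(1)] by simp
  show "sparse F"
    by (rule sparse_insert[OF F(3)]) (use F(1) assms(2) in fastforce)
  show "card F = i'" using F(2) fin k assms(7) by (metis card.remove)
  show "x \<in> {a'..<b'}" if "x \<in> F" for x
    using that F(1) assms(3-6) by (cases "x = k") fastforce+
qed

lemma supported_diff: "supported a b i v \<Longrightarrow> supported a b i w \<Longrightarrow> supported a b i (\<lambda>F. v F - w F)"
  by (simp add: supported_def) metis

lemma supported_scale: "supported a b i w \<Longrightarrow> supported a b i (\<lambda>F. c * w F)"
  unfolding supported_def by (metis mult_zero_right)

lemma supported_cross: "supported p (p + 3 * m - 1) m (cross p m :: nat set \<Rightarrow> 'a::comm_ring_1)"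
proof (induction m arbitrary: p)
  case (Suc m)
  have s: "supported (p + 3) (p + 3 + 3 * m - 1) m (cross (p + 3) m :: nat set \<Rightarrow> 'a)" using Suc .
  have "supported p (p + 3 * Suc m - 1) (Suc m) (wedge k (cross (p + 3) m) :: nat set \<Rightarrow> 'a)" if "k = p \<or> k = Suc p" for k
    by (rule supported_wedge[OF s]) (use that in auto)
  then show ?case by (auto intro: supported_diff)
qed (simp add: supported_def unit_chain_def sparse_def)

text \<open>The Leibniz rule with the boundary of e_a equal to 1. It makes every factor e_p -
  e_(p+1) a cycle, and hence the products \<open>cross\<close>.\<close>

lemma kbd_wedge:
  assumes "finite V" "a \<in> V"
  shows "kbd V (wedge a w) F = w F - wedge a (kbd V w) F"
proof -
  have "kbd V (wedge a w) F + wedge a (kbd V w) F = (\<Sum>k\<in>V. contr k (wedge a w) F + wedge a (contr k w) F)"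
    unfolding kbd_def by (simp add: wedge_sum sum.distrib)
  also have "\<dots> = w F" using assms by (simp add: contr_wedge)
  finally show ?thesis by (simp add: eq_diff_eq)
qed

lemma kbd_diff: "kbd V (\<lambda>F. v F - w F) F = kbd V v F - kbd V w F"
  by (simp add: kbd_def contr_diff sum_subtractf)

lemma kbd_scale: "kbd V (\<lambda>F. c * w F) F = c * kbd V w F"
  by (simp add: kbd_def contr_scale sum_distrib_left)

lemma kbd_cross:
  "finite V \<Longrightarrow> {p..<p + 3 * m - 1} \<subseteq> V \<Longrightarrow> kbd V (cross p m :: nat set \<Rightarrow> 'a::comm_ring_1) F = 0"
proof (induction m arbitrary: p F)
  case 0
  have "contr k unit_chain F = (0 :: 'a)" for k by (simp add: contr_def unit_chain_def)
  then show ?case by (simp add: kbd_def)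
next
  case (Suc m)
  have "p \<in> V" "Suc p \<in> V" using Suc.prems by auto
  moreover have "kbd V (cross (p + 3) m) = (\<lambda>F. 0 :: 'a)"
    using Suc by (intro ext Suc.IH) auto
  ultimately show ?case using Suc.prems by (simp only: cross.simps kbd_diff kbd_wedge) (simp add: wedge_def)
qed

text \<open>Since p and p + 2 are not adjacent, e_p - e_(p+2) is the boundary of an edge of the
  complex, so up to boundaries the factor e_p - e_(p+1) may be replaced by e_(p+2) - e_(p+1). Doing
  so factor by factor, from the last one on, turns \<open>cross p m\<close> into (-1)^m times
  \<open>cross (Suc p) m\<close>; this chain collects the pieces. When p + 2 comes in, the next
  factor already starts at p + 4 and leaves room for it.\<close>

fun homotopy :: "nat \<Rightarrow> nat \<Rightarrow> nat set \<Rightarrow> 'a::comm_ring_1" where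
  "homotopy p 0 = (\<lambda>F. 0)"
| "homotopy p (Suc m) = (\<lambda>F. (-1) ^ m * wedge (p + 2) (wedge p (cross (p + 4) m)) F
    - (wedge p (homotopy (p + 3) m) F - wedge (Suc p) (homotopy (p + 3) m) F))"

lemma supported_homotopy: "supported p (p + 3 * m) (Suc m) (homotopy p m :: nat set \<Rightarrow> 'a::comm_ring_1)"
proof (induction m arbitrary: p)
  case (Suc m)
  have s: "supported (p + 3) (p + 3 + 3 * m) (Suc m) (homotopy (p + 3) m :: nat set \<Rightarrow> 'a)" using Suc .
  have 1: "supported p (p + 3 * Suc m) (Suc (Suc m)) (wedge k (homotopy (p + 3) m) :: nat set \<Rightarrow> 'a)" if "k = p \<or> k = Suc p" for k
    by (rule supported_wedge[OF s]) (use that in auto)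
  have c: "supported (p + 4) (p + 4 + 3 * m - 1) m (cross (p + 4) m :: nat set \<Rightarrow> 'a)" by (rule supported_cross)
  have "supported p (p + 3 * Suc m) (Suc (Suc m)) (wedge p (wedge (p + 2) (cross (p + 4) m)) :: nat set \<Rightarrow> 'a)"
    by (rule supported_wedge[OF supported_wedge[OF c, of "p + 2" "p + 2" "p + 3 * Suc m"]]) auto
  then have "supported p (p + 3 * Suc m) (Suc (Suc m)) (wedge (p + 2) (wedge p (cross (p + 4) m)) :: nat set \<Rightarrow> 'a)"
    using wedge_wedge[of "p + 2" p "cross (p + 4) m :: nat set \<Rightarrow> 'a"] by (simp add: supported_def)
  then show ?case unfolding homotopy.simps
    by (intro supported_diff supported_scale 1) auto
qed (simp add: supported_def)

lemma kbd_homotopy: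
  assumes "finite V"
  shows "{p..<p + 3 * m} \<subseteq> V \<Longrightarrow> kbd V (homotopy p m :: nat set \<Rightarrow> 'a::comm_ring_1) F = cross p m F - (- 1) ^ m * cross (Suc p) m F"
proof (induction m arbitrary: p F)
  case 0
  have "kbd V (\<lambda>F. 0) F = (0 :: 'a)" by (auto simp: kbd_def contr_def intro!: sum.neutral)
  then show ?case by simp
next
  case (Suc m)
  have V: "p \<in> V" "Suc p \<in> V" "p + 2 \<in> V" using Suc.prems by auto
  have c: "kbd V (cross (p + 4) m) = (\<lambda>F. 0 :: 'a)"
    using Suc.prems by (intro ext kbd_cross assms) auto
  have h: "kbd V (homotopy (p + 3) m :: nat set \<Rightarrow> 'a) = (\<lambda>F. cross (p + 3) m F - (- 1) ^ m * cross (p + 4) m F)"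
    using Suc by (intro ext) (subst Suc.IH, auto simp: add.commute)
  have w: "kbd V (wedge p (cross (p + 4) m :: nat set \<Rightarrow> 'a)) = cross (p + 4) m"
    by (intro ext) (subst kbd_wedge[OF assms V(1)], simp add: c wedge_def)
  have e: "Suc p + 3 = p + 4" "Suc (Suc p) = p + 2" by simp_all
  show ?case
    unfolding homotopy.simps cross.simps e kbd_diff kbd_scale kbd_wedge[OF assms V(1)]
      kbd_wedge[OF assms V(2)] kbd_wedge[OF assms V(3)] w h wedge_diff wedge_scale
    by (simp add: algebra_simps)
qed


section \<open>Characteristic cochains of dominating independent sets\<close>

definition indic :: "nat set \<Rightarrow> nat set \<Rightarrow> 'a::comm_ring_1" where
  "indic S F = (if F = S then 1 else 0)"

lemma sum_mult_indic:
  assumes "finite V" "S \<subseteq> V"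
  shows "(\<Sum>F\<in>Pow V. Z F * indic S F) = Z S"
  using assms by (simp add: indic_def if_distrib[of "\<lambda>x. _ * x"] cong: if_cong)

lemma kcobd_eq_0: "(\<And>k. k \<in> V \<Longrightarrow> k \<in> F \<Longrightarrow> w (F - {k}) = 0) \<Longrightarrow> kcobd V w F = 0"
  by (auto simp: kcobd_def wedge_def intro!: sum.neutral)

lemma wedge_indic_nonzero: "wedge k (indic S) F \<noteq> 0 \<Longrightarrow> k \<in> F \<and> F - {k} = S"
  by (auto simp: wedge_def indic_def split: if_splits)

lemma kcobd_indic_eq_0:
  assumes "\<And>k. k \<in> V \<Longrightarrow> k \<notin> S \<Longrightarrow> F \<noteq> insert k S"
  shows "kcobd V (indic S) F = 0"
proof (rule kcobd_eq_0)
  fix k assume "k \<in> V" "k \<in> F"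
  then show "indic S (F - {k}) = 0" using assms[of k] by (auto simp: indic_def insert_absorb)
qed

text \<open>The triples centred at the points of \<open>prog p m\<close> tile the integers from p -
  1 to p + 3m - 2, and t is the index of the triple containing j. The clause
  \<open>j \<noteq> 0\<close> guards the truncated subtraction.\<close>

lemma prog_neighbour:
  assumes "p \<le> j + 1" "j + 1 < p + 3 * m" "j \<notin> prog p m"
  shows "Suc j \<in> prog p m \<or> j \<noteq> 0 \<and> j - 1 \<in> prog p m"
proof -
  define t where "t = (j + 1 - p) div 3"
  have t: "t < m" using assms by (auto simp: t_def)
  have mem: "p + 3 * t \<in> prog p m" using t by (simp add: prog_def)
  have "j + 1 - p = 3 * t + (j + 1 - p) mod 3" by (simp add: t_def)
  moreover have "(j + 1 - p) mod 3 < 3" by simp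
  ultimately have "j + 1 = p + 3 * t \<or> j + 1 = p + 3 * t + 1 \<or> j + 1 = p + 3 * t + 2" using assms(1) by linarith
  then show ?thesis
  proof (elim disjE)
    assume "j + 1 = p + 3 * t"
    then show ?thesis using mem by simp
  next
    assume "j + 1 = p + 3 * t + 1"
    then have "j = p + 3 * t" by simp
    then show ?thesis using mem assms(3) by simp
  next
    assume "j + 1 = p + 3 * t + 2"
    then have "j - 1 = p + 3 * t" "j \<noteq> 0" by simp_all
    then show ?thesis using mem by simp
  qed
qed

lemma sparse_insert_prog:
  assumes "sparse F" "insert j (prog p m) \<subseteq> F" "p \<le> j + 1" "j + 1 < p + 3 * m" "j \<notin> prog p m"
  shows False
  using prog_neighbour[OF assms(3-5)]
proof (elim disjE conjE)
  assume "Suc j \<in> prog p m" then show False using assms(1,2) by (auto simp: sparse_def)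
next
  assume "j \<noteq> 0" "j - 1 \<in> prog p m"
  then have "j - 1 \<in> F" "Suc (j - 1) \<in> F" using assms(2) by auto
  then show False using assms(1) by (auto simp: sparse_def)
qed

text \<open>The vertices 1, 4, 7, ... dominate the cycle: along the path their neighbourhoods reach
  at least n - 1, and n is a neighbour of 1 by the closing edge. This serves both the cocycle
  condition for the characteristic cochain and the maximality of the set.\<close>

lemma insert_prog_notin_cyc:
  assumes "n \<ge> 3" "n mod 3 \<noteq> 1" "j \<in> {1..n}" "j \<notin> prog 1 ((n + 2) div 3)"
    "insert j (prog 1 ((n + 2) div 3)) \<subseteq> F"
  shows "F \<notin> cyc n"
proof
  assume F: "F \<in> cyc n"
  define d where "d = (n + 2) div 3"
  have "1 \<in> prog 1 d" using assms(1) by (auto simp: d_def prog_def image_iff intro!: bexI[of _ 0])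
  then have "n \<notin> F" using F assms by (auto simp: cyc_def d_def)
  then have "j \<noteq> n" using assms by auto
  then have "j + 1 < 1 + 3 * d" using assms(2,3) by (simp add: d_def) presburger
  then show False using sparse_insert_prog[of F j 1 d] F assms by (auto simp: cyc_def d_def)
qed

lemma sparse_prog: "sparse (prog p m)"
proof -
  have "supported p (p + 3 * m - 1) m (cross p m :: nat set \<Rightarrow> int)" by (rule supported_cross)
  moreover have "(cross p m (prog p m) :: int) \<noteq> 0" by (simp add: cross_prog)
  ultimately show ?thesis by (auto simp: supported_def)
qed

text \<open>The cross-polytope on 1, ..., 3k - 1 misses the vertex 3k, so the closing edge does not
  meet it. It contains the maximal independent set 1, 4, ..., 3k - 2 with coefficient 1, whose
  characteristic cochain therefore detects it.\<close>

lemma koszul_nonzero_cyc_mod_0: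
  assumes "k \<ge> 1"
  shows "koszul_nonzero {1..3 * k} Var (sr (cyc (3 * k)) :: 'k::field mpoly set) k"
proof (rule koszul_nonzero_sr[where c = "indic (prog 1 k)" and Z = "cross 1 k"])
  have d: "(3 * k + 2) div 3 = k" by presburger
  show "kcobd {1..3 * k} (indic (prog 1 k)) F = (0::'k)" if "F \<in> cyc (3 * k)" for F
  proof (rule kcobd_indic_eq_0, rule notI)
    fix j assume "j \<in> {1..3 * k}" "j \<notin> prog 1 k" "F = insert j (prog 1 k)"
    then show False using insert_prog_notin_cyc[of "3 * k" j F, unfolded d] that assms by auto
  qed
  show "F \<in> cyc (3 * k) \<and> F \<subseteq> {1..3 * k} \<and> card F = k" if "cross 1 k F \<noteq> (0::'k)" for F
  proof -
    have "F \<subseteq> {1..<1 + 3 * k - 1} \<and> card F = k \<and> sparse F"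
      using supported_cross[of 1 k, where 'a = 'k] that by (auto simp: supported_def)
    then show ?thesis using assms by (auto simp: cyc_def)
  qed
  show "kbd {1..3 * k} (cross 1 k) F = (0::'k)" for F by (rule kbd_cross) auto
  have "prog 1 k \<subseteq> {1..3 * k}" by (auto dest: prog_ge)
  then show "(\<Sum>F\<in>Pow {1..3 * k}. cross 1 k F * indic (prog 1 k) F) \<noteq> (0::'k)"
    by (simp add: sum_mult_indic cross_prog)
qed simp

lemma koszul_nonzero_cyc_mod_2:
  assumes "n = 3 * k + 2" "k \<ge> 1"
  shows "koszul_nonzero {1..n} Var (sr (cyc n) :: 'k::field mpoly set) (Suc k)"
proof -
  \<comment> \<open>A sphere made of two cones and a cylinder. The cone from n needs a base avoiding
    1 and n - 1, namely \<open>cross 2 k\<close>; the cone from 1 needs one avoiding 2 and n, namely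
    \<open>cross 3 k\<close>. The chain \<open>homotopy 2 k\<close> joins the two bases, and the
    signs make the boundaries cancel.\<close>
  define Z :: "nat set \<Rightarrow> 'k" where 
    "Z = (\<lambda>F. (wedge n (cross 2 k) F - homotopy 2 k F) - (- 1) ^ k * wedge 1 (cross 3 k) F)"
  have d: "(n + 2) div 3 = Suc k" using assms by presburger
  have hom: "supported 2 n (Suc k) (homotopy 2 k :: nat set \<Rightarrow> 'k)"
    using supported_homotopy[of 2 k] assms by simp
  have cr2: "supported 2 (n - 1) k (cross 2 k :: nat set \<Rightarrow> 'k)"
    using supported_cross[of 2 k] assms by simp
  have cr3: "supported 3 n k (cross 3 k :: nat set \<Rightarrow> 'k)"
    using supported_cross[of 3 k] assms by simp
  have s1: "supported 2 (n + 1) (Suc k) (wedge n (cross 2 k) :: nat set \<Rightarrow> 'k)"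
    by (rule supported_wedge[OF cr2]) (use assms in auto)
  have s3: "supported 1 n (Suc k) (wedge 1 (cross 3 k) :: nat set \<Rightarrow> 'k)"
    by (rule supported_wedge[OF cr3]) (use assms in auto)
  show ?thesis
  proof (rule koszul_nonzero_sr[where c = "indic (prog 1 (Suc k))" and Z = Z])
    show "kcobd {1..n} (indic (prog 1 (Suc k))) F = (0::'k)" if "F \<in> cyc n" for F
    proof (rule kcobd_indic_eq_0, rule notI)
      fix j assume "j \<in> {1..n}" "j \<notin> prog 1 (Suc k)" "F = insert j (prog 1 (Suc k))"
      moreover have "n mod 3 \<noteq> 1" "n \<ge> 3" using assms by presburger+
      ultimately show False using insert_prog_notin_cyc[of n j F, unfolded d] that by auto
    qed
    show "F \<in> cyc n \<and> F \<subseteq> {1..n} \<and> card F = Suc k" if ZF: "Z F \<noteq> 0" for F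
    proof -
      consider "wedge n (cross 2 k) F \<noteq> (0::'k)" | "homotopy 2 k F \<noteq> (0::'k)" | "wedge 1 (cross 3 k) F \<noteq> (0::'k)"
        using ZF by (fastforce simp: Z_def)
      then show ?thesis
      proof cases
        case 1
        then have "F \<subseteq> {2..<n + 1} \<and> card F = Suc k \<and> sparse F" using s1 by (auto simp: supported_def)
        then show ?thesis by (auto simp: cyc_def)
      next
        case 2
        then have "F \<subseteq> {2..<n} \<and> card F = Suc k \<and> sparse F" using hom by (auto simp: supported_def)
        then show ?thesis by (auto simp: cyc_def)
      next
        case 3
        then have "F \<subseteq> {1..<n} \<and> card F = Suc k \<and> sparse F" using s3 by (auto simp: supported_def)
        then show ?thesis by (auto simp: cyc_def)
      qed
    qed
    have c2: "kbd {1..n} (cross 2 k) = (\<lambda>F. 0::'k)" by (intro ext kbd_cross) (use assms in auto)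
    have c3: "kbd {1..n} (cross 3 k) = (\<lambda>F. 0::'k)" by (intro ext kbd_cross) (use assms in auto)
    have h: "kbd {1..n} (homotopy 2 k) F = cross 2 k F - (- 1) ^ k * (cross 3 k F :: 'k)" for F
      by (subst kbd_homotopy) (use assms in \<open>auto simp: eval_nat_numeral\<close>)
    have w0: "wedge j (\<lambda>F. 0::'k) F = 0" for j F by (simp add: wedge_def)
    have V: "finite {1..n}" "n \<in> {1..n}" "1 \<in> {1..n}" using assms by auto
    show "kbd {1..n} Z F = 0" for F
      unfolding Z_def kbd_diff kbd_scale kbd_wedge[OF V(1,2)] kbd_wedge[OF V(1,3)] c2 c3 h w0 by simp
    \<comment> \<open>Only the cone from 1 has faces containing the vertex 1, so it alone
      contributes to the pairing.\<close>
    have P: "prog 1 (Suc k) = insert 1 (prog 4 k)" by (simp add: prog_Suc)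
    have "n \<notin> prog 1 (Suc k)" using assms by (auto dest!: prog_ge)
    then have "wedge n (cross 2 k) (prog 1 (Suc k)) = (0::'k)" by (simp add: wedge_def)
    moreover have "homotopy 2 k (prog 1 (Suc k)) = (0::'k)"
      using hom P by (auto simp: supported_def)
    moreover have "wedge 1 (cross 3 k) (prog 1 (Suc k)) = ((- 1) ^ k :: 'k)"
    proof -
      have "(ksign 1 (prog 1 (Suc k)) :: 'k) = 1" by (rule ksign_min) (auto dest: prog_ge)
      moreover have "1 \<in> prog 1 (Suc k)" unfolding P by simp
      moreover have "prog 1 (Suc k) - {1} = prog (Suc 3) k"
      proof -
        have "1 \<notin> prog 4 k" "Suc 3 = 4" by (auto dest: prog_ge)
        then show ?thesis unfolding P by simp
      qed
      ultimately show ?thesis unfolding wedge_def by (simp only: if_True cross_prog_Suc mult_1)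
    qed
    ultimately have "Z (prog 1 (Suc k)) = - 1" by (simp add: Z_def flip: power_add mult_2)
    moreover have "prog 1 (Suc k) \<subseteq> {1..n}" using assms by (auto dest: prog_ge)
    ultimately show "(\<Sum>F\<in>Pow {1..n}. Z F * indic (prog 1 (Suc k)) F) \<noteq> 0"
      by (simp add: sum_mult_indic)
  qed simp
qed

section \<open>The cocycle for cycles of length 3k + 1\<close>

lemma kcobd_wedge: "kcobd V (wedge a w) F = - wedge a (kcobd V w) F"
  unfolding kcobd_def wedge_sum by (subst wedge_wedge) (simp add: sum_negf)

lemma kcobd_add: "kcobd V (\<lambda>F. v F + w F) F = kcobd V v F + kcobd V w F"
  by (simp add: kcobd_def wedge_add sum.distrib)

lemma kcobd_scale: "kcobd V (\<lambda>F. c * w F) F = c * kcobd V w F"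
  by (simp add: kcobd_def wedge_scale sum_distrib_left)

lemma kcobd_zero: "kcobd V (\<lambda>F. 0) F = 0"
  by (auto simp: kcobd_def wedge_def intro!: sum.neutral)

text \<open>On independent sets the coboundaries of the summands telescope.\<close>

fun corr :: "nat \<Rightarrow> nat \<Rightarrow> nat \<Rightarrow> nat set \<Rightarrow> 'a::comm_ring_1" where
  "corr n p 0 = (\<lambda>F. 0)"
| "corr n p (Suc m) = (\<lambda>F. indic (insert n (prog (p + 3) m)) F + wedge (Suc p) (corr n (p + 3) m) F)"

lemma corr_nonzero: "corr n p m F \<noteq> 0 \<Longrightarrow> n \<in> F"
proof (induction m arbitrary: p F)
  case (Suc m)
  then consider "indic (insert n (prog (p + 3) m)) F \<noteq> (0::'a)" | "wedge (Suc p) (corr n (p + 3) m) F \<noteq> (0::'a)"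
    by fastforce
  then show ?case
  proof cases
    case 2
    then have "corr n (p + 3) m (F - {Suc p}) \<noteq> (0::'a)" using wedge_nonzero by blast
    then show ?thesis using Suc.IH by blast
  qed (auto simp: indic_def split: if_splits)
qed simp

text \<open>Let v be the characteristic cochain of n together with p + 3, p + 6, ..., n - 2. Of the
  vertices p, ..., n only p and p + 1 can join this set, so dv = e_p v + e_(p+1) v on independent
  sets. The first term is the claimed value; the second cancels against the coboundary of e_(p+1)
  times the recursive correction, the sign coming from moving d past e_(p+1). At the bottom n = p +
  2, and the second term vanishes because p + 1 and n are adjacent.\<close>

lemma kcobd_corr:
  assumes "p + 3 * m = n + 1" "p \<ge> 2" "m \<ge> 1" "F \<in> cyc n"
  shows "kcobd {p..n} (corr n p m) F = indic (insert n (prog p m)) F"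
  using assms
proof (induction m arbitrary: p F)
  case (Suc m)
  let ?v = "indic (insert n (prog (p + 3) m)) :: nat set \<Rightarrow> 'a"
  let ?c = "corr n (p + 3) m :: nat set \<Rightarrow> 'a"
  have sF: "sparse F" using Suc.prems by (auto simp: cyc_def)
  have wp: "wedge p ?v F = indic (insert n (prog p (Suc m))) F"
  proof -
    have *: "p \<notin> insert n (prog (p + 3) m)" using Suc.prems by (auto dest: prog_ge)
    have "ksign p F = (1::'a)" if "F = insert p (insert n (prog (p + 3) m))"
      by (rule ksign_min) (use that Suc.prems in \<open>auto dest: prog_ge\<close>)
    moreover have "p \<in> F \<and> F - {p} = insert n (prog (p + 3) m) \<longleftrightarrow> F = insert n (prog p (Suc m))"
      using * by (auto simp: prog_Suc)
    ultimately show ?thesis using * by (auto simp: wedge_def indic_def prog_Suc insert_commute)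
  qed
  have wv: "wedge j ?v F = 0" if j: "j \<in> {p + 2..n}" for j
  proof (rule ccontr)
    assume "wedge j ?v F \<noteq> 0"
    then have F: "j \<in> F" "F - {j} = insert n (prog (p + 3) m)"
      using wedge_indic_nonzero by blast+
    then have jn: "j \<notin> prog (p + 3) m" "j \<noteq> n" "n \<in> F" "insert j (prog (p + 3) m) \<subseteq> F" by auto
    show False
    proof (cases "j + 1 < p + 3 + 3 * m")
      case True
      then show False using sparse_insert_prog[OF sF jn(4)] jn(1) j by auto
    next
      case False
      then show False using j Suc.prems(1) jn(2) by auto
    qed
  qed
  have kv: "kcobd {p..n} ?v F = wedge p ?v F + wedge (Suc p) ?v F"
  proof -
    have "{p..n} = insert p (insert (Suc p) {p + 2..n})" using Suc.prems(1) by auto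
    then have "kcobd {p..n} ?v F = wedge p ?v F + (wedge (Suc p) ?v F + (\<Sum>j\<in>{p + 2..n}. wedge j ?v F))"
      by (simp add: kcobd_def)
    then show ?thesis using wv by simp
  qed
  have "kcobd {p..n} (wedge (Suc p) ?c) F = - wedge (Suc p) ?v F"
  proof (cases "m = 0")
    case True
    have "wedge (Suc p) ?v F = 0"
    proof (rule ccontr)
      assume "wedge (Suc p) ?v F \<noteq> 0"
      then have "Suc p \<in> F" "n \<in> F" using wedge_indic_nonzero[of "Suc p" _ F] by blast+
      moreover have "n = Suc (Suc p)" using Suc.prems(1) True by simp
      ultimately show False using sF by (auto simp: sparse_def)
    qed
    moreover have "wedge (Suc p) (\<lambda>F. 0::'a) = (\<lambda>F. 0)" by (auto simp: wedge_def)
    ultimately show ?thesis using True by (simp add: kcobd_zero)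
  next
    case False
    have "kcobd {p..n} (wedge (Suc p) ?c) F = - (\<Sum>j\<in>{p..n}. wedge (Suc p) (wedge j ?c) F)"
      unfolding kcobd_wedge by (simp add: kcobd_def[abs_def] wedge_sum)
    \<comment> \<open>Behind e_(p+1) the directions p, p + 1 and p + 2 vanish on sparse sets, which
      leaves the range of the induction hypothesis.\<close>
    also have "(\<Sum>j\<in>{p..n}. wedge (Suc p) (wedge j ?c) F) = (\<Sum>j\<in>{p + 3..n}. wedge (Suc p) (wedge j ?c) F)"
    proof (rule sum.mono_neutral_right)
      show "\<forall>j\<in>{p..n} - {p + 3..n}. wedge (Suc p) (wedge j ?c) F = 0"
      proof (rule ballI, rule ccontr)
        fix j assume j: "j \<in> {p..n} - {p + 3..n}" "wedge (Suc p) (wedge j ?c) F \<noteq> 0"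
        then have "Suc p \<in> F" "j \<in> F - {Suc p}" using wedge_nonzero by blast+
        moreover have "j = p \<or> j = Suc p \<or> j = Suc (Suc p)" using j(1) by auto
        ultimately show False using sF by (auto simp: sparse_def)
      qed
    qed auto
    also have "\<dots> = wedge (Suc p) (kcobd {p + 3..n} ?c) F" by (simp add: kcobd_def[abs_def] wedge_sum)
    also have "\<dots> = wedge (Suc p) ?v F"
    proof -
      have "F - {Suc p} \<in> cyc n" using down_closedD[OF down_closed_cyc Suc.prems(4)] by blast
      then have "kcobd {p + 3..n} ?c (F - {Suc p}) = ?v (F - {Suc p})"
        using Suc.prems False by (intro Suc.IH) auto
      then show ?thesis by (simp add: wedge_def)
    qed
    finally show ?thesis .
  qed
  then show ?case using kv wp by (simp add: kcobd_add)
qed simp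

lemma koszul_nonzero_cyc_mod_1:
  assumes "n = 3 * k + 1" "k \<ge> 1"
  shows "koszul_nonzero {1..n} Var (sr (cyc n) :: 'k::field mpoly set) k"
proof -
  \<comment> \<open>The neighbourhoods of 2, 5, ..., n - 2 cover 1, ..., n - 1, so the first term
    fails to be a cocycle only in direction n. There (-1)^k is the sign of n behind k smaller
    vertices, and the correction taken with that sign removes the defect.\<close>
  define c :: "nat set \<Rightarrow> 'k" where "c = (\<lambda>F. indic (prog 2 k) F + (- ((- 1) ^ k)) * corr n 2 k F)"
  show ?thesis
  proof (rule koszul_nonzero_sr[where c = c and Z = "cross 1 k"])
    fix F assume F: "F \<in> cyc n"
    have sF: "sparse F" "F \<subseteq> {1..n}" using F by (auto simp: cyc_def)
    have n2: "n \<notin> prog 2 k" using assms by (auto dest!: prog_ge)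
    have "kcobd {1..n} (corr n 2 k) F = wedge 1 (corr n 2 k) F + (kcobd {2..n} (corr n 2 k) F :: 'k)"
    proof -
      have "{1..n} = insert 1 {2..n}" using assms by auto
      then show ?thesis by (simp add: kcobd_def)
    qed
    moreover have "wedge 1 (corr n 2 k) F = (0::'k)"
    proof (rule ccontr)
      assume "wedge 1 (corr n 2 k) F \<noteq> (0::'k)"
      then have "1 \<in> F" "n \<in> F" using wedge_nonzero[of 1 "corr n 2 k :: nat set \<Rightarrow> 'k" F] 
          corr_nonzero[of n 2 k "F - {1}", where 'a = 'k] by auto
      then show False using F by (simp add: cyc_def)
    qed
    moreover have "kcobd {2..n} (corr n 2 k) F = (indic (insert n (prog 2 k)) F :: 'k)"
      using assms F by (intro kcobd_corr) auto
    ultimately have 1: "kcobd {1..n} (corr n 2 k) F = (indic (insert n (prog 2 k)) F :: 'k)" by simp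
    have "wedge j (indic (prog 2 k)) F = (0::'k)" if j: "j \<in> {1..n} - {n}" for j
    proof (rule ccontr)
      assume "wedge j (indic (prog 2 k)) F \<noteq> (0::'k)"
      then have "j \<in> F" "F - {j} = prog 2 k" using wedge_indic_nonzero by blast+
      then have "insert j (prog 2 k) \<subseteq> F" "j \<notin> prog 2 k" by auto
      then show False using sparse_insert_prog[OF sF(1), of j 2 k] j assms by auto
    qed
    then have "kcobd {1..n} (indic (prog 2 k)) F = (wedge n (indic (prog 2 k)) F :: 'k)"
      unfolding kcobd_def using assms by (subst sum.remove[of _ n]) auto
    also have "\<dots> = (- 1) ^ k * indic (insert n (prog 2 k)) F"
    proof (cases "F = insert n (prog 2 k)")
      case True
      have "{j \<in> F. j < n} = prog 2 k" using True assms by (auto dest: prog_ge)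
      then have "ksign n F = ((- 1) ^ k :: 'k)" by (simp add: ksign_def)
      then show ?thesis using True n2 by (simp add: wedge_def indic_def)
    next
      case False
      then have "\<not> (n \<in> F \<and> F - {n} = prog 2 k)" by auto
      then show ?thesis using False by (auto simp: wedge_def indic_def)
    qed
    finally show "kcobd {1..n} c F = 0" unfolding c_def kcobd_add kcobd_scale 1 by simp
  next
    fix F assume "cross 1 k F \<noteq> (0::'k)"
    then have "F \<subseteq> {1..<1 + 3 * k - 1} \<and> card F = k \<and> sparse F"
      using supported_cross[of 1 k, where 'a = 'k] by (auto simp: supported_def)
    then show "F \<in> cyc n \<and> F \<subseteq> {1..n} \<and> card F = k" using assms by (auto simp: cyc_def)
  next
    show "kbd {1..n} (cross 1 k) F = (0::'k)" for F by (rule kbd_cross) (use assms in auto)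
  next
    \<comment> \<open>The cycle avoids n and the correction lives on sets containing n, so the
      pairing sees only the first term.\<close>
    have "(\<Sum>F\<in>Pow {1..n}. cross 1 k F * c F) = (\<Sum>F\<in>Pow {1..n}. cross 1 k F * indic (prog 2 k) F)"
    proof (rule sum.cong[OF refl])
      fix F
      show "cross 1 k F * c F = cross 1 k F * indic (prog 2 k) F"
      proof (cases "cross 1 k F = (0::'k)")
        case False
        then have "F \<subseteq> {1..<1 + 3 * k - 1}"
          using supported_cross[of 1 k, where 'a = 'k] by (auto simp: supported_def)
        then have "n \<notin> F" using assms by auto
        then have "corr n 2 k F = (0::'k)" using corr_nonzero by blast
        then show ?thesis by (simp add: c_def)
      qed simp
    qed
    also have "\<dots> = cross 1 k (prog 2 k)"
      by (rule sum_mult_indic) (use assms in \<open>auto dest: prog_ge\<close>)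
    also have "\<dots> = (- 1) ^ k" using cross_prog_Suc[of 1 k, where 'a = 'k] by (simp add: eval_nat_numeral)
    finally show "(\<Sum>F\<in>Pow {1..n}. cross 1 k F * c F) \<noteq> 0" by simp
  qed simp
qed

section \<open>Chains of prime ideals\<close>

definition prime_set :: "'a::comm_ring_1 set \<Rightarrow> bool" where
  "prime_set J \<longleftrightarrow> is_ideal J \<and> 1 \<notin> J \<and> (\<forall>a b. a * b \<in> J \<longrightarrow> a \<in> J \<or> b \<in> J)"

lemma prime_set_sr_Pow: "prime_set (sr (Pow F) :: 'k::field mpoly set)"
  unfolding prime_set_def using prime_sr_Pow ideal_sr[OF down_closed_Pow] by (auto simp: sr_def)

lemma prime_set_power: "prime_set J \<Longrightarrow> y \<notin> J \<Longrightarrow> y ^ t \<notin> J"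
  by (induction t) (auto simp: prime_set_def)

definition power_product :: "'a::comm_ring_1 list \<Rightarrow> nat list \<Rightarrow> 'a" where
  "power_product ys es = prod_list (map2 (^) ys es)"

definition exponents :: "nat \<Rightarrow> nat \<Rightarrow> nat list set" where
  "exponents D d = {es. set es \<subseteq> {..D} \<and> length es = d}"

lemma finite_exponents: "finite (exponents D d)"
  by (simp add: exponents_def finite_lists_length_eq)

lemma card_exponents: "card (exponents D d) = (D + 1) ^ d"
  by (simp add: exponents_def card_lists_length_eq)

lemma sum_exponents_Suc: "(\<Sum>es\<in>exponents D (Suc m). f es) = (\<Sum>t\<le>D. \<Sum>es\<in>exponents D m. f (t # es))"
proof -
  have "exponents D (Suc m) = (\<lambda>(t, es). t # es) ` ({..D} \<times> exponents D m)"
    by (force simp: exponents_def length_Suc_conv image_iff)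
  moreover have "inj_on (\<lambda>(t, es). t # es) ({..D} \<times> exponents D m)" by (auto simp: inj_on_def)
  ultimately show ?thesis
    by (simp add: sum.reindex sum.cartesian_product case_prod_unfold)
qed

text \<open>Successive differences \<open>y\<^sub>i \<in> Q\<^sub>i\<^sub>+\<^sub>1 - Q\<^sub>i\<close> in a chain of primes are algebraically
  independent: in a polynomial relation modulo \<open>Q\<^sub>j\<close> the power of \<open>y\<^sub>j\<close> can be cancelled, and its
  constant term in \<open>y\<^sub>j\<close> is a relation modulo \<open>Q\<^sub>j\<^sub>+\<^sub>1\<close>.\<close>

lemma prime_chain_independent:
  fixes Q :: "nat \<Rightarrow> 'k::field mpoly set"
  assumes Q: "\<And>i. i \<le> d \<Longrightarrow> prime_set (Q i)" "\<And>i. i < d \<Longrightarrow> Q i \<subseteq> Q (Suc i)"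
    and y: "\<And>i. i < d \<Longrightarrow> y i \<in> Q (Suc i) - Q i"
  shows "j + m = d \<Longrightarrow> (\<Sum>es\<in>exponents D m. single 0 (c es) * power_product (map y [j..<j + m]) es) \<in> Q j
    \<Longrightarrow> es \<in> exponents D m \<Longrightarrow> c es = 0"
proof (induction m arbitrary: j c es)
  case 0
  have [simp]: "exponents D 0 = {[]}" by (auto simp: exponents_def)
  have "single 0 (c []) \<in> Q j" using 0 by (simp add: power_product_def)
  moreover have "prime_set (Q j)" using 0 Q by simp
  ultimately have "single 0 (inverse (c [])) * single 0 (c []) \<in> Q j" "1 \<notin> Q j"
    using ideal_mult[of "Q j"] by (auto simp: prime_set_def)
  then have "c [] = 0" by (cases "c [] = 0") (simp_all add: mult_single)
  then show ?case using 0 by simp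
next
  case (Suc m)
  define ys where "ys = map y [Suc j..<Suc j + m]"
  define g where "g t = (\<Sum>es\<in>exponents D m. single 0 (c (t # es)) * power_product ys es)" for t
  have j: "j < d" using Suc.prems by simp
  have Qj: "prime_set (Q j)" "prime_set (Q (Suc j))" "Q j \<subseteq> Q (Suc j)" using Q j by auto
  then have J: "is_ideal (Q j)" "is_ideal (Q (Suc j))" by (auto simp: prime_set_def)
  have ys: "map y [j..<j + Suc m] = y j # ys" by (simp add: ys_def upt_conv_Cons del: upt_Suc)
  have sum: "(\<Sum>t\<le>D. y j ^ t * g t) \<in> Q j"
    using Suc.prems(2) unfolding sum_exponents_Suc ys g_def
    by (simp add: power_product_def sum_distrib_left mult_ac)
  have IH: "\<forall>es\<in>exponents D m. c (t # es) = 0" if "g t \<in> Q (Suc j)" for t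
    using Suc.IH[of "Suc j" "\<lambda>es. c (t # es)"] that Suc.prems(1) unfolding g_def ys_def by auto
  have "t \<le> D \<Longrightarrow> \<forall>es\<in>exponents D m. c (t # es) = 0" for t
  proof (induction t rule: less_induct)
    case (less t)
    have g0: "g s = 0" if "s < t" for s
      using less.IH[OF that] less.prems that unfolding g_def by (intro sum.neutral) auto
    have "(\<Sum>s\<le>D. y j ^ s * g s) = (\<Sum>s\<in>{t..D}. y j ^ s * g s)"
      by (rule sum.mono_neutral_right) (auto simp: g0)
    also have "\<dots> = (\<Sum>s\<in>{t..D}. y j ^ t * (y j ^ (s - t) * g s))"
      by (intro sum.cong refl) (simp add: mult.assoc[symmetric] power_add[symmetric])
    finally have "y j ^ t * (\<Sum>s\<in>{t..D}. y j ^ (s - t) * g s) \<in> Q j"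
      using sum by (simp add: sum_distrib_left)
    moreover have "y j ^ t \<notin> Q j" using prime_set_power[OF Qj(1)] y[OF j] by blast
    ultimately have "(\<Sum>s\<in>{t..D}. y j ^ (s - t) * g s) \<in> Q j" using Qj(1) by (auto simp: prime_set_def)
    then have 1: "(\<Sum>s\<in>{t..D}. y j ^ (s - t) * g s) \<in> Q (Suc j)" using Qj(3) by blast
    have eq: "(\<Sum>s\<in>{t..D}. y j ^ (s - t) * g s) = g t + (\<Sum>s\<in>{t..D} - {t}. y j ^ (s - t) * g s)"
      using less.prems by (subst sum.remove[of _ t]) auto
    have "(\<Sum>s\<in>{t..D} - {t}. y j ^ (s - t) * g s) \<in> Q (Suc j)"
    proof (rule ideal_sum[OF J(2)])
      fix s assume "s \<in> {t..D} - {t}"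
      then obtain k where "s - t = Suc k" by (metis Diff_iff Suc_pred' atLeastAtMost_iff diff_is_0_eq gr0I insertI1 le_antisym)
      then show "y j ^ (s - t) * g s \<in> Q (Suc j)"
        using y[OF j] ideal_mult_right[OF J(2)] by (simp add: mult.assoc)
    qed
    from ideal_diff[OF J(2) 1 this] have "g t \<in> Q (Suc j)" unfolding eq by simp
    then show ?case using IH by blast
  qed
  then show ?case using Suc.prems(3) by (auto simp: exponents_def length_Suc_conv)
qed

section \<open>Counting monomials of bounded degree\<close>

definition bounded_in :: "nat set \<Rightarrow> nat \<Rightarrow> 'k::field mpoly \<Rightarrow> bool" where
  "bounded_in F N p \<longleftrightarrow> (\<forall>m\<in>keys p. keys m \<subseteq> F \<and> deg m \<le> N)"

lemma bounded_in_mult: "bounded_in F M p \<Longrightarrow> bounded_in F N q \<Longrightarrow> bounded_in F (M + N) (p * q)"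
  unfolding bounded_in_def by (auto simp: keys_add_nat deg_add add_mono elim!: keys_mult_cases) blast+

lemma bounded_in_1: "bounded_in F N 1"
  by (simp add: bounded_in_def deg_def in_keys_iff[of _ 1] lookup_one when_def)

lemma bounded_in_mono: "bounded_in F M p \<Longrightarrow> M \<le> N \<Longrightarrow> bounded_in F N p"
  unfolding bounded_in_def by fastforce

lemma bounded_in_power: "bounded_in F M p \<Longrightarrow> bounded_in F (t * M) (p ^ t)"
  by (induction t) (auto simp: bounded_in_1 intro: bounded_in_mult)

lemma bounded_in_power_product:
  "\<forall>p\<in>set ys. bounded_in F M p \<Longrightarrow> es \<in> exponents D (length ys) \<Longrightarrow> bounded_in F (length ys * (D * M)) (power_product ys es)"
proof (induction ys arbitrary: es)
  case (Cons p ys)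
  then obtain e es' where es: "es = e # es'" "e \<le> D" "es' \<in> exponents D (length ys)"
    by (auto simp: exponents_def length_Suc_conv)
  have "bounded_in F (D * M) (p ^ e)" 
    by (rule bounded_in_mono[OF bounded_in_power[of F M]]) (use Cons.prems es in auto)
  moreover have "bounded_in F (length ys * (D * M)) (power_product ys es')" using Cons es by simp
  ultimately have "bounded_in F (D * M + length ys * (D * M)) (p ^ e * power_product ys es')" by (rule bounded_in_mult)
  then show ?case by (simp add: es power_product_def)
qed (simp add: power_product_def bounded_in_1)

lemma lookup_le_deg: "lookup m v \<le> deg m"
  by (cases "v \<in> keys m") (auto simp: deg_def in_keys_iff intro: member_le_sum)

lemma
  assumes "finite F"
  shows finite_bounded_monomials: "finite {m. keys m \<subseteq> F \<and> deg m \<le> N}"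
    and card_bounded_monomials: "card {m. keys m \<subseteq> F \<and> deg m \<le> N} \<le> (N + 1) ^ card F"
proof -
  let ?f = "\<lambda>m::nat \<Rightarrow>\<^sub>0 nat. restrict (lookup m) F"
  have inj: "inj_on ?f {m. keys m \<subseteq> F \<and> deg m \<le> N}"
  proof (rule inj_onI, rule poly_mapping_eqI)
    fix m m' v assume m: "m \<in> {m. keys m \<subseteq> F \<and> deg m \<le> N}" "m' \<in> {m. keys m \<subseteq> F \<and> deg m \<le> N}"
      and eq: "?f m = ?f m'"
    show "lookup m v = lookup m' v"
    proof (cases "v \<in> F")
      case True
      then show ?thesis using fun_cong[OF eq, of v] by simp
    next
      case False
      then have "v \<notin> keys m" "v \<notin> keys m'" using m by auto
      then show ?thesis by (simp add: in_keys_iff)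
    qed
  qed
  have sub: "?f ` {m. keys m \<subseteq> F \<and> deg m \<le> N} \<subseteq> (\<Pi>\<^sub>E v\<in>F. {..N})"
    using le_trans[OF lookup_le_deg] by auto
  have fin: "finite (\<Pi>\<^sub>E v\<in>F. {..N})" using assms by (intro finite_PiE) auto
  show "finite {m. keys m \<subseteq> F \<and> deg m \<le> N}" using finite_imageD[OF finite_subset[OF sub fin] inj] .
  show "card {m. keys m \<subseteq> F \<and> deg m \<le> N} \<le> (N + 1) ^ card F"
    using card_inj_on_le[OF inj sub fin] assms by (simp add: card_PiE)
qed

text \<open>If d > f = card F, the chain gives e = f + 1 algebraically independent polynomials in f
  variables, of degree at most some M. Their (D + 1)^e products with exponents up to D are linearly
  independent, yet lie in the span of at most (e D M + 1)^f monomials, which is impossible for large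
  D.\<close>

lemma prime_chain_length_le:
  fixes Q :: "nat \<Rightarrow> 'k::field mpoly set"
  assumes Q: "\<And>i. i \<le> d \<Longrightarrow> prime_set (Q i)" "\<And>i. i < d \<Longrightarrow> Q i \<subset> Q (Suc i)"
    and F: "finite F" "sr (Pow F) \<subseteq> Q 0"
  shows "d \<le> card F"
proof (rule ccontr)
  define f where "f = card F"
  define e where "e = Suc f"
  assume "\<not> d \<le> card F"
  then have e: "e \<le> d" by (simp add: e_def f_def)
  interpret vs: vector_space "\<lambda>c (p::'k mpoly). single 0 c * p"
    by unfold_locales (simp_all add: algebra_simps single_add mult_single mult.assoc[symmetric])
  have sub: "sr (Pow F) \<subseteq> Q i" if "i \<le> d" for i
    using that by (induction i) (use F(2) Q(2) in \<open>auto simp: Suc_le_eq less_imp_le psubset_eq\<close>)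
  \<comment> \<open>Restriction to F changes y only by an element of \<open>sr (Pow F)\<close>,
    which lies in every prime of the chain.\<close>
  have "\<exists>y. y \<in> Q (Suc i) - Q i \<and> y \<in> polys_in F" if "i < d" for i
  proof -
    obtain y where y: "y \<in> Q (Suc i)" "y \<notin> Q i" using Q(2)[OF \<open>i < d\<close>] by blast
    have J: "is_ideal (Q i)" "is_ideal (Q (Suc i))" using Q(1) \<open>i < d\<close> by (auto simp: prime_set_def)
    have "y - restr F y \<in> Q i" "y - restr F y \<in> Q (Suc i)"
      using sub[of i] sub[of "Suc i"] diff_restr \<open>i < d\<close> by auto
    then show ?thesis using y ideal_diff_iff[OF J(1)] ideal_diff_iff[OF J(2)] restr_in by blast
  qed
  then obtain y where y: "\<And>i. i < d \<Longrightarrow> y i \<in> Q (Suc i) - Q i" "\<And>i. i < d \<Longrightarrow> y i \<in> polys_in F"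
    by metis
  define ys where "ys = map y [0..<0 + e]"
  define M where "M = (\<Sum>p\<in>set ys. \<Sum>m\<in>keys p. deg m)"
  have M: "bounded_in F M p" if "p \<in> set ys" for p
    unfolding bounded_in_def
  proof safe
    fix m assume "m \<in> keys p"
    have "deg m \<le> (\<Sum>m\<in>keys p. deg m)" using \<open>m \<in> keys p\<close> by (intro member_le_sum) auto
    also have "\<dots> \<le> M" unfolding M_def using that by (intro member_le_sum) auto
    finally show "deg m \<le> M" .
    fix v assume "v \<in> keys m"
    moreover have "p \<in> polys_in F" using that y(2) e by (auto simp: ys_def)
    ultimately show "v \<in> F" using \<open>m \<in> keys p\<close> by (auto simp: polys_in_def)
  qed
  \<comment> \<open>Chosen so that ((e M + 1) (D + 1))^f equals D (D + 1)^f, which is smaller than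
    (D + 1)^e.\<close>
  define D where "D = (e * M + 1) ^ f"
  define b where "b = power_product ys"
  have len: "length ys = e" by (simp add: ys_def)
  have indep: "c es = 0" if "(\<Sum>es\<in>exponents D e. single 0 (c es) * b es) = 0" "es \<in> exponents D e" for c es
  proof (rule prime_chain_independent[where Q = Q and y = y and d = e and j = 0 and m = e and D = D])
    show "(\<Sum>es\<in>exponents D e. single 0 (c es) * power_product (map y [0..<0 + e]) es) \<in> Q 0"
      using that(1) Q(1)[of 0] by (simp add: b_def ys_def prime_set_def ideal_zero)
    show "Q i \<subseteq> Q (Suc i)" if "i < e" for i using Q(2)[of i] that e by auto
  qed (use e Q(1) y that in auto)
  have inj: "inj_on b (exponents D e)"
  proof (rule inj_onI, rule ccontr)
    fix es es' assume es: "es \<in> exponents D e" "es' \<in> exponents D e" "b es = b es'" "es \<noteq> es'"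
    define c where "c x = (if x = es then 1 else if x = es' then - 1 else 0 :: 'k)" for x
    have "(\<Sum>x\<in>exponents D e. single 0 (c x) * b x) = (\<Sum>x\<in>{es, es'}. single 0 (c x) * b x)"
      by (rule sum.mono_neutral_right) (use es finite_exponents in \<open>auto simp: c_def\<close>)
    also have "\<dots> = 0" using es by (simp add: c_def single_uminus)
    finally have "c es = 0" using indep es by blast
    then show False by (simp add: c_def)
  qed
  have "vs.independent (b ` exponents D e)"
  proof (rule vs.independent_if_scalars_zero)
    fix g x assume g: "(\<Sum>x\<in>b ` exponents D e. single 0 (g x) * x) = 0" "x \<in> b ` exponents D e"
    have "(\<Sum>es\<in>exponents D e. single 0 (g (b es)) * b es) = 0"
      using g(1) by (simp add: sum.reindex[OF inj])
    then show "g x = 0" using indep[of "\<lambda>es. g (b es)"] g(2) by auto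
  qed (simp add: finite_exponents)
  define T where "T = {m. keys m \<subseteq> F \<and> deg m \<le> e * (D * M)}"
  have T: "finite T" "card T \<le> (e * (D * M) + 1) ^ f"
    unfolding T_def f_def using finite_bounded_monomials card_bounded_monomials F(1) by blast+
  have "b ` exponents D e \<subseteq> vs.span ((\<lambda>m. single m 1) ` T)"
  proof safe
    fix es assume es: "es \<in> exponents D e"
    have "bounded_in F (e * (D * M)) (b es)"
      using bounded_in_power_product[of ys F M es D] M es unfolding b_def len by blast
    then have "keys (b es) \<subseteq> T" by (auto simp: bounded_in_def T_def)
    then have "b es = (\<Sum>m\<in>T. single m (lookup (b es) m))"
      using poly_mapping_sum_monomials[OF T(1)] by metis
    also have "\<dots> = (\<Sum>m\<in>T. single 0 (lookup (b es) m) * single m 1)" by (simp add: mult_single)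
    also have "\<dots> \<in> vs.span ((\<lambda>m. single m 1) ` T)"
      by (intro vs.span_sum vs.span_scale vs.span_base) auto
    finally show "b es \<in> vs.span ((\<lambda>m. single m 1) ` T)" .
  qed
  then have "card (b ` exponents D e) \<le> card ((\<lambda>m. single m (1::'k)) ` T)"
    using vs.independent_span_bound \<open>vs.independent (b ` exponents D e)\<close> T(1) by blast
  also have "\<dots> \<le> card T" by (rule card_image_le[OF T(1)])
  also note T(2)
  also have "e * (D * M) + 1 \<le> (e * M + 1) * (D + 1)" by (simp add: algebra_simps)
  then have "(e * (D * M) + 1) ^ f \<le> ((e * M + 1) * (D + 1)) ^ f" by (rule power_mono) simp
  also have "((e * M + 1) * (D + 1)) ^ f = D * (D + 1) ^ f"
    by (simp only: power_mult_distrib D_def[symmetric])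
  finally have "(D + 1) ^ e \<le> D * (D + 1) ^ f"
    by (simp only: card_image[OF inj] card_exponents)
  then show False by (simp add: e_def)
qed

section \<open>Associated primes of Stanley-Reisner rings\<close>

definition facet :: "nat set set \<Rightarrow> nat set \<Rightarrow> bool" where
  "facet D F \<longleftrightarrow> F \<in> D \<and> (\<forall>G\<in>D. F \<subseteq> G \<longrightarrow> G = F)"

lemma obtain_facet:
  assumes "finite D" "S \<in> D" obtains F where "facet D F" "S \<subseteq> F"
proof -
  obtain F where F: "F \<in> {G \<in> D. S \<subseteq> G}" "\<And>G. G \<in> {G \<in> D. S \<subseteq> G} \<Longrightarrow> F \<subseteq> G \<Longrightarrow> F = G"
    using finite_has_maximal[of "{G \<in> D. S \<subseteq> G}"] assms by auto
  have "facet D F" unfolding facet_def using F by auto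
  then show ?thesis using that F(1) by blast
qed

text \<open>A set is a face exactly when it lies in some facet; algebraically this is the primary
  decomposition of the squarefree monomial ideal.\<close>

lemma sr_eq_Inter_facets:
  assumes "down_closed D" "finite D"
  shows "p \<in> sr D \<longleftrightarrow> (\<forall>F. facet D F \<longrightarrow> p \<in> sr (Pow F))"
proof
  assume p: "p \<in> sr D"
  show "\<forall>F. facet D F \<longrightarrow> p \<in> sr (Pow F)"
  proof (intro allI impI)
    fix F assume "facet D F"
    then show "p \<in> sr (Pow F)" using p down_closedD[OF assms(1)] by (auto simp: sr_def facet_def)
  qed
next
  assume p: "\<forall>F. facet D F \<longrightarrow> p \<in> sr (Pow F)"
  show "p \<in> sr D" unfolding sr_def
  proof safe
    fix m assume "m \<in> keys p" "keys m \<in> D"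
    moreover obtain F where "facet D F" "keys m \<subseteq> F" using obtain_facet[OF assms(2) \<open>keys m \<in> D\<close>] .
    ultimately show False using p by (auto simp: sr_def)
  qed
qed

text \<open>The colon by u is the intersection of the prime components not containing u. A prime
  that is a finite intersection of primes is one of them: otherwise the product of elements chosen
  from the components, all outside the prime, would lie in it. The empty product covers the case
  that no component survives.\<close>

lemma prime_colon_sr:
  assumes D: "down_closed D" "finite D" and pr: "prime_set (colon (sr D) u)"
  shows "\<exists>F. facet D F \<and> colon (sr D) u = (sr (Pow F) :: 'k::field mpoly set)"
proof -
  define Fs where "Fs = {F. facet D F \<and> u \<notin> sr (Pow F)}"
  have fin: "finite Fs" by (rule finite_subset[OF _ D(2)]) (auto simp: Fs_def facet_def)
  have col: "r \<in> colon (sr D) u \<longleftrightarrow> (\<forall>F\<in>Fs. r \<in> sr (Pow F))" for r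
  proof -
    have "u * r \<in> sr (Pow F) \<longleftrightarrow> u \<in> sr (Pow F) \<or> r \<in> sr (Pow F)" for F
      using prime_set_sr_Pow[of F, where 'k = 'k] ideal_mult ideal_mult_right
      unfolding prime_set_def by blast
    then show ?thesis by (auto simp: colon_def sr_eq_Inter_facets[OF D] Fs_def)
  qed
  have "\<exists>F\<in>Fs. sr (Pow F) \<subseteq> colon (sr D) u"
  proof (rule ccontr)
    assume "\<not> (\<exists>F\<in>Fs. sr (Pow F) \<subseteq> colon (sr D) u)"
    then have "\<forall>F\<in>Fs. \<exists>g. g \<in> sr (Pow F) \<and> g \<notin> colon (sr D) u" by blast
    then obtain g where g: "\<And>F. F \<in> Fs \<Longrightarrow> g F \<in> sr (Pow F)" "\<And>F. F \<in> Fs \<Longrightarrow> g F \<notin> colon (sr D) u"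
      by metis
    have "prod g G \<notin> colon (sr D) u" if "finite G" "G \<subseteq> Fs" for G
      using that pr g(2) by (induction G rule: finite_induct) (auto simp: prime_set_def)
    then have "prod g Fs \<notin> colon (sr D) u" using fin by blast
    moreover have "prod g Fs \<in> sr (Pow F)" if "F \<in> Fs" for F
      using ideal_mult_right[OF ideal_sr[OF down_closed_Pow] g(1)[OF that]] 
      by (subst prod.remove[OF fin that]) 
    ultimately show False using col by blast
  qed
  then obtain F where "F \<in> Fs" "sr (Pow F) \<subseteq> colon (sr D) u" by blast
  then show ?thesis using col by (intro exI[of _ F]) (auto simp: Fs_def)
qed

lemma colon_sr_xmon:
  assumes "finite F" shows "colon (sr D) (xmon F) = sr {S. F \<union> S \<in> D}"
  using assms by (auto simp: colon_def sr_def xmon_def keys_single_mult keys_add_nat keys_chi)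

lemma colon_sr_facet:
  assumes "down_closed D" "facet D F" "finite F"
  shows "colon (sr D) (xmon F) = sr (Pow F)"
proof -
  have "F \<union> S \<in> D \<longleftrightarrow> S \<subseteq> F" for S
    using assms(2) by (auto simp: facet_def sup.absorb1)
  then show ?thesis by (simp add: colon_sr_xmon[OF assms(3)] Pow_def)
qed

text \<open>A maximal independent set dominates the cycle, and the closed neighbourhood
  \<open>nb i\<close> has at most three vertices; hence n is at most 3 card F.\<close>

lemma facet_cyc_card:
  assumes "n \<ge> 3" "facet (cyc n) F" shows "(n + 2) div 3 \<le> card F"
proof -
  define nb where "nb i = {i, if i = n then 1 else i + 1, if i = 1 then n else i - 1}" for i :: nat
  have F: "F \<in> cyc n" "\<And>G. G \<in> cyc n \<Longrightarrow> F \<subseteq> G \<Longrightarrow> G = F" using assms(2) by (auto simp: facet_def)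
  have fin: "finite F" by (rule finite_subset[of _ "{1..n}"]) (use F(1) in \<open>auto simp: cyc_def\<close>)
  have "{1..n} \<subseteq> (\<Union>i\<in>F. nb i)"
  proof
    fix v assume v: "v \<in> {1..n}"
    show "v \<in> (\<Union>i\<in>F. nb i)"
    proof (rule ccontr)
      assume nv: "v \<notin> (\<Union>i\<in>F. nb i)"
      have "v \<notin> F" using nv by (auto simp: nb_def)
      have a: "Suc v \<notin> F" using nv v by (auto simp: nb_def)
      have b: "Suc i \<noteq> v" if "i \<in> F" for i using nv v that F(1) by (auto simp: nb_def cyc_def)
      have c: "\<not> (v = n \<and> 1 \<in> F)" using nv by (auto simp: nb_def)
      have d: "\<not> (v = 1 \<and> n \<in> F)" using nv by (auto simp: nb_def)
      have "insert v F \<in> cyc n"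
        using F(1) v a b c d assms(1) unfolding cyc_def sparse_def by auto
      then show False using F(2) \<open>v \<notin> F\<close> by blast
    qed
  qed
  then have "card {1..n} \<le> card (\<Union>i\<in>F. nb i)" by (rule card_mono[rotated]) (simp add: fin nb_def)
  also have "\<dots> \<le> (\<Sum>i\<in>F. card (nb i))" by (rule card_UN_le[OF fin])
  also have "\<dots> \<le> (\<Sum>i\<in>F. 3)" by (rule sum_mono) (simp add: nb_def card_insert_if)
  finally show ?thesis by simp
qed

text \<open>The domination bound is attained. For n = 3k + 1 the progression would end at n, a
  neighbour of its first vertex 1.\<close>

lemma facet_prog:
  assumes "n \<ge> 3" "n mod 3 \<noteq> 1" shows "facet (cyc n) (prog 1 ((n + 2) div 3))"
proof -
  let ?F = "prog 1 ((n + 2) div 3)"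
  have r: "n mod 3 = 0 \<or> n mod 3 = 2" using assms by presburger
  have i: "i \<in> ?F \<Longrightarrow> 1 \<le> i \<and> i + 2 < 1 + 3 * ((n + 2) div 3)" for i using prog_ge .
  have "3 * ((n + 2) div 3) \<le> n + 1" using r by presburger
  then have "?F \<subseteq> {1..n}" "n \<notin> ?F" using i by fastforce+
  then have "?F \<in> cyc n" using sparse_prog by (auto simp: cyc_def)
  moreover have "G = ?F" if G: "G \<in> cyc n" "?F \<subseteq> G" for G
  proof (rule ccontr)
    assume "G \<noteq> ?F"
    then obtain j where "j \<in> G" "j \<notin> ?F" using G by blast
    then show False using insert_prog_notin_cyc[OF assms, of j G] G by (auto simp: cyc_def)
  qed
  ultimately show ?thesis by (simp add: facet_def)
qed

section \<open>Cosets of ideals of a subring\<close>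

text \<open>The carrier is a subset of a type-class ring and the operations are those of the type,
  so statements about records reduce to membership in sets of polynomials.\<close>

definition subring_record :: "'a::comm_ring_1 set \<Rightarrow> 'a ring" where
  "subring_record A = \<lparr>carrier = A, monoid.mult = (*), one = 1, zero = 0, add = (+)\<rparr>"

lemma poly_ring_eq: "poly_ring V = subring_record (polys_in V)"
  by (simp add: poly_ring_def subring_record_def polys_in_def)

lemma subring_record_simps [simp]:
  "carrier (subring_record A) = A" "monoid.mult (subring_record A) = (*)" "one (subring_record A) = 1"
  "zero (subring_record A) = 0" "add (subring_record A) = (+)"
  by (simp_all add: subring_record_def)

definition coset :: "'a::ab_group_add set \<Rightarrow> 'a \<Rightarrow> 'a set" where
  "coset I a = (\<lambda>i. i + a) ` I"

locale subring_ideal =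
  fixes A I :: "'a::comm_ring_1 set"
  assumes A0: "0 \<in> A" and A1: "1 \<in> A" and A_diff: "x \<in> A \<Longrightarrow> y \<in> A \<Longrightarrow> x - y \<in> A"
    and A_mult: "x \<in> A \<Longrightarrow> y \<in> A \<Longrightarrow> x * y \<in> A"
    and I_sub: "I \<subseteq> A" and I0: "0 \<in> I" and I_diff: "x \<in> I \<Longrightarrow> y \<in> I \<Longrightarrow> x - y \<in> I"
    and I_mult: "x \<in> A \<Longrightarrow> y \<in> I \<Longrightarrow> x * y \<in> I"
begin

lemma A_uminus: "x \<in> A \<Longrightarrow> - x \<in> A" using A_diff[of 0 x] A0 by simp
lemma A_add: "x \<in> A \<Longrightarrow> y \<in> A \<Longrightarrow> x + y \<in> A" using A_diff[of x "-y"] A_uminus by simp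
lemma I_uminus: "x \<in> I \<Longrightarrow> - x \<in> I" using I_diff[of 0 x] I0 by simp
lemma I_add: "x \<in> I \<Longrightarrow> y \<in> I \<Longrightarrow> x + y \<in> I" using I_diff[of x "-y"] I_uminus by simp

lemma I_mult_right: "y \<in> I \<Longrightarrow> x \<in> A \<Longrightarrow> y * x \<in> I"
  using I_mult[of x y] by (simp add: mult.commute)

lemma cring_record: "cring (subring_record A)"
proof (rule cringI)
  show "abelian_group (subring_record A)"
  proof (rule abelian_groupI)
    fix x assume "x \<in> carrier (subring_record A)"
    then show "\<exists>y\<in>carrier (subring_record A). y \<oplus>\<^bsub>subring_record A\<^esub> x = \<zero>\<^bsub>subring_record A\<^esub>"
      by (auto intro!: bexI[of _ "- x"] A_uminus)
  qed (auto simp: A0 A_add add_ac)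
  show "comm_monoid (subring_record A)"
    by (rule comm_monoidI) (auto simp: A1 A_mult mult_ac)
qed (simp add: distrib_right)

lemma mem_coset: "x \<in> coset I a \<longleftrightarrow> x - a \<in> I"
  by (force simp: coset_def image_iff)

lemma coset_eq_iff: "coset I a = coset I b \<longleftrightarrow> a - b \<in> I"
proof
  assume "coset I a = coset I b"
  moreover have "a \<in> coset I a" by (simp add: mem_coset I0)
  ultimately show "a - b \<in> I" by (simp add: mem_coset)
next
  assume ab: "a - b \<in> I"
  have "x - a \<in> I \<longleftrightarrow> x - b \<in> I" for x
    using I_add[of "x - a" "a - b"] I_diff[of "x - b" "a - b"] ab by auto
  then show "coset I a = coset I b" by (auto simp: mem_coset)
qed

lemma coset_0: "coset I 0 = I"
  by (auto simp: mem_coset)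

lemma coset_add: "(\<Union>x\<in>coset I a. \<Union>y\<in>coset I b. {x + y}) = coset I (a + b)"
proof (intro equalityI subsetI)
  fix z assume "z \<in> coset I (a + b)"
  then have "z - b \<in> coset I a" "b \<in> coset I b" "z = (z - b) + b"
    by (auto simp: mem_coset I0 algebra_simps)
  then show "z \<in> (\<Union>x\<in>coset I a. \<Union>y\<in>coset I b. {x + y})" by blast
next
  fix z assume "z \<in> (\<Union>x\<in>coset I a. \<Union>y\<in>coset I b. {x + y})"
  then obtain x y where xy: "x - a \<in> I" "y - b \<in> I" "z = x + y" by (auto simp: mem_coset)
  have "z - (a + b) = (x - a) + (y - b)" using xy(3) by simp
  then show "z \<in> coset I (a + b)" using I_add[OF xy(1,2)] by (simp only: mem_coset)
qed

lemma coset_mult: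
  assumes "r \<in> A" shows "(\<Union>u\<in>coset I a. coset I (r * u)) = coset I (r * a)"
proof -
  have "coset I (r * u) = coset I (r * a)" if "u \<in> coset I a" for u
    using that I_mult[OF assms, of "u - a"] by (simp add: coset_eq_iff mem_coset right_diff_distrib)
  moreover have "a \<in> coset I a" by (simp add: mem_coset I0)
  ultimately show ?thesis by blast
qed

lemma ideal_record: "ideal I (subring_record A)"
proof (rule idealI)
  show "ring (subring_record A)" using cring_record by (simp add: cring_def)
  interpret group "add_monoid (subring_record A)"
    using cring_record abelian_group.a_group cring.axioms(1) ring.is_abelian_group by blast
  have inv: "inv\<^bsub>add_monoid (subring_record A)\<^esub> x = - x" if "x \<in> A" for x
    using that by (intro inv_equality) (auto intro: A_uminus)
  show "subgroup I (add_monoid (subring_record A))"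
    by (rule subgroupI) (use I_sub I0 I_uminus I_add inv in auto)
qed (auto simp: I_mult I_mult_right)

abbreviation "N \<equiv> quot_module (self_module (subring_record A)) I"

lemma a_r_coset_record: "I +>\<^bsub>subring_record A\<^esub> a = coset I a" 
  "I +>\<^bsub>self_module (subring_record A)\<^esub> a = coset I a"
  by (auto simp: a_r_coset_def r_coset_def coset_def self_module_def)

lemma quot_simps:
  shows carrier_quot: "carrier N = coset I ` A"
    and zero_quot: "\<zero>\<^bsub>N\<^esub> = I"
    and add_quot: "coset I a \<oplus>\<^bsub>N\<^esub> coset I b = coset I (a + b)"
    and smult_quot: "r \<in> A \<Longrightarrow> r \<odot>\<^bsub>N\<^esub> coset I a = coset I (r * a)"
proof -
  show "carrier N = coset I ` A"
    unfolding quot_module_def A_RCOSETS_def'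
    by (auto simp: a_r_coset_record) (auto simp: self_module_def)
  show "\<zero>\<^bsub>N\<^esub> = I" by (simp add: quot_module_def)
  show "coset I a \<oplus>\<^bsub>N\<^esub> coset I b = coset I (a + b)"
    by (simp add: quot_module_def set_add_def' self_module_def coset_add)
  show "r \<odot>\<^bsub>N\<^esub> coset I a = coset I (r * a)" if "r \<in> A"
    using coset_mult[OF that] by (simp add: quot_module_def a_r_coset_record) (simp add: self_module_def)
qed

lemma group_quot: "group (add_monoid N)"
proof (rule groupI)
  fix x assume "x \<in> carrier (add_monoid N)"
  then obtain a where a: "a \<in> A" "x = coset I a" by (auto simp: carrier_quot)
  then have "coset I (- a) \<in> carrier N" "coset I (- a) \<oplus>\<^bsub>N\<^esub> x = \<zero>\<^bsub>N\<^esub>"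
    by (auto simp: carrier_quot add_quot zero_quot coset_0 A_uminus)
  then show "\<exists>y\<in>carrier (add_monoid N). y \<otimes>\<^bsub>add_monoid N\<^esub> x = \<one>\<^bsub>add_monoid N\<^esub>" by auto
next
  have z: "\<zero>\<^bsub>N\<^esub> = coset I 0" by (simp add: zero_quot coset_0)
  show "\<one>\<^bsub>add_monoid N\<^esub> \<in> carrier (add_monoid N)" using A0 by (auto simp: z carrier_quot)
  show "\<one>\<^bsub>add_monoid N\<^esub> \<otimes>\<^bsub>add_monoid N\<^esub> x = x" if "x \<in> carrier (add_monoid N)" for x
    using that by (auto simp: z carrier_quot add_quot)
qed (auto simp: carrier_quot add_quot A_add add_ac)

lemma submodule_quot:
  assumes K: "subring_ideal A K" shows "submodule (coset I ` K) (subring_record A) N"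
proof -
  interpret K: subring_ideal A K by fact
  interpret G: group "add_monoid N" by (rule group_quot)
  have z: "\<zero>\<^bsub>N\<^esub> = coset I 0" by (simp add: zero_quot coset_0)
  have inv: "inv\<^bsub>add_monoid N\<^esub> (coset I a) = coset I (- a)" if "a \<in> A" for a
    using that by (intro G.inv_equality) (auto simp: add_quot carrier_quot z A_uminus)
  have "subgroup (coset I ` K) (add_monoid N)"
  proof (rule G.subgroupI)
    show "coset I ` K \<subseteq> carrier (add_monoid N)" using K.I_sub by (auto simp: carrier_quot)
    show "coset I ` K \<noteq> {}" using K.I0 by blast
  qed (use K.I_sub in \<open>auto simp: inv K.I_uminus K.I_add add_quot subsetD\<close>)
  then show ?thesis
    by (auto simp: submodule_def submodule_axioms_def smult_quot K.I_mult)
qed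

lemma annihilator_quot:
  "annihilator (subring_record A) N (coset I a) = {r \<in> A. r * a \<in> I}"
proof -
  have "coset I b = I \<longleftrightarrow> b \<in> I" for b using coset_eq_iff[of b 0] by (simp add: coset_0)
  then show ?thesis by (simp add: annihilator_def smult_quot zero_quot cong: conj_cong)
qed

text \<open>Elements of (A/I)/(K/I) are sets of cosets of I, one for each coset of K, so the
  condition can be tested in A/K.\<close>

lemma nonzerodivisor_on_quot:
  assumes K: "subring_ideal A K" and IK: "I \<subseteq> K" and r: "r \<in> A"
  shows "nonzerodivisor_on (quot_module N (coset I ` K)) r \<longleftrightarrow> (\<forall>a\<in>A. r * a \<in> K \<longrightarrow> a \<in> K)"
proof -
  interpret K: subring_ideal A K by fact
  let ?M = "quot_module N (coset I ` K)"
  have rc: "coset I ` K +>\<^bsub>N\<^esub> coset I a = coset I ` coset K a" for a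
    by (auto simp: a_r_coset_def' add_quot coset_def[of K])
  have carrier: "carrier ?M = (\<lambda>a. coset I ` coset K a) ` A"
    by (auto simp: quot_module_def[of N] A_RCOSETS_def' carrier_quot rc)
  have self: "a \<in> coset K a" for a by (simp add: K.mem_coset K.I0)
  have smult: "r \<odot>\<^bsub>?M\<^esub> (coset I ` coset K a) = coset I ` coset K (r * a)" for a
  proof -
    have "coset K (r * u) = coset K (r * a)" if "u \<in> coset K a" for u
      using that K.I_mult[OF r, of "u - a"] by (simp add: K.coset_eq_iff K.mem_coset right_diff_distrib)
    then have "(\<Union>u\<in>coset K a. coset I ` coset K (r * u)) = (\<Union>u\<in>coset K a. coset I ` coset K (r * a))"
      by (intro SUP_cong refl) simp
    also have "\<dots> = coset I ` coset K (r * a)" using self[of a] by (intro SUP_const) blast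
    finally show ?thesis using r by (simp add: quot_module_def[of N] smult_quot rc)
  qed
  have eq: "coset I ` coset K a = coset I ` K \<longleftrightarrow> a \<in> K" for a
  proof
    assume "coset I ` coset K a = coset I ` K"
    then have "coset I a \<in> coset I ` K" using self[of a] by blast
    then obtain k where "k \<in> K" "a - k \<in> I" by (auto simp: coset_eq_iff)
    then show "a \<in> K" using K.I_add[of "a - k" k] IK by auto
  next
    assume "a \<in> K"
    then show "coset I ` coset K a = coset I ` K" using K.coset_eq_iff[of a 0] by (simp add: K.coset_0)
  qed
  have zero: "\<zero>\<^bsub>?M\<^esub> = coset I ` K" by (simp add: quot_module_def[of N])
  show ?thesis unfolding nonzerodivisor_on_def carrier zero by (auto simp: smult eq)
qed

lemma self_quotient: "carrier (subring_record A Quot I) = coset I ` A"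
  "\<one>\<^bsub>subring_record A Quot I\<^esub> = coset I 1" "\<zero>\<^bsub>subring_record A Quot I\<^esub> = coset I 0"
  "a \<in> A \<Longrightarrow> b \<in> A \<Longrightarrow> coset I a \<oplus>\<^bsub>subring_record A Quot I\<^esub> coset I b = coset I (a + b)"
  "a \<in> A \<Longrightarrow> b \<in> A \<Longrightarrow> coset I a \<otimes>\<^bsub>subring_record A Quot I\<^esub> coset I b = coset I (a * b)"
  using ideal.rcoset_mult_add[OF ideal_record, of a b]
  by (auto simp: FactRing_def A_RCOSETS_def' a_r_coset_record set_add_def' coset_add coset_0)

end

lemma subring_ideal_Int:
  assumes "is_ideal J" shows "subring_ideal (polys_in V) (J \<inter> polys_in V)"
  using assms
  by unfold_locales
    (auto simp: polys_in_closed ideal_zero ideal_diff ideal_mult)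

section \<open>Polynomial rings\<close>

lemma sr_Pow_subset: "D \<subseteq> Pow V \<Longrightarrow> sr (Pow V) \<subseteq> sr D"
  by (auto simp: sr_def)

lemma restr_mem_iff: "is_ideal J \<Longrightarrow> sr (Pow V) \<subseteq> J \<Longrightarrow> restr V p \<in> J \<longleftrightarrow> p \<in> J"
  using ideal_diff_iff[of J p "restr V p"] diff_restr[of p V] by blast

lemma primeideal_Int:
  assumes "prime_set Q" shows "primeideal (Q \<inter> polys_in V) (poly_ring V :: 'k::field mpoly ring)"
proof -
  have Q: "is_ideal Q" using assms by (simp add: prime_set_def)
  interpret subring_ideal "polys_in V" "Q \<inter> polys_in V" by (rule subring_ideal_Int[OF Q])
  show ?thesis unfolding poly_ring_eq
  proof (rule primeidealI[OF ideal_record cring_record])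
    show "carrier (subring_record (polys_in V)) \<noteq> Q \<inter> polys_in V"
      using assms polys_in_1 by (auto simp: prime_set_def)
  qed (use assms in \<open>auto simp: prime_set_def\<close>)
qed

lemma genideal_poly_ring:
  assumes "is_ideal J" "S \<subseteq> J" "S \<subseteq> polys_in V"
    and "\<And>H. ideal H (poly_ring V) \<Longrightarrow> S \<subseteq> H \<Longrightarrow> J \<inter> polys_in V \<subseteq> H"
  shows "Idl\<^bsub>poly_ring V\<^esub> S = J \<inter> (polys_in V :: 'k::field mpoly set)"
proof -
  interpret subring_ideal "polys_in V" "J \<inter> polys_in V" by (rule subring_ideal_Int[OF assms(1)])
  interpret R: ring "poly_ring V :: 'k mpoly ring"
    using cring_record by (simp add: poly_ring_eq cring_def)
  show ?thesis
  proof
    show "Idl\<^bsub>poly_ring V\<^esub> S \<subseteq> J \<inter> polys_in V"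
      by (rule R.genideal_minimal) (use assms(2,3) ideal_record in \<open>auto simp: poly_ring_eq\<close>)
    have c: "S \<subseteq> carrier (poly_ring V)" using assms(3) by (simp add: poly_ring_eq)
    show "J \<inter> polys_in V \<subseteq> Idl\<^bsub>poly_ring V\<^esub> S"
      using assms(4)[OF R.genideal_ideal[OF c] R.genideal_self[OF c]] .
  qed
qed

lemma poly_ring_ideal_sum:
  assumes "ideal H (poly_ring V)" "\<And>i. i \<in> B \<Longrightarrow> f i \<in> H" shows "sum f B \<in> (H :: 'k::field mpoly set)"
proof -
  interpret ideal H "poly_ring V" by fact
  show ?thesis using assms(2)
    by (induction B rule: infinite_finite_induct)
       (use additive_subgroup.zero_closed[OF additive_subgroup_axioms] additive_subgroup.a_closed[OF additive_subgroup_axioms] in \<open>auto simp: poly_ring_eq\<close>)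
qed

lemma poly_ring_ideal_mult:
  "ideal H (poly_ring V) \<Longrightarrow> x \<in> H \<Longrightarrow> a \<in> polys_in V \<Longrightarrow> a * x \<in> H"
  using ideal.I_l_closed[of H "poly_ring V" x a] by (simp add: poly_ring_eq)

text \<open>Each term of p is a multiple of a squarefree monomial in H. The test serves the
  irrelevant ideal, with S a single vertex, and the edge ideal, with S an edge.\<close>

lemma poly_ring_ideal_monomials:
  assumes H: "ideal H (poly_ring V)" and p: "p \<in> polys_in V"
    and div: "\<And>m. m \<in> keys p \<Longrightarrow> \<exists>S. finite S \<and> S \<subseteq> keys m \<and> xmon S \<in> H"
  shows "p \<in> (H :: 'k::field mpoly set)"
proof -
  have "single m (lookup p m) \<in> H" if m: "m \<in> keys p" for m
  proof -
    obtain S where S: "finite S" "S \<subseteq> keys m" "xmon S \<in> H" using div[OF m] by blast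
    have "m = (m - chi S) + chi S"
    proof (rule poly_mapping_eqI)
      fix v
      have "v \<in> S \<Longrightarrow> lookup m v \<noteq> 0" using S(2) by (auto simp: in_keys_iff)
      then show "lookup m v = lookup (m - chi S + chi S) v"
        using S(1) by (auto simp: lookup_add lookup_minus lookup_chi)
    qed
    then have "single m (lookup p m) = single (m - chi S) (lookup p m) * xmon S"
      by (simp add: xmon_def mult_single)
    moreover have "single (m - chi S) (lookup p m) \<in> polys_in V"
    proof -
      have "keys (m - chi S) \<subseteq> keys m" by (auto simp: in_keys_iff lookup_minus)
      then show ?thesis using p m by (auto simp: polys_in_def)
    qed
    ultimately show ?thesis using poly_ring_ideal_mult[OF H S(3)] by simp
  qed
  then have "(\<Sum>m\<in>keys p. single m (lookup p m)) \<in> H" by (rule poly_ring_ideal_sum[OF H])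
  then show ?thesis by (simp add: poly_mapping_sum_monomials)
qed

lemma irrelevant_ideal_eq:
  assumes "finite V"
  shows "irrelevant_ideal V = {p. lookup p 0 = 0} \<inter> (polys_in V :: 'k::field mpoly set)"
  unfolding irrelevant_ideal_def
proof (rule genideal_poly_ring)
  have "{p. lookup p 0 = 0} = (sr {{}} :: 'k mpoly set)" 
  proof -
    have "keys m = {} \<longleftrightarrow> m = 0" for m :: "nat \<Rightarrow>\<^sub>0 nat" by simp
    then show ?thesis by (auto simp: sr_def in_keys_iff)
  qed
  then show "is_ideal {p :: 'k mpoly. lookup p 0 = 0}"
    by (simp only:) (rule ideal_sr, simp add: down_closed_def)
  have "single v (Suc 0) \<noteq> 0" for v :: nat
    by (metis lookup_single_eq lookup_zero nat.distinct(1))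
  then show "Var ` V \<subseteq> {p. lookup p 0 = (0::'k)}" by (auto simp: Var_def lookup_single when_def)
  show "Var ` V \<subseteq> (polys_in V :: 'k mpoly set)" by (auto simp: Var_def polys_in_def)
  fix H :: "'k mpoly set" assume H: "ideal H (poly_ring V)" "Var ` V \<subseteq> H"
  show "{p. lookup p 0 = 0} \<inter> polys_in V \<subseteq> H"
  proof
    fix p assume p: "p \<in> {p. lookup p 0 = 0} \<inter> (polys_in V :: 'k mpoly set)"
    show "p \<in> H"
    proof (rule poly_ring_ideal_monomials[OF H(1)])
      fix m assume m: "m \<in> keys p"
      then have "m \<noteq> 0" using p by (auto simp: in_keys_iff)
      then have "keys m \<noteq> {}" by simp
      then obtain v where v: "v \<in> keys m" by blast
      then have "Var v \<in> H" using m p H(2) by (auto simp: polys_in_def)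
      moreover have "Var v = (xmon {v} :: 'k mpoly)" using prod_Var[of "{v}"] by simp
      ultimately show "\<exists>S. finite S \<and> S \<subseteq> keys m \<and> xmon S \<in> H" using v by (intro exI[of _ "{v}"]) simp
    qed (use p in blast)
  qed
qed

text \<open>Supplies the form of the regular elements required by the Koszul bound. The coefficients
  may come from the large ring, where the Koszul complex is formed.\<close>

lemma irrelevant_ideal_combination:
  assumes "finite V" "p \<in> irrelevant_ideal V"
  shows "\<exists>a. p = (\<Sum>k\<in>V. a k * (Var k :: 'k::field mpoly))"
proof -
  let ?J = "{p. \<exists>a. p = (\<Sum>k\<in>V. a k * (Var k :: 'k mpoly))}"
  have J: "is_ideal ?J"
  proof (rule is_idealI)
    show "0 \<in> ?J" by (auto intro!: exI[of _ "\<lambda>_. 0"])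
    fix x y assume "x \<in> ?J" "y \<in> ?J"
    then obtain a b where "x = (\<Sum>k\<in>V. a k * Var k)" "y = (\<Sum>k\<in>V. b k * Var k)" by blast
    then show "x + y \<in> ?J" 
      by (auto intro!: exI[of _ "\<lambda>k. a k + b k"] simp: distrib_right sum.distrib)
  next
    fix c x assume "x \<in> ?J"
    then obtain a where "x = (\<Sum>k\<in>V. a k * Var k)" by blast
    then show "c * x \<in> ?J" 
      by (auto intro!: exI[of _ "\<lambda>k. c * a k"] simp: sum_distrib_left mult.assoc)
  qed
  have "Var v \<in> ?J" if "v \<in> V" for v
  proof -
    have "(\<Sum>k\<in>V. (if k = v then 1 else 0) * Var k) = (Var v :: 'k mpoly)"
      using that assms(1) by (simp add: if_distrib[of "\<lambda>x. x * _"] cong: if_cong)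
    then show ?thesis by (auto intro!: exI[of _ "\<lambda>k. if k = v then 1 else 0"])
  qed
  interpret subring_ideal "polys_in V" "?J \<inter> polys_in V" by (rule subring_ideal_Int[OF J])
  interpret R: ring "poly_ring V :: 'k mpoly ring"
    using cring_record by (simp add: poly_ring_eq cring_def)
  have "irrelevant_ideal V \<subseteq> ?J \<inter> polys_in V" unfolding irrelevant_ideal_def
  proof (rule R.genideal_minimal)
    show "ideal (?J \<inter> polys_in V) (poly_ring V)" using ideal_record by (simp add: poly_ring_eq)
    show "Var ` V \<subseteq> ?J \<inter> polys_in V"
      using \<open>\<And>v. v \<in> V \<Longrightarrow> Var v \<in> ?J\<close> by (auto simp: polys_in_def Var_def)
  qed
  then show ?thesis using assms(2) by blast
qed

lemma edge_ideal_cycle_graph: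
  assumes "n \<ge> 3"
  shows "edge_ideal (cycle_graph n) = sr (cyc n) \<inter> (polys_in {1..n} :: 'k::field mpoly set)"
proof -
  let ?S = "{Var i * Var j | i j. {i, j} \<in> snd (cycle_graph n)} :: 'k mpoly set"
  have edge: "{i, j} \<in> snd (cycle_graph n) \<longleftrightarrow> i \<in> {1..n} \<and> j \<in> {1..n} \<and> 
      (j = Suc i \<or> i = Suc j \<or> i = 1 \<and> j = n \<or> i = n \<and> j = 1)" for i j
    using assms by (auto simp: cycle_graph_def doubleton_eq_iff)
  have x: "Var i * Var j = (xmon {i, j} :: 'k mpoly)" if "{i, j} \<in> snd (cycle_graph n)" for i j
  proof -
    have "i \<noteq> j" using that assms by (auto simp: edge)
    then show ?thesis using prod_Var[of "{i, j}", where 'a = 'k] by simp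
  qed
  have nc: "{i, j} \<notin> cyc n" if "{i, j} \<in> snd (cycle_graph n)" for i j
    using that by (auto simp: edge cyc_def sparse_def)
  have "Idl\<^bsub>poly_ring {1..n}\<^esub> ?S = sr (cyc n) \<inter> polys_in {1..n}"
  proof (rule genideal_poly_ring[OF ideal_sr[OF down_closed_cyc]])
    show "?S \<subseteq> sr (cyc n)" using nc by (auto simp: x) (simp add: sr_def xmon_def keys_chi)
    show "?S \<subseteq> polys_in {1..n}" by (auto simp: x) (auto simp: polys_in_def xmon_def keys_chi edge)
    fix H :: "'k mpoly set" assume H: "ideal H (poly_ring {1..n})" "?S \<subseteq> H"
    show "sr (cyc n) \<inter> polys_in {1..n} \<subseteq> H"
    proof
      fix p assume p: "p \<in> sr (cyc n) \<inter> (polys_in {1..n} :: 'k mpoly set)"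
      show "p \<in> H"
      proof (rule poly_ring_ideal_monomials[OF H(1)])
        fix m assume m: "m \<in> keys p"
        then have m': "keys m \<notin> cyc n" "keys m \<subseteq> {1..n}" using p by (auto simp: sr_def polys_in_def)
        have "\<exists>i j. i \<in> keys m \<and> j \<in> keys m \<and> {i, j} \<in> snd (cycle_graph n)"
        proof (cases "sparse (keys m)")
          case True
          then have "1 \<in> keys m" "n \<in> keys m" using m' by (auto simp: cyc_def)
          moreover from this have "{1, n} \<in> snd (cycle_graph n)" using m'(2) unfolding edge by blast
          ultimately show ?thesis by blast
        next
          case False
          then obtain i where "i \<in> keys m" "Suc i \<in> keys m" by (auto simp: sparse_def)
          moreover from this have "{i, Suc i} \<in> snd (cycle_graph n)" using m'(2) unfolding edge by blast
          ultimately show ?thesis by blast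
        qed
        then obtain i j where ij: "i \<in> keys m" "j \<in> keys m" "{i, j} \<in> snd (cycle_graph n)" by blast
        then have "xmon {i, j} \<in> H" using H(2) x by fastforce
        then show "\<exists>S. finite S \<and> S \<subseteq> keys m \<and> xmon S \<in> H" using ij by (intro exI[of _ "{i, j}"]) simp
      qed (use p in blast)
    qed
  qed
  then show ?thesis by (simp add: edge_ideal_def cycle_graph_def)
qed

lemma krull_dim_quotient:
  assumes "finite F" "F \<subseteq> V"
  shows "krull_dim (poly_ring V Quot (sr (Pow F) \<inter> (polys_in V :: 'k::field mpoly set))) = enat (card F)"
proof -
  let ?A = "polys_in V :: 'k mpoly set"
  let ?R = "subring_record ?A"
  let ?P = "sr (Pow F) \<inter> ?A"
  have srF: "is_ideal (sr (Pow F) :: 'k mpoly set)" by (rule ideal_sr[OF down_closed_Pow])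
  interpret subring_ideal ?A ?P by (rule subring_ideal_Int[OF srF])
  interpret R: cring ?R by (rule cring_record)
  interpret P: ideal ?P ?R by (rule ideal_record)
  have "krull_dim (?R Quot ?P) \<le> enat (card F)"
    unfolding krull_dim_def
  proof (rule Sup_least)
    fix x
    assume "x \<in> {enat k |k. \<exists>Q. (\<forall>i\<le>k. primeideal (Q i) (?R Quot ?P)) \<and> (\<forall>i<k. Q i \<subset> Q (Suc i))}"
    then obtain k Q where x: "x = enat k"
      and Q: "\<forall>i\<le>k. primeideal (Q i) (?R Quot ?P)" "\<forall>i<k. Q i \<subset> Q (Suc i)" by blast
    \<comment> \<open>The surjection of the large ring onto the quotient. Preimages under it turn a
      chain of primes of the quotient into one above \<open>sr (Pow F)\<close>, to which the
      counting bound applies.\<close>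
    define h where "h p = coset ?P (restr V p)" for p
    have h_add: "h (p + q) = h p \<oplus>\<^bsub>?R Quot ?P\<^esub> h q" for p q
      by (simp add: h_def self_quotient restr_in restr_add)
    have h_mult: "h (p * q) = h p \<otimes>\<^bsub>?R Quot ?P\<^esub> h q" for p q
      by (simp add: h_def self_quotient restr_in restr_mult)
    have h_car: "h p \<in> carrier (?R Quot ?P)" for p
      by (auto simp: h_def self_quotient restr_in)
    have h_zero: "h p = \<zero>\<^bsub>?R Quot ?P\<^esub>" if "p \<in> sr (Pow F)" for p
    proof -
      have "restr V p \<in> sr (Pow F)"
        using restr_mem_iff[OF srF sr_Pow_subset] that assms(2) by blast
      then show ?thesis by (simp add: h_def self_quotient coset_eq_iff restr_in)
    qed
    have h_one: "h 1 = \<one>\<^bsub>?R Quot ?P\<^esub>" by (simp add: h_def self_quotient restr_id polys_in_1)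
    define T where "T i = {p. h p \<in> Q i}" for i
    have "k \<le> card F"
    proof (rule prime_chain_length_le[of k T])
      fix i assume "i \<le> k"
      then interpret Qi: primeideal "Q i" "?R Quot ?P" using Q(1) by blast
      have "is_ideal (T i)"
        by (rule is_idealI)
           (auto simp: T_def h_add h_mult h_zero srF ideal_zero Qi.I_l_closed[OF _ h_car] 
             additive_subgroup.zero_closed[OF Qi.additive_subgroup_axioms] additive_subgroup.a_closed[OF Qi.additive_subgroup_axioms])
      moreover have "1 \<notin> T i"
        using Qi.one_imp_carrier Qi.I_notcarr by (auto simp: T_def h_one)
      moreover have "a \<in> T i \<or> b \<in> T i" if "a * b \<in> T i" for a b
        using that Qi.I_prime[OF h_car h_car] by (auto simp: T_def h_mult)
      ultimately show "prime_set (T i)" by (simp add: prime_set_def)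
    next
      fix i assume i: "i < k"
      then interpret Qi: primeideal "Q (Suc i)" "?R Quot ?P" using Q(1) by simp
      obtain X where X: "X \<in> Q (Suc i)" "X \<notin> Q i" using Q(2) i by blast
      then have "X \<in> carrier (?R Quot ?P)" using Qi.Icarr by blast
      then obtain a where a: "a \<in> ?A" "X = coset ?P a" by (auto simp: self_quotient)
      then have "h a = X" by (simp add: h_def restr_id)
      then show "T i \<subset> T (Suc i)" using X Q(2) i by (auto simp: T_def)
    next
      interpret Q0: primeideal "Q 0" "?R Quot ?P" using Q(1) by blast
      show "sr (Pow F) \<subseteq> T 0"
        using h_zero additive_subgroup.zero_closed[OF Q0.additive_subgroup_axioms] by (auto simp: T_def)
    qed (rule assms(1))
    then show "x \<le> enat (card F)" by (simp add: x)
  qed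
  moreover have "enat (card F) \<le> krull_dim (?R Quot ?P)"
  proof -
    \<comment> \<open>A chain of length card F arises by adjoining the variables of F to the prime
      one at a time, in the order of \<open>xs\<close>.\<close>
    obtain xs where xs: "set xs = F" "distinct xs" using finite_distinct_list[OF assms(1)] by blast
    define G where "G i = set (drop i xs)" for i
    have GF: "G i \<subseteq> F" for i using set_drop_subset xs(1) by (force simp: G_def)
    define Q where "Q i = coset ?P ` (sr (Pow (G i)) \<inter> ?A)" for i
    have PG: "?P \<subseteq> sr (Pow (G i)) \<inter> ?A" for i using GF[of i] by (auto simp: sr_def)
    have mem: "coset ?P a \<in> Q i \<longleftrightarrow> a \<in> sr (Pow (G i)) \<inter> ?A" if "a \<in> ?A" for a i
    proof
      assume "coset ?P a \<in> Q i"
      then obtain b where b: "b \<in> sr (Pow (G i))" "a - b \<in> ?P" by (auto simp: Q_def coset_eq_iff)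
      then have "a - b \<in> sr (Pow (G i))" using PG by blast
      then show "a \<in> sr (Pow (G i)) \<inter> ?A"
        using that b ideal_diff_iff[OF ideal_sr[OF down_closed_Pow]] by blast
    qed (auto simp: Q_def)
    have "\<forall>i\<le>card F. primeideal (Q i) (?R Quot ?P)"
    proof (intro allI impI)
      fix i
      have pr: "primeideal (sr (Pow (G i)) \<inter> ?A) ?R"
        using primeideal_Int[OF prime_set_sr_Pow] by (simp add: poly_ring_eq)
      then interpret K: primeideal "sr (Pow (G i)) \<inter> ?A" ?R .
      have id: "ideal (Q i) (?R Quot ?P)"
        using R.ring_ideal_imp_quot_ideal[OF ideal_record K.ideal_axioms] by (simp add: Q_def a_r_coset_record)
      show "primeideal (Q i) (?R Quot ?P)"
      proof (rule primeidealI[OF id])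
        show "cring (?R Quot ?P)" by (rule P.quotient_is_cring) (rule R.cring_axioms)
        have "coset ?P 1 \<in> carrier (?R Quot ?P)" "coset ?P 1 \<notin> Q i"
          by (auto simp: self_quotient polys_in_1 mem) (simp add: sr_def)
        then show "carrier (?R Quot ?P) \<noteq> Q i" by blast
        fix X Y assume "X \<in> carrier (?R Quot ?P)" "Y \<in> carrier (?R Quot ?P)" 
          and XY: "X \<otimes>\<^bsub>?R Quot ?P\<^esub> Y \<in> Q i"
        then obtain a b where ab: "a \<in> ?A" "X = coset ?P a" "b \<in> ?A" "Y = coset ?P b"
          by (auto simp: self_quotient)
        then have "a * b \<in> sr (Pow (G i))" using XY by (simp add: self_quotient mem polys_in_mult)
        then show "X \<in> Q i \<or> Y \<in> Q i" using prime_sr_Pow ab by (auto simp: mem)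
      qed
    qed
    moreover have "\<forall>i<card F. Q i \<subset> Q (Suc i)"
    proof (intro allI impI psubsetI)
      fix i assume "i < card F"
      then have i: "i < length xs" using xs distinct_card by metis
      have "G (Suc i) \<subseteq> G i" by (simp add: G_def set_drop_subset_set_drop)
      then have "sr (Pow (G i)) \<subseteq> sr (Pow (G (Suc i)))" by (auto simp: sr_def)
      then show "Q i \<subseteq> Q (Suc i)" by (auto simp: Q_def)
      have d: "drop i xs = xs ! i # drop (Suc i) xs" using Cons_nth_drop_Suc[OF i] by simp
      then have v: "xs ! i \<in> G i" "xs ! i \<notin> G (Suc i)"
        using distinct_drop[OF xs(2), of i] by (simp_all add: G_def)
      have "xs ! i \<in> V" using i xs(1) assms(2) nth_mem by blast
      then have "Var (xs ! i) \<in> ?A" "Var (xs ! i) \<in> sr (Pow (G (Suc i)))" "Var (xs ! i) \<notin> sr (Pow (G i))"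
        using v by (auto simp: Var_def polys_in_def sr_def)
      then show "Q i \<noteq> Q (Suc i)" using mem by blast
    qed
    ultimately show ?thesis unfolding krull_dim_def by (intro Sup_upper) blast
  qed
  ultimately show ?thesis by (simp add: poly_ring_eq)
qed

section \<open>Depth and initial dimension of the edge ring\<close>

text \<open>The image of J + (rs) is a submodule containing all products. Conversely its elements
  are built up one generator at a time; cofactors, which lie in the large ring, are brought back by
  \<open>restr V\<close>.\<close>

lemma smult_span_quot:
  fixes J :: "'k::field mpoly set"
  assumes J: "is_ideal J" "sr (Pow V) \<subseteq> J" and rs: "set rs \<subseteq> polys_in V"
  shows "smult_span (subring_record (polys_in V))
    (quot_module (self_module (subring_record (polys_in V))) (J \<inter> polys_in V)) (set rs)
    = coset (J \<inter> polys_in V) ` (adjs J rs \<inter> polys_in V)"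
proof -
  let ?A = "polys_in V :: 'k mpoly set"
  let ?I = "J \<inter> ?A"
  let ?R = "subring_record ?A"
  interpret subring_ideal ?A ?I by (rule subring_ideal_Int[OF J(1)])
  have id: "is_ideal (adjs J qs)" for qs by (rule ideal_adjs[OF J(1)])
  have sub: "J \<subseteq> adjs J qs" for qs
    by (induction qs rule: rev_induct) (use subset_adj in auto)
  have gen: "s \<in> adjs J qs" if "s \<in> set qs" for s qs
    using that
  proof (induction qs rule: rev_induct)
    case (snoc r qs)
    have "r * 1 \<in> adj (adjs J qs) r" by (rule mem_adj[OF id])
    then show ?case using snoc subset_adj[of "adjs J qs" r] by auto
  qed simp
  show ?thesis
  proof
    have "s \<odot>\<^bsub>N\<^esub> u \<in> coset ?I ` (adjs J rs \<inter> ?A)" if s: "s \<in> set rs" and u: "u \<in> carrier N" for s u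
    proof -
      obtain a where a: "a \<in> ?A" "u = coset ?I a" using u by (auto simp: carrier_quot)
      have "s * a \<in> adjs J rs" using ideal_mult_right[OF id gen[OF s]] .
      then show ?thesis using s a rs by (auto simp: smult_quot polys_in_mult subsetD)
    qed
    then show "smult_span ?R N (set rs) \<subseteq> coset ?I ` (adjs J rs \<inter> ?A)"
      unfolding smult_span_def using submodule_quot[OF subring_ideal_Int[OF id]]
      by (intro Inter_lower) blast
  next
    show "coset ?I ` (adjs J rs \<inter> ?A) \<subseteq> smult_span ?R N (set rs)"
      unfolding smult_span_def
    proof (rule Inter_greatest)
      fix H assume "H \<in> {H. submodule H ?R N \<and> (\<forall>s\<in>set rs. \<forall>u\<in>carrier N. s \<odot>\<^bsub>N\<^esub> u \<in> H)}"
      then have H: "submodule H ?R N" and g: "\<And>s u. s \<in> set rs \<Longrightarrow> u \<in> carrier N \<Longrightarrow> s \<odot>\<^bsub>N\<^esub> u \<in> H"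
        by auto
      interpret H: subgroup H "add_monoid N" using H by (simp add: submodule_def)
      have "set qs \<subseteq> set rs \<Longrightarrow> p \<in> adjs J qs \<Longrightarrow> coset ?I (restr V p) \<in> H" for qs p
      proof (induction qs arbitrary: p rule: rev_induct)
        case Nil
        then have "restr V p \<in> ?I" using restr_mem_iff[OF J] by (simp add: restr_in)
        then have "coset ?I (restr V p) = \<zero>\<^bsub>N\<^esub>" 
          using coset_eq_iff[of "restr V p" 0] by (simp add: zero_quot coset_0)
        then show ?case using H.one_closed by simp
      next
        case (snoc r qs)
        then have "p \<in> adj (adjs J qs) r" by simp
        then obtain a where a: "p - r * a \<in> adjs J qs" unfolding adj_def[of "adjs J qs" r] by blast
        have r: "r \<in> ?A" "r \<in> set rs" using snoc.prems rs by auto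
        have "restr V p = restr V (p - r * a) + r * restr V a"
          using restr_add[of V "p - r * a" "r * a"] restr_mult[of V r a] restr_id[OF r(1)] by simp
        moreover have "coset ?I (restr V (p - r * a)) \<in> H" using snoc.IH a snoc.prems by simp
        moreover have "coset ?I (restr V a) \<in> carrier N" by (auto simp: carrier_quot restr_in)
        then have "coset ?I (r * restr V a) \<in> H" using g[OF r(2)] smult_quot[OF r(1)] by metis
        ultimately show ?case using H.m_closed[of "coset ?I (restr V (p - r * a))" "coset ?I (r * restr V a)"]
          by (simp add: add_quot)
      qed
      then show "coset ?I ` (adjs J rs \<inter> ?A) \<subseteq> H" using restr_id by fastforce
    qed
  qed
qed

text \<open>Every intermediate ideal contains the variables outside V, so regularity may be tested
  in the large ring. The condition on 1 expresses that the last quotient is nonzero.\<close>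

lemma regular_sequence_quot_iff:
  fixes J :: "'k::field mpoly set"
  assumes J: "is_ideal J" "sr (Pow V) \<subseteq> J"
  shows "regular_sequence (subring_record (polys_in V))
      (quot_module (self_module (subring_record (polys_in V))) (J \<inter> polys_in V)) rs
    \<longleftrightarrow> set rs \<subseteq> polys_in V \<and> weakly_regular J rs \<and> 1 \<notin> adjs J rs"
proof (cases "set rs \<subseteq> polys_in V")
  case rs: True
  let ?A = "polys_in V :: 'k mpoly set"
  let ?I = "J \<inter> ?A"
  interpret subring_ideal ?A ?I by (rule subring_ideal_Int[OF J(1)])
  have id: "is_ideal (adjs J qs)" for qs by (rule ideal_adjs[OF J(1)])
  have sub: "J \<subseteq> adjs J qs" for qs
    by (induction qs rule: rev_induct) (use subset_adj in auto)
  have "nonzerodivisor_on (quot_module N (smult_span (subring_record ?A) N (set (take i rs)))) (rs ! i)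
      \<longleftrightarrow> nzd (adjs J (take i rs)) (rs ! i)" if i: "i < length rs" for i
  proof -
    let ?K = "adjs J (take i rs)"
    have r: "rs ! i \<in> ?A" using rs i nth_mem by blast
    have mem: "restr V p \<in> ?K \<longleftrightarrow> p \<in> ?K" for p using restr_mem_iff[OF id order.trans[OF J(2) sub]] .
    have "set (take i rs) \<subseteq> ?A" using rs set_take_subset by fast
    then have "smult_span (subring_record ?A) N (set (take i rs)) = coset ?I ` (?K \<inter> ?A)"
      by (rule smult_span_quot[OF J])
    moreover have "nonzerodivisor_on (quot_module N (coset ?I ` (?K \<inter> ?A))) (rs ! i)
        \<longleftrightarrow> (\<forall>a\<in>?A. rs ! i * a \<in> ?K \<inter> ?A \<longrightarrow> a \<in> ?K \<inter> ?A)"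
      by (rule nonzerodivisor_on_quot[OF subring_ideal_Int[OF id] _ r]) (use sub in blast)
    moreover have "\<dots> \<longleftrightarrow> nzd ?K (rs ! i)"
    proof
      assume *: "\<forall>a\<in>?A. rs ! i * a \<in> ?K \<inter> ?A \<longrightarrow> a \<in> ?K \<inter> ?A"
      show "nzd ?K (rs ! i)" unfolding nzd_def
      proof (intro allI impI)
        fix u assume "rs ! i * u \<in> ?K"
        then have "rs ! i * restr V u \<in> ?K" 
          using mem[of "rs ! i * u"] restr_mult[of V "rs ! i" u] restr_id[OF r] by simp
        then have "restr V u \<in> ?K" using * restr_in[of V u] polys_in_mult[OF r] by blast
        then show "u \<in> ?K" using mem by blast
      qed
    qed (auto simp: nzd_def)
    ultimately show ?thesis by simp
  qed
  moreover have "coset ?I ` (adjs J rs \<inter> ?A) = coset ?I ` ?A \<longleftrightarrow> 1 \<in> adjs J rs"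
  proof
    assume "coset ?I ` (adjs J rs \<inter> ?A) = coset ?I ` ?A"
    then have "coset ?I 1 \<in> coset ?I ` (adjs J rs \<inter> ?A)" using polys_in_1 by blast
    then obtain a where a: "a \<in> adjs J rs" "1 - a \<in> J" by (auto simp: coset_eq_iff)
    then show "1 \<in> adjs J rs" using ideal_diff_iff[OF id] sub by blast
  next
    assume "1 \<in> adjs J rs"
    then have "a \<in> adjs J rs" for a using ideal_mult[OF id, of 1 rs a] by simp
    then have "adjs J rs \<inter> ?A = ?A" by blast
    then show "coset ?I ` (adjs J rs \<inter> ?A) = coset ?I ` ?A" by simp
  qed
  ultimately show ?thesis
    using rs by (simp add: regular_sequence_def smult_span_quot[OF J rs] carrier_quot weakly_regular_iff_nth)
qed (auto simp: regular_sequence_def)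

section \<open>The edge ring of the cycle\<close>

lemma cyc_subset: "cyc n \<subseteq> Pow {1..n}"
  by (auto simp: cyc_def)

lemma finite_cyc: "finite (cyc n)"
  by (rule finite_subset[OF cyc_subset]) simp

abbreviation cycle_edge_ring :: "nat \<Rightarrow> ('k::field mpoly, 'k mpoly set) module" where
  "cycle_edge_ring n \<equiv> edge_ring (cycle_graph n)"

lemma edge_ring_cycle_graph:
  "n \<ge> 3 \<Longrightarrow> cycle_edge_ring n = quot_module (self_module (subring_record (polys_in {1..n})))
    (sr (cyc n) \<inter> (polys_in {1..n} :: 'k::field mpoly set))"
  unfolding edge_ring_def edge_ideal_cycle_graph by (simp add: cycle_graph_def poly_ring_eq)

lemma regular_sequence_cycle:
  assumes "n \<ge> 3"
  shows "regular_sequence (poly_ring {1..n}) (cycle_edge_ring n) rs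
    \<longleftrightarrow> set rs \<subseteq> polys_in {1..n} \<and> weakly_regular (sr (cyc n) :: 'k::field mpoly set) rs \<and> 1 \<notin> adjs (sr (cyc n)) rs"
  unfolding edge_ring_cycle_graph[OF assms] poly_ring_eq
  by (rule regular_sequence_quot_iff[OF ideal_sr[OF down_closed_cyc] sr_Pow_subset[OF cyc_subset]])

lemma depth_cycle_le:
  assumes "n \<ge> 3" "koszul_nonzero {1..n} Var (sr (cyc n) :: 'k::field mpoly set) d"
  shows "depth (poly_ring {1..n}) (irrelevant_ideal {1..n}) (cycle_edge_ring n :: ('k mpoly, _) module) \<le> enat d"
  unfolding depth_def
proof (rule Sup_least)
  fix x assume "x \<in> {enat (length rs) |rs. set rs \<subseteq> irrelevant_ideal {1..n} \<and>
    regular_sequence (poly_ring {1..n}) (cycle_edge_ring n :: ('k mpoly, _) module) rs}"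
  then obtain rs :: "'k mpoly list" where rs: "x = enat (length rs)" "set rs \<subseteq> irrelevant_ideal {1..n}"
    "weakly_regular (sr (cyc n)) rs" unfolding regular_sequence_cycle[OF assms(1)] by blast
  have "length rs \<le> d"
    by (rule weakly_regular_length_le[OF ideal_sr[OF down_closed_cyc] _ assms(2) rs(3)])
       (use rs(2) irrelevant_ideal_combination[of "{1..n}"] in auto)
  then show "x \<le> enat d" by (simp add: rs(1))
qed

lemma le_depth_cycle:
  assumes "n \<ge> 3" "depth_ge {1..n} d (cyc n)"
  shows "enat d \<le> depth (poly_ring {1..n}) (irrelevant_ideal {1..n}) (cycle_edge_ring n :: ('k::field mpoly, _) module)"
proof -
  let ?rs = "map (esym {1..n}) [1..<Suc d] :: 'k mpoly list"
  have keys: "\<exists>S. S \<subseteq> {1..n} \<and> card S = j \<and> m = chi S" if "m \<in> keys (esym {1..n} j :: 'k mpoly)" for m j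
  proof -
    have "m \<in> (\<Union>S\<in>{S. S \<subseteq> {1..n} \<and> card S = j}. keys (xmon S :: 'k mpoly))"
      by (rule subsetD[OF keys_sum that[unfolded esym_def]])
    then show ?thesis by (auto simp: xmon_def)
  qed
  have in_A: "set ?rs \<subseteq> polys_in {1..n}"
  proof -
    have "esym {1..n} j \<in> (polys_in {1..n} :: 'k mpoly set)" for j unfolding polys_in_def
    proof safe
      fix m v assume m: "m \<in> keys (esym {1..n} j :: 'k mpoly)" and v: "v \<in> keys m"
      obtain S where S: "S \<subseteq> {1..n}" "m = chi S" using keys[OF m] by blast
      then have "keys m = S" using keys_chi finite_subset[OF S(1)] by simp
      then show "v \<in> {1..n}" using v S by blast
    qed
    then show ?thesis by auto
  qed
  have nc: "lookup r 0 = 0" if r: "r \<in> set ?rs" for r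
  proof (rule ccontr)
    obtain j where "j \<in> set [1..<Suc d]" and rj: "r = esym {1..n} j" using r unfolding set_map by blast
    then have j: "j \<ge> 1" by auto
    assume "lookup r 0 \<noteq> 0"
    then have "0 \<in> keys (esym {1..n} j :: 'k mpoly)" by (simp add: in_keys_iff rj)
    then obtain S where S: "S \<subseteq> {1..n}" "card S = j" "0 = chi S" using keys by blast
    then have "deg 0 = j" using deg_chi[of S] by simp
    then show False using j by (simp add: deg_def)
  qed
  have irr: "set ?rs \<subseteq> irrelevant_ideal {1..n}"
    using in_A nc by (auto simp: irrelevant_ideal_eq simp del: upt_Suc set_map)
  \<comment> \<open>All members of the sequence have positive degree, so the ideal stays inside
    \<open>sr {{}}\<close>, the polynomials without constant term.\<close>
  have "adjs (sr (cyc n)) qs \<subseteq> (sr {{}} :: 'k mpoly set)" if "set qs \<subseteq> set ?rs" for qs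
    using that
  proof (induction qs rule: rev_induct)
    case Nil
    have "{} \<in> cyc n" by (auto simp: cyc_def sparse_def)
    then show ?case by (auto simp: sr_def)
  next
    case (snoc r qs)
    have "r \<in> sr {{}}" using nc[of r] snoc.prems by (auto simp: sr_def in_keys_iff simp del: upt_Suc set_map)
    moreover have "is_ideal (sr {{}} :: 'k mpoly set)" by (rule ideal_sr) (simp add: down_closed_def)
    ultimately show ?case using snoc adj_minimal[of "sr {{}}" "adjs (sr (cyc n)) qs" r] by (simp del: upt_Suc)
  qed
  then have "adjs (sr (cyc n)) ?rs \<subseteq> sr {{}}" by blast
  moreover have "1 \<notin> (sr {{}} :: 'k mpoly set)" by (simp add: sr_def)
  ultimately have "1 \<notin> adjs (sr (cyc n)) ?rs" by blast
  moreover have "weakly_regular (sr (cyc n)) ?rs"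
    by (rule depth_ge_imp_weakly_regular[OF _ assms(2)]) simp
  ultimately have "regular_sequence (poly_ring {1..n}) (cycle_edge_ring n) ?rs"
    unfolding regular_sequence_cycle[OF assms(1)] using in_A by blast
  then have "enat (length ?rs) \<le> depth (poly_ring {1..n}) (irrelevant_ideal {1..n}) (cycle_edge_ring n :: ('k mpoly, _) module)"
    unfolding depth_def using irr by (intro Sup_upper) blast
  then show ?thesis by (simp del: upt_Suc)
qed

text \<open>Annihilators of cosets are colon ideals: prime ones come from facets, and the facet F is
  reached by the monomial x_F. The intersection with \<open>UNIV\<close> fixes the coefficient
  type.\<close>

lemma associated_primes_cycle:
  assumes "n \<ge> 3"
  shows "associated_primes (poly_ring {1..n}) (cycle_edge_ring n)
    = {sr (Pow F) \<inter> polys_in {1..n} | F. facet (cyc n) F} \<inter> (UNIV :: 'k::field mpoly set set)"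
proof -
  let ?A = "polys_in {1..n} :: 'k mpoly set"
  let ?J = "sr (cyc n) :: 'k mpoly set"
  have J: "is_ideal ?J" "sr (Pow {1..n}) \<subseteq> ?J"
    by (rule ideal_sr[OF down_closed_cyc], rule sr_Pow_subset[OF cyc_subset])
  interpret subring_ideal ?A "?J \<inter> ?A" by (rule subring_ideal_Int[OF J(1)])
  have ann: "annihilator (subring_record ?A) N (coset (?J \<inter> ?A) a) = colon ?J a \<inter> ?A" if "a \<in> ?A" for a
    unfolding annihilator_quot using that by (auto simp: colon_def mult.commute polys_in_mult)
  have ass: "associated_primes (poly_ring {1..n}) (cycle_edge_ring n) =
      {P. primeideal P (poly_ring {1..n}) \<and> (\<exists>a\<in>?A. P = colon ?J a \<inter> ?A)}"
    unfolding associated_primes_def edge_ring_cycle_graph[OF assms] poly_ring_eq carrier_quot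
    using ann by auto
  have "(\<exists>F. facet (cyc n) F \<and> P = sr (Pow F) \<inter> ?A)" 
    if P: "primeideal P (poly_ring {1..n})" "a \<in> ?A" "P = colon ?J a \<inter> ?A" for P a
  proof -
    interpret P: primeideal P "poly_ring {1..n}" by fact
    have C: "is_ideal (colon ?J a)" by (rule ideal_colon[OF J(1)])
    have sub: "sr (Pow {1..n}) \<subseteq> colon ?J a" using J ideal_mult[OF J(1)] by (auto simp: colon_def)
    have mem: "restr {1..n} p \<in> P \<longleftrightarrow> p \<in> colon ?J a" for p
      using restr_mem_iff[OF C sub] by (simp add: P(3) restr_in)
    have "1 \<notin> colon ?J a"
    proof
      assume "1 \<in> colon ?J a"
      then have "colon ?J a = UNIV" using ideal_mult[OF C, of 1] by auto
      then show False using P.I_notcarr P(3) by (simp add: poly_ring_eq)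
    qed
    moreover have "x \<in> colon ?J a \<or> y \<in> colon ?J a" if "x * y \<in> colon ?J a" for x y
    proof -
      have "restr {1..n} x * restr {1..n} y \<in> P" using that mem[of "x * y"] by (simp add: restr_mult)
      then show ?thesis using P.I_prime[of "restr {1..n} x" "restr {1..n} y"] mem
        by (simp add: poly_ring_eq restr_in)
    qed
    ultimately have "prime_set (colon ?J a)" using C by (simp add: prime_set_def)
    then show ?thesis using prime_colon_sr[OF down_closed_cyc finite_cyc] P(3) by metis
  qed
  moreover have "primeideal (sr (Pow F) \<inter> ?A) (poly_ring {1..n}) \<and> (\<exists>a\<in>?A. sr (Pow F) \<inter> ?A = colon ?J a \<inter> ?A)"
    if F: "facet (cyc n) F" for F
  proof
    have sub: "F \<subseteq> {1..n}" using F cyc_subset by (auto simp: facet_def)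
    then have fin: "finite F" using finite_subset by blast
    have "xmon F \<in> ?A" using sub by (auto simp: polys_in_def xmon_def keys_chi[OF fin])
    then show "\<exists>a\<in>?A. sr (Pow F) \<inter> ?A = colon ?J a \<inter> ?A"
      using colon_sr_facet[OF down_closed_cyc F fin] by metis
  qed (rule primeideal_Int[OF prime_set_sr_Pow])
  ultimately show ?thesis unfolding ass by blast
qed

lemma indim_cycle:
  assumes "n \<ge> 3"
  shows "indim (poly_ring {1..n}) (cycle_edge_ring n :: ('k::field mpoly, _) module) = (INF F\<in>{F. facet (cyc n) F}. enat (card F))"
proof -
  have "krull_dim (poly_ring {1..n} Quot (sr (Pow F) \<inter> (polys_in {1..n} :: 'k mpoly set))) = enat (card F)"
    if F: "facet (cyc n) F" for F
  proof -
    have sub: "F \<subseteq> {1..n}" using F cyc_subset by (auto simp: facet_def)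
    then show ?thesis using krull_dim_quotient finite_subset by blast
  qed
  then have "(\<lambda>P. krull_dim (poly_ring {1..n} Quot P)) ` {sr (Pow F) \<inter> (polys_in {1..n} :: 'k mpoly set) | F. facet (cyc n) F}
    = (\<lambda>F. enat (card F)) ` {F. facet (cyc n) F}"
    by (auto simp: image_iff) metis
  then show ?thesis unfolding indim_def associated_primes_cycle[OF assms] by simp
qed

theorem theorem1p9:
  fixes n :: nat
  assumes "n \<ge> 3"
  shows "initially_Cohen_Macaulay TYPE('k::field) (cycle_graph n) \<longleftrightarrow> \<not> [n = 1] (mod 3)"
proof -
  let ?depth = "depth (poly_ring {1..n}) (irrelevant_ideal {1..n}) (cycle_edge_ring n :: ('k mpoly, _) module)"
  let ?indim = "indim (poly_ring {1..n}) (cycle_edge_ring n :: ('k mpoly, _) module)"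
  define d where "d = (n + 2) div 3"
  have iCM: "initially_Cohen_Macaulay TYPE('k) (cycle_graph n) \<longleftrightarrow> ?depth = ?indim"
    unfolding initially_Cohen_Macaulay_def Let_def by (simp only: cycle_graph_def fst_conv)
  have indim: "enat d \<le> ?indim"
    unfolding indim_cycle[OF assms] using facet_cyc_card[OF assms] by (auto simp: d_def intro!: INF_greatest)
  define k where "k = n div 3"
  have k: "k \<ge> 1" using assms by (simp add: k_def)
  have n: "n = 3 * k + n mod 3" by (simp add: k_def)
  have cong: "[n = 1] (mod 3) \<longleftrightarrow> n mod 3 = 1" by (simp add: cong_def)
  show ?thesis
  proof (cases "n mod 3 = 1")
    case True
    then have n1: "n = 3 * k + 1" using n by simp
    \<comment> \<open>The Koszul class in degree k stays one below the domination bound d = k +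
      1.\<close>
    have "?depth \<le> enat k" by (rule depth_cycle_le[OF assms koszul_nonzero_cyc_mod_1[OF n1 k]])
    moreover have "enat k < enat d" using n1 by (simp add: d_def)
    ultimately have "?depth < ?indim" using indim by (meson le_less_trans less_le_trans)
    then show ?thesis using iCM cong True by simp
  next
    case False
    have "koszul_nonzero {1..n} Var (sr (cyc n) :: 'k mpoly set) d"
    proof (cases "n mod 3 = 0")
      case True
      then have "n = 3 * k" "d = k" using n by (simp_all add: d_def k_def)
      then show ?thesis using koszul_nonzero_cyc_mod_0[OF k] by simp
    next
      case False
      then have n2: "n = 3 * k + 2" using n \<open>n mod 3 \<noteq> 1\<close> by linarith
      then have "d = Suc k" by (simp add: d_def)
      then show ?thesis using koszul_nonzero_cyc_mod_2[OF n2 k] by simp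
    qed
    then have "?depth \<le> enat d" by (rule depth_cycle_le[OF assms])
    moreover have "enat d \<le> ?depth"
      using le_depth_cycle[OF assms depth_ge_cyc[OF assms False]] by (simp add: d_def)
    moreover have "?indim \<le> enat d"
      unfolding indim_cycle[OF assms] d_def
      by (rule INF_lower2[of "prog 1 ((n + 2) div 3)"]) (use facet_prog[OF assms False] in auto)
    ultimately show ?thesis using iCM cong False indim by (auto intro: antisym)
  qed
qed

end
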